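(* Let $f,g:\mathbb{R}\to\mathbb{R}$ be continuous nondecreasing functions, with $f$ positive and strictly increasing, and such that $\lim_{t\to+\infty}f(t)=+\infty$ whenever $\lim_{t\to+\infty}g(t)<+\infty$. Let $\Omega\subset\mathbb{R}^n$ be an open domain with nonempty boundary, let $q\in(0,2]$, and let $u\in USC(\Omega)$ be a viscosity subsolution of $F(x,D^2u)= f(u)+g(u)|Du|^q$ in $\Omega$ (i.e. a viscosity solution of the inequality $F(x,D^2u)\ge f(u)+g(u)|Du|^q$), where $F$ is as in the context. Let $d(x)=\mathrm{dist}(x,\partial\Omega)$. \begin{itemize} \item[(i)] Assume $\lim_{t\to+\infty}g(t)>0$ and that it is NOT the case that [$q\le1$ and $\int_0^{+\infty}\frac{dt}{(t f(t))^{1/2}+(t g^+(t))^{1/(2-q)}}=+\infty$]. Then for all $x\in\Omega$, $$u(x)\le\max\{t_0,\ \mathcal{R}^{-1}(d(x))\},$$ where $t_0=\inf\{t\in\mathbb{R}: g(t)\ge0\}$ and $\mathcal{R}:\mathbb{R}\to(0,+\infty)$ is $$\mathcal{R}(a)=\begin{cases}\displaystyle 2\left(\frac{n}{2-q}\right)^{1/(2-q)}\int_a^{+\infty}\frac{dt}{\left(\int_a^t f(s)\,ds\right)^{1/2}+\left(\int_a^t g^+(s)\,ds\right)^{1/(2-q)}} & \text{if } q<2,\\[2ex] \displaystyle\sqrt{\frac n2}\int_a^{+\infty}\frac{dt}{\left(\int_a^t e^{\frac2n\int_s^t g^+(\tau)\,d\tau}f(s)\,ds\right)^{1/2}} & \text{if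 } q=2.\end{cases}$$ \item[(ii)] Assume $\lim_{t\to+\infty}g(t)=0$ and that $$\int_0^{+\infty}\frac{dt}{\left(\int_0^t e^{-2\int_s^t\left(\frac{g^-(\tau)}{f(\tau)}\right)^{2/q}f(\tau)\,d\tau}f(s)\,ds\right)^{1/2}}<+\infty .$$ Then for all $x\in\Omega$, $u(x)\le\mathcal{R}^{-1}(d(x))$, where $$\mathcal{R}(a)=\frac{n^{1/q}}{\sqrt q}\int_a^{+\infty}\frac{dt}{\left(\int_a^t e^{-2\int_s^t\left(\frac{g^-(r)}{f(r)}\right)^{2/q}f(r)\,dr}f(s)\,ds\right)^{1/2}} .$$ \item[(iii)] Assume $\lim_{t\to+\infty}g(t)<0$ and that $$\int_0^{+\infty}\left[\frac{1}{(t f(t))^{1/2}}+\frac{1}{f(t)^{1/q}}\right]dt<+\infty .$$ Then for all $x\in\Omega$, $u(x)\le\mathcal{R}^{-1}(d(x))$, where $$\mathcal{R}(a)=2\,\frac{n^{1/q}}{q}\int_a^{+\infty}\left[\frac{1}{\left(\int_a^t f(s)\,ds\right)^{1/2}}+\left(\frac{\int_a^t g^-(s)\,ds}{\int_a^t f(s)\,ds}\right)^{1/q}\right]dt .$$ \end{itemize}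
   Context: $\mathcal{S}_n$ is the space of real symmetric $n\times n$ matrices with the usual partial order. $F:\mathbb{R}^n\times\mathcal{S}_n\to\mathbb{R}$ is continuous, satisfies $F(x,O)=0$ for all $x$, and $0\le F(x,X+Y)-F(x,X)\le \mathrm{tr}(Y)$ for all $x\in\mathbb{R}^n$, $X,Y\in\mathcal{S}_n$ with $Y\ge O$. $g^+=\max(g,0)$, $g^-=\max(-g,0)$. $u\in USC(\Omega)$ (upper semicontinuous) is a viscosity solution of $F(x,D^2u)\ge f(u)+g(u)|Du|^q$ in $\Omega$ if for every $x_0\in\Omega$ and every $\phi\in C^2$ such that $u-\phi$ has a local maximum at $x_0$, $F(x_0,D^2\phi(x_0))\ge f(u(x_0))+g(u(x_0))|D\phi(x_0)|^q$. For a strictly decreasing $\mathcal{R}:\mathbb{R}\to(0,+\infty)$ with $\lim_{a\to+\infty}\mathcal{R}(a)=0$ and $b>0$, $\mathcal{R}^{-1}(b)$ denotes the unique $a$ with $\mathcal{R}(a)=b$ if it exists, and $\mathcal{R}^{-1}(b)=-\infty$ otherwise. *)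

theory Defs
  imports "HOL-Analysis.Analysis"
begin

definition sym_mat :: "real^'n^'n \<Rightarrow> bool" where
  "sym_mat X \<longleftrightarrow> transpose X = X"

definition psd_mat :: "real^'n^'n \<Rightarrow> bool" where
  "psd_mat Y \<longleftrightarrow> (\<forall>v. 0 \<le> v \<bullet> (Y *v v))"

definition admissible_F :: "(real^'n \<Rightarrow> real^'n^'n \<Rightarrow> real) \<Rightarrow> bool" where
  "admissible_F F \<longleftrightarrow>
     continuous_on (UNIV \<times> {X. sym_mat X}) (\<lambda>(x, X). F x X) \<and>
     (\<forall>x. F x 0 = 0) \<and>
     (\<forall>x X Y. sym_mat X \<longrightarrow> sym_mat Y \<longrightarrow> psd_mat Y \<longrightarrow>
        0 \<le> F x (X + Y) - F x X \<and> F x (X + Y) - F x X \<le> trace Y)"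

definition pos_part :: "real \<Rightarrow> real" where "pos_part a = max a 0"
definition neg_part :: "real \<Rightarrow> real" where "neg_part a = max (- a) 0"

definition usc_on :: "'a::metric_space set \<Rightarrow> ('a \<Rightarrow> real) \<Rightarrow> bool" where
  "usc_on \<Omega> u \<longleftrightarrow>
     (\<forall>x\<in>\<Omega>. \<forall>e>0. \<exists>d>0. \<forall>y\<in>\<Omega>. dist y x < d \<longrightarrow> u y < u x + e)"

definition C2_fun :: "(real^'n \<Rightarrow> real) \<Rightarrow> (real^'n \<Rightarrow> real^'n) \<Rightarrow> (real^'n \<Rightarrow> real^'n^'n) \<Rightarrow> bool" where
  "C2_fun \<phi> D\<phi> H\<phi> \<longleftrightarrow>
     (\<forall>y. (\<phi> has_derivative (\<lambda>h. D\<phi> y \<bullet> h)) (at y)) \<and>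
     (\<forall>y. (D\<phi> has_derivative (\<lambda>h. H\<phi> y *v h)) (at y)) \<and>
     continuous_on UNIV H\<phi>"

definition visc_subsol ::
  "(real^'n \<Rightarrow> real^'n^'n \<Rightarrow> real) \<Rightarrow> (real \<Rightarrow> real) \<Rightarrow> (real \<Rightarrow> real) \<Rightarrow> real \<Rightarrow>
   (real^'n) set \<Rightarrow> (real^'n \<Rightarrow> real) \<Rightarrow> bool" where
  "visc_subsol F f g q \<Omega> u \<longleftrightarrow>
     (\<forall>x0\<in>\<Omega>. \<forall>\<phi> D\<phi> H\<phi>. C2_fun \<phi> D\<phi> H\<phi> \<longrightarrow>
        (\<exists>r>0. \<forall>y\<in>\<Omega> \<inter> ball x0 r. u y - \<phi> y \<le> u x0 - \<phi> x0) \<longrightarrow>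
        F x0 (H\<phi> x0) \<ge> f (u x0) + g (u x0) * norm (D\<phi> x0) powr q)"

definition R_inv :: "(real \<Rightarrow> ennreal) \<Rightarrow> real \<Rightarrow> ereal" where
  "R_inv R b = (if \<exists>!a. R a = ennreal b then ereal (THE a. R a = ennreal b) else - \<infinity>)"

text \<open>Limit of g at +infinity in the extended reals (exists for nondecreasing g).\<close>
definition lim_top :: "(real \<Rightarrow> real) \<Rightarrow> ereal" where
  "lim_top g = Lim at_top (\<lambda>t. ereal (g t))"

definition R_i :: "nat \<Rightarrow> real \<Rightarrow> (real \<Rightarrow> real) \<Rightarrow> (real \<Rightarrow> real) \<Rightarrow> real \<Rightarrow> ennreal" where
  "R_i n q f g a =
    (if q < 2 then
       ennreal (2 * (real n / (2 - q)) powr (1 / (2 - q))) *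
       (\<integral>\<^sup>+ t \<in> {a<..}. ennreal (1 / (sqrt (integral {a..t} f)
            + (integral {a..t} (\<lambda>s. pos_part (g s))) powr (1 / (2 - q)))) \<partial>lborel)
     else
       ennreal (sqrt (real n / 2)) *
       (\<integral>\<^sup>+ t \<in> {a<..}. ennreal (1 / sqrt (integral {a..t}
            (\<lambda>s. exp (2 / real n * integral {s..t} (\<lambda>\<tau>. pos_part (g \<tau>))) * f s))) \<partial>lborel))"

definition W_ii :: "real \<Rightarrow> (real \<Rightarrow> real) \<Rightarrow> (real \<Rightarrow> real) \<Rightarrow> real \<Rightarrow> real \<Rightarrow> real" where
  "W_ii q f g a t = integral {a..t}
     (\<lambda>s. exp (- 2 * integral {s..t} (\<lambda>r. (neg_part (g r) / f r) powr (2 / q) * f r)) * f s)"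

definition R_ii :: "nat \<Rightarrow> real \<Rightarrow> (real \<Rightarrow> real) \<Rightarrow> (real \<Rightarrow> real) \<Rightarrow> real \<Rightarrow> ennreal" where
  "R_ii n q f g a =
     ennreal (real n powr (1 / q) / sqrt q) *
     (\<integral>\<^sup>+ t \<in> {a<..}. ennreal (1 / sqrt (W_ii q f g a t)) \<partial>lborel)"

definition R_iii :: "nat \<Rightarrow> real \<Rightarrow> (real \<Rightarrow> real) \<Rightarrow> (real \<Rightarrow> real) \<Rightarrow> real \<Rightarrow> ennreal" where
  "R_iii n q f g a =
     ennreal (2 * real n powr (1 / q) / q) *
     (\<integral>\<^sup>+ t \<in> {a<..}. ennreal (1 / sqrt (integral {a..t} f)
        + (integral {a..t} (\<lambda>s. neg_part (g s)) / integral {a..t} f) powr (1 / q)) \<partial>lborel)"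

end

theory Submission
  imports Defs
begin

text \<open>
  Let $d$ be the distance of $x_0$ to the boundary. If $\mathcal R(a) < d$, there is a radial
  supersolution $\varphi(|x - x_0|)$ with $\varphi(0) = a$ that blows up inside the ball of
  radius $d$, and comparison at a maximum of $u - \varphi$ gives $u(x_0) \le a$. Letting $a$
  decrease to $\mathcal R^{-1}(d)$ yields the bound; if $\mathcal R$ does not attain $d$, then
  $\mathcal R(a) < d$ for every $a$, so that no subsolution exists.

  The profile is found by quadrature: $(\varphi')^2 = y(\varphi)$, hence $2 \varphi'' = y'(\varphi)$ and
  the blow-up radius is $\int_a^\infty y^{-1/2}$. It suffices that $\varphi''$ is at most a
  nondecreasing function $v(\varphi)$, since then also $\varphi'/r \le v(\varphi)$, and that
  $y'/2 + (n - 1) v \le f + g y^{q/2}$. With $P = \int_a^t f$, all choices are explicit: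
  $y = \frac 2n P + (\frac{2-q}{n} \int_a^t g^+)^{2/(2-q)}$ with $v = y'/2$ if $q < 2$ in (i),
  multiples of the weighted integrals of $f$ if $q = 2$ and in (ii), and
  $y^{-1/2} = c\,(P^{-1/2} + (\int_a^t g^- / P)^{1/q})$ in (iii); in (ii) and (iii) $v = f/n$.
\<close>

section \<open>Autonomous differential equations\<close>

text \<open>Two obstacles shape the construction. The equation \<phi>' = sqrt (y \<phi>) is
  degenerate at its starting height, since y a = 0, and a function that blows up is not C2 on the
  whole space. So the slope is made the unknown of a nondegenerate equation, and y' is frozen
  outside [a, M] for some M above u: the profile becomes global, and in place of blow-up it only has
  to reach M in time. The formulas for y come from equality cases. With v = y' / 2 the requirement
  is n y' / 2 \<le> f + g y^(q/2); solved with f alone and with g alone, it yields the two summands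
  used for q < 2, and for q = 2 it is linear. In (iii), y is read off from the integrand of the
  radius. Inverting the radius is a separate matter: after the substitution t = a + s it is an
  integral over a fixed half-line of a kernel that decreases in a. The weighted integrals in (i) and
  (ii) solve W' = e W + f, W a = 0, with e nondecreasing, so their growth under translation is
  proved once.\<close>

lemma antiderivative_real:
  fixes k :: "real \<Rightarrow> real"
  assumes "continuous_on UNIV k"
  obtains H where "H c = 0" "\<And>x. (H has_real_derivative k x) (at x)"
proof -
  \<comment> \<open>The oriented integral, unlike the one over \<open>{c..u}\<close>, is an
    antiderivative to the left of c as well.\<close>
  let ?H = "\<lambda>u. LBINT y=ereal c..ereal u. k y"
  have "(?H has_real_derivative k x) (at x)" for x
  proof -
    define a b where "a = min c x - 1" and "b = max c x + 1"
    have "(?H has_vector_derivative k x) (at x within {a..b})"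
      by (rule interval_integral_FTC2) (auto simp: a_def b_def intro: continuous_on_subset[OF assms])
    moreover have "at x within {a..b} = at x"
      by (rule at_within_interior) (auto simp: a_def b_def)
    ultimately show ?thesis
      by (simp add: has_real_derivative_iff_has_vector_derivative)
  qed
  then show thesis by (intro that[of ?H]) auto
qed

lemma DERIV_imp_continuous_on:
  "(\<And>x. (H has_real_derivative h x) (at x)) \<Longrightarrow> continuous_on S H"
  by (meson DERIV_isCont continuous_at_imp_continuous_on)

text \<open>Separation of variables: X is the inverse of the time map T, an antiderivative of 1 / k.
  Since k is positive, continuity is enough; since k \<le> C, T grows at least linearly in both
  directions, so it is onto and X exists for all times.\<close>

lemma autonomous_ode:
  fixes k :: "real \<Rightarrow> real"
  assumes cont: "continuous_on UNIV k" and "0 < c" and bnd: "\<And>x. c \<le> k x" "\<And>x. k x \<le> C"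
  obtains X where "X 0 = x0" "\<And>t. (X has_real_derivative k (X t)) (at t)"
proof -
  have kpos: "k x > 0" for x using bnd(1)[of x] \<open>0 < c\<close> by linarith
  have "C > 0" using kpos[of 0] bnd(2)[of 0] by linarith
  have "continuous_on UNIV (\<lambda>x. 1 / k x)"
    using kpos by (intro continuous_intros cont) (auto simp: less_le)
  then obtain T where T0: "T x0 = 0" and T: "\<And>x. (T has_real_derivative 1 / k x) (at x)"
    using antiderivative_real[of "\<lambda>x. 1 / k x" x0] by metis
  have grow: "T b - T a \<ge> (b - a) / C" if "a \<le> b" for a b
  proof (cases "a = b")
    case False
    then obtain z where "T b - T a = (b - a) * (1 / k z)"
      using MVT2[of a b T "\<lambda>x. 1 / k x"] T \<open>a \<le> b\<close> by (metis less_eq_real_def)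
    moreover have "1 / k z \<ge> 1 / C" using bnd(2)[of z] kpos[of z] by (simp add: frac_le)
    ultimately show ?thesis using that
      by (metis diff_ge_0_iff_ge mult_left_mono times_divide_eq_right mult.right_neutral)
  qed auto
  have contT: "continuous_on S T" for S
    by (rule DERIV_imp_continuous_on[OF T])
  have surj: "\<exists>x. T x = t" for t
  proof -
    define L where "L = C * \<bar>t\<bar>"
    have "L \<ge> 0" using \<open>C > 0\<close> by (simp add: L_def)
    have "T (x0 + L) \<ge> \<bar>t\<bar>" "T (x0 - L) \<le> - \<bar>t\<bar>"
      using grow[of x0 "x0 + L"] grow[of "x0 - L" x0] T0 \<open>L \<ge> 0\<close> \<open>C > 0\<close> by (auto simp: L_def)
    then have "T (x0 - L) \<le> t" "t \<le> T (x0 + L)" by linarith+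
    then show ?thesis using IVT'[of T "x0 - L" t "x0 + L"] contT \<open>L \<ge> 0\<close> by auto
  qed
  define X where "X = (\<lambda>t. SOME x. T x = t)"
  have TX: "T (X t) = t" for t unfolding X_def by (rule someI_ex) (rule surj)
  have inj: "T a = T b \<Longrightarrow> a = b" for a b
    using grow[of a b] grow[of b a] \<open>C > 0\<close>
    by (cases a b rule: linorder_cases) (auto simp: field_simps)
  \<comment> \<open>The growth of T, read backwards, is a Lipschitz bound for X; it supplies the
    continuity that the inverse function rule asks for.\<close>
  have lip: "\<bar>X s - X t\<bar> \<le> C * \<bar>s - t\<bar>" for s t
  proof -
    have "X s \<le> X t \<Longrightarrow> X t - X s \<le> C * (t - s)" "X t \<le> X s \<Longrightarrow> X s - X t \<le> C * (s - t)"
      using grow[of "X s" "X t"] grow[of "X t" "X s"] \<open>C > 0\<close> by (auto simp: TX field_simps)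
    moreover have "C * (t - s) \<le> C * \<bar>s - t\<bar>" "C * (s - t) \<le> C * \<bar>s - t\<bar>"
      using \<open>C > 0\<close> by (auto intro!: mult_left_mono)
    ultimately show ?thesis by linarith
  qed
  have contX: "isCont X t" for t
  proof -
    have "((\<lambda>s. C * \<bar>s - t\<bar>) \<longlongrightarrow> C * \<bar>t - t\<bar>) (at t)" by (intro tendsto_intros)
    then have "((\<lambda>s. X s - X t) \<longlongrightarrow> 0) (at t)"
      using \<open>C > 0\<close> lip[of _ t]
      by (intro Lim_null_comparison[of "\<lambda>s. X s - X t" "\<lambda>s. C * \<bar>s - t\<bar>"] always_eventually) simp_all
    then show ?thesis unfolding isCont_def by (simp add: LIM_zero_iff)
  qed
  have "(X has_real_derivative k (X t)) (at t)" for t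
    using DERIV_inverse_function[of T "1 / k (X t)" X t "t - 1" "t + 1"] T TX contX kpos[of "X t"] by auto
  moreover have "X 0 = x0" using inj[of "X 0" x0] TX T0 by auto
  ultimately show thesis using that by blast
qed

section \<open>Radial functions\<close>

text \<open>The equation \<phi>' = sqrt (y \<phi>) with \<phi> 0 = a also has the constant solution
  a. Taking the slope p as unknown avoids this: with Y the inverse of y, the equation p' = w (Y
  (p^2)) / 2 has a right side bounded away from 0, and \<phi> = Y (p^2) has derivative p. Y itself
  is obtained from Y' = 1 / w Y.\<close>

lemma radial_profile:
  fixes w y :: "real \<Rightarrow> real"
  assumes cont: "continuous_on UNIV w" and "0 < c" and bnd: "\<And>t. c \<le> w t" "\<And>t. w t \<le> C"
    and y0: "y a = 0" and y: "\<And>t. (y has_real_derivative w t) (at t)"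
  obtains \<phi> p where "\<phi> 0 = a" "p 0 = 0"
    "\<And>r. (\<phi> has_real_derivative p r) (at r)"
    "\<And>r. (p has_real_derivative w (\<phi> r) / 2) (at r)"
    "\<And>r. y (\<phi> r) = (p r)\<^sup>2"
proof -
  have wpos: "w t > 0" for t using bnd(1)[of t] \<open>0 < c\<close> by linarith
  have "C > 0" using wpos[of 0] bnd(2)[of 0] by linarith
  have "continuous_on UNIV (\<lambda>x. 1 / w x)"
    using wpos by (intro continuous_intros cont) (auto simp: less_le)
  moreover have "1 / C \<le> 1 / w t" "1 / w t \<le> 1 / c" for t
    using wpos[of t] bnd[of t] \<open>0 < c\<close> by (auto simp: frac_le)
  ultimately obtain Y where Y0: "Y 0 = a" and Y: "\<And>t. (Y has_real_derivative 1 / w (Y t)) (at t)"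
    using autonomous_ode[of "\<lambda>x. 1 / w x" "1 / C" "1 / c" a] \<open>C > 0\<close> by auto
  have contY: "continuous_on S Y" for S
    by (rule DERIV_imp_continuous_on[OF Y])
  have yY: "y (Y s) = s" for s
  proof -
    have "((\<lambda>s. y (Y s) - s) has_real_derivative 0) (at s)" for s
      using wpos[of "Y s"]
      by (auto intro!: derivative_eq_intros DERIV_chain2[OF y Y])
    then have "y (Y s) - s = y (Y 0) - 0" by (intro DERIV_isconst_all) blast
    then show ?thesis using y0 Y0 by simp
  qed
  have "continuous_on UNIV (\<lambda>x. w (Y (x\<^sup>2)) / 2)"
    by (intro continuous_intros continuous_on_compose2[OF cont] continuous_on_compose2[OF contY[of UNIV]]) auto
  then obtain p where p0: "p 0 = 0" and p: "\<And>t. (p has_real_derivative w (Y ((p t)\<^sup>2)) / 2) (at t)"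
    using autonomous_ode[of "\<lambda>x. w (Y (x\<^sup>2)) / 2" "c / 2" "C / 2" 0] bnd \<open>0 < c\<close> by auto
  show thesis
  proof (rule that[of "\<lambda>r. Y ((p r)\<^sup>2)" p])
    show "((\<lambda>r. Y ((p r)\<^sup>2)) has_real_derivative p r) (at r)" for r
    proof -
      have "((\<lambda>r. Y ((p r)\<^sup>2)) has_real_derivative
          1 / w (Y ((p r)\<^sup>2)) * (2 * p r * (w (Y ((p r)\<^sup>2)) / 2))) (at r)"
        by (rule DERIV_chain2[where f=Y, OF Y]) (auto intro!: derivative_eq_intros p)
      then show ?thesis using wpos[of "Y ((p r)\<^sup>2)"] by simp
    qed
  qed (use p0 Y0 p yY in auto)
qed

section \<open>Rank-one matrices and the Hessian of a radial function\<close>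

definition outer :: "real^'n \<Rightarrow> real^'n^'n" where
  "outer z = (\<chi> i j. z $ i * z $ j)"

lemma outer_mult_vec: "outer z *v h = (z \<bullet> h) *\<^sub>R z"
  by (simp add: outer_def matrix_vector_mult_def vec_eq_iff inner_vec_def sum_distrib_left sum_distrib_right mult_ac)

lemma transpose_outer: "transpose (outer z) = outer z"
  by (simp add: outer_def transpose_def vec_eq_iff mult_ac)

lemma trace_outer: "trace (outer z) = (norm z)\<^sup>2"
  by (simp add: outer_def trace_def power2_norm_eq_inner inner_vec_def)

lemma norm_outer_le: "norm (outer z) \<le> real CARD('n) * real CARD('n) * (norm z)\<^sup>2" for z :: "real^'n"
proof -
  have "norm (outer z) \<le> (\<Sum>i\<in>UNIV. norm (outer z $ i))"
    by (simp add: norm_vec_def L2_set_le_sum)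
  also have "\<dots> \<le> (\<Sum>i\<in>(UNIV::'n set). \<Sum>j\<in>(UNIV::'n set). \<bar>outer z $ i $ j\<bar>)"
    by (intro sum_mono norm_le_l1_cart)
  also have "\<dots> \<le> (\<Sum>i\<in>(UNIV::'n set). \<Sum>j\<in>(UNIV::'n set). (norm z)\<^sup>2)"
    by (intro sum_mono) (auto simp: outer_def abs_mult power2_eq_square intro!: mult_mono component_le_norm_cart)
  finally show ?thesis by simp
qed

text \<open>The tangential eigenvalue \<phi>' / r of the Hessian of \<phi>(|x|). In use k is the
  derivative of p, so the value at 0 is the limit of p r / r.\<close>

definition radial_slope :: "(real \<Rightarrow> real) \<Rightarrow> (real \<Rightarrow> real) \<Rightarrow> real \<Rightarrow> real" where
  "radial_slope p k r = (if r = 0 then k 0 else p r / r)"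

text \<open>The eigenvalue is k in the direction of z and \<open>radial_slope\<close> orthogonally
  to it. At z = 0 the quotient is 0 by convention, which leaves k 0 times the identity.\<close>

definition radial_hessian :: "(real \<Rightarrow> real) \<Rightarrow> (real \<Rightarrow> real) \<Rightarrow> real^'n \<Rightarrow> real^'n^'n" where
  "radial_hessian p k z = radial_slope p k (norm z) *\<^sub>R mat 1
     + ((k (norm z) - radial_slope p k (norm z)) / (norm z)\<^sup>2) *\<^sub>R outer z"

lemma radial_hessian_mult_vec:
  "radial_hessian p k z *v h = radial_slope p k (norm z) *\<^sub>R h
     + ((k (norm z) - radial_slope p k (norm z)) / (norm z)\<^sup>2 * (z \<bullet> h)) *\<^sub>R z"
  by (simp add: radial_hessian_def matrix_vector_mult_add_rdistrib scaleR_matrix_vector_assoc [symmetric] outer_mult_vec)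

lemma sym_mat_radial_hessian: "sym_mat (radial_hessian p k z)"
  using transpose_outer[of z]
  by (auto simp: sym_mat_def radial_hessian_def transpose_def vec_eq_iff mat_def)

lemma trace_radial_hessian:
  fixes z :: "real^'n"
  assumes "z \<noteq> 0"
  shows "trace (radial_hessian p k z) = k (norm z) + (real CARD('n) - 1) * radial_slope p k (norm z)"
proof -
  have s: "trace (a *\<^sub>R A + b *\<^sub>R B) = a * trace A + b * trace B" for a b and A B :: "real^'n^'n"
    by (simp add: trace_def sum.distrib sum_distrib_left)
  show ?thesis unfolding radial_hessian_def s trace_outer trace_I using assms
    by (simp add: algebra_simps diff_divide_distrib)
qed

lemma trace_radial_hessian_0:
  "trace (radial_hessian p k (0::real^'n)) = real CARD('n) * k 0"
  by (simp add: radial_hessian_def radial_slope_def outer_def trace_def mat_def)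

text \<open>The number m is the squared length of the projection of v onto z, so the quadratic form
  splits into its tangential part, with |v|^2 - m, and its radial part, with m. For z = 0 the
  convention m = 0 keeps the formula true.\<close>

lemma psd_mat_radial_hessian:
  fixes z :: "real^'n"
  assumes "k (norm z) \<ge> 0" "radial_slope p k (norm z) \<ge> 0"
  shows "psd_mat (radial_hessian p k z)"
  unfolding psd_mat_def
proof
  fix v :: "real^'n"
  define s where "s = radial_slope p k (norm z)"
  define m where "m = (z \<bullet> v)\<^sup>2 / (norm z)\<^sup>2"
  have "(z \<bullet> v)\<^sup>2 \<le> (norm z)\<^sup>2 * (norm v)\<^sup>2"
    using Cauchy_Schwarz_ineq[of z v] by (simp add: power2_norm_eq_inner)
  then have m: "0 \<le> m" "m \<le> (norm v)\<^sup>2"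
    unfolding m_def by (auto simp: divide_le_eq mult.commute)
  have "v \<bullet> (radial_hessian p k z *v v) = s * ((norm v)\<^sup>2 - m) + k (norm z) * m"
    unfolding radial_hessian_mult_vec m_def s_def[symmetric]
    by (simp add: inner_add_right dot_square_norm inner_commute algebra_simps power2_eq_square diff_divide_distrib)
  also have "\<dots> \<ge> 0" using assms m by (simp add: s_def)
  finally show "0 \<le> v \<bullet> (radial_hessian p k z *v v)" .
qed

section \<open>Radial functions as C2 test functions\<close>

context
  fixes \<phi> p k :: "real \<Rightarrow> real"
  assumes \<phi>: "\<And>r. (\<phi> has_real_derivative p r) (at r)"
    and p: "\<And>r. (p has_real_derivative k r) (at r)"
    and p0: "p 0 = 0" and k: "continuous_on UNIV k"
begin

lemma radial_slope_0: "radial_slope p k 0 = k 0"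
  by (simp add: radial_slope_def)

lemma radial_slope_tendsto: "(radial_slope p k \<longlongrightarrow> k 0) (at 0)"
proof -
  have "((\<lambda>h. (p (0 + h) - p 0) / h) \<longlongrightarrow> k 0) (at 0)"
    using p[of 0] unfolding DERIV_def .
  then show ?thesis
    by (rule Lim_transform_eventually) (auto simp: radial_slope_def p0 eventually_at_filter)
qed

lemma isCont_radial_slope: "isCont (radial_slope p k) r"
proof (cases "r = 0")
  case True
  then show ?thesis using radial_slope_tendsto by (simp add: isCont_def radial_slope_def)
next
  case False
  have "isCont (\<lambda>r. p r / r) r" using False DERIV_isCont[OF p] by (intro continuous_intros) auto
  moreover have "\<forall>\<^sub>F x in nhds r. radial_slope p k x = p x / x"
    using t1_space_nhds[OF False] by eventually_elim (auto simp: radial_slope_def)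
  ultimately show ?thesis using isCont_cong[of "radial_slope p k" "\<lambda>x. p x / x" r] by auto
qed

text \<open>Only the origin is delicate. The coefficient of the rank-one term contains 1 / |z|^2,
  but \<open>norm_outer_le\<close> gives this factor back, so the term is at most a multiple of |k -
  p / r|, which tends to 0.\<close>

lemma continuous_on_radial_hessian: "continuous_on UNIV (radial_hessian p k :: real^'n \<Rightarrow> _)"
proof (rule continuous_at_imp_continuous_on, rule ballI)
  fix z :: "real^'n"
  have sl: "isCont (\<lambda>z. radial_slope p k (norm z)) z" for z :: "real^'n"
    by (rule isCont_o2[OF _ isCont_radial_slope]) (intro continuous_intros)
  have kn: "isCont (\<lambda>z. k (norm z)) z" for z :: "real^'n"
    by (rule isCont_o2[where g=k]) (use k in \<open>auto intro!: continuous_intros simp: continuous_on_eq_continuous_at\<close>)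
  have out: "isCont outer z" for z :: "real^'n"
    unfolding isCont_def outer_def by (intro vec_tendstoI) (auto intro!: tendsto_intros)
  show "isCont (radial_hessian p k) z"
  proof (cases "z = 0")
    case False
    then show ?thesis unfolding radial_hessian_def by (intro continuous_intros sl kn out) auto
  next
    case True
    let ?b = "\<lambda>z::real^'n. (k (norm z) - radial_slope p k (norm z)) / (norm z)\<^sup>2"
    let ?N = "real CARD('n) * real CARD('n)"
    let ?d = "\<lambda>z::real^'n. \<bar>k (norm z) - radial_slope p k (norm z)\<bar> * ?N"
    have le: "norm (?b z *\<^sub>R outer z) \<le> ?d z" for z
    proof -
      have "norm (?b z *\<^sub>R outer z) \<le> \<bar>?b z\<bar> * (?N * (norm z)\<^sup>2)"
        unfolding norm_scaleR by (rule mult_left_mono[OF norm_outer_le]) simp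
      also have "\<dots> \<le> ?d z" by (cases "z = 0") (auto simp: abs_divide)
      finally show ?thesis .
    qed
    have "(?d \<longlongrightarrow> ?d 0) (at 0)"
      by (intro tendsto_intros isContD[OF kn] isContD[OF sl])
    then have "(?d \<longlongrightarrow> 0) (at 0)" by (simp only: norm_zero radial_slope_0) simp
    with le have "((\<lambda>z. ?b z *\<^sub>R outer z) \<longlongrightarrow> 0) (at 0)"
      using Lim_null_comparison[OF always_eventually, of "\<lambda>z. ?b z *\<^sub>R outer z" ?d "at 0"] by metis
    then have "(radial_hessian p k \<longlongrightarrow> radial_slope p k (norm (0::real^'n)) *\<^sub>R mat 1 + 0) (at (0::real^'n))"
      unfolding radial_hessian_def by (intro tendsto_intros isContD[OF sl])
    then show ?thesis using True by (simp add: isCont_def radial_hessian_def)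
  qed
qed

text \<open>The norm is not differentiable at 0; there p 0 = 0 makes \<phi>(|x|) - \<phi>(0) of
  smaller order than |x|.\<close>

lemma radial_gradient:
  "((\<lambda>x. \<phi> (norm (x::real^'n))) has_derivative (\<lambda>h. (radial_slope p k (norm z) *\<^sub>R z) \<bullet> h)) (at z)"
proof (cases "z = 0")
  case True
  have "((\<lambda>h. (\<phi> h - \<phi> 0) / h) \<longlongrightarrow> 0) (at 0)"
    using \<phi>[of 0] by (simp add: DERIV_def p0)
  then have "((\<lambda>h. norm ((\<phi> h - \<phi> 0) / h)) \<longlongrightarrow> 0) (at 0)" by (rule tendsto_norm_zero)
  moreover have "filterlim (\<lambda>h::real^'n. norm h) (at 0) (at 0)"
    unfolding filterlim_at using tendsto_norm_zero[OF tendsto_ident_at]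
    by (simp add: eventually_at_filter)
  ultimately have "((\<lambda>h::real^'n. norm ((\<phi> (norm h) - \<phi> 0) / norm h)) \<longlongrightarrow> 0) (at 0)"
    by (rule filterlim_compose[where f="\<lambda>h::real^'n. norm h"])
  then show ?thesis using True by (simp add: has_derivative_at)
next
  case False
  have "((\<lambda>x. \<phi> (norm (x::real^'n))) has_derivative (\<lambda>h. p (norm z) * (sgn z \<bullet> h))) (at z)"
    using has_derivative_compose[OF has_derivative_norm[OF False] has_field_derivative_imp_has_derivative[OF \<phi>[of "norm z"]]]
    by (simp add: inner_commute)
  then show ?thesis
    using False by (simp add: radial_slope_def sgn_div_norm divide_inverse mult_ac)
qed

lemma radial_hessian_derivative:
  "((\<lambda>x. radial_slope p k (norm x) *\<^sub>R x) has_derivative (\<lambda>h. radial_hessian p k z *v h)) (at (z::real^'n))"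
proof (cases "z = 0")
  case True
  let ?s = "\<lambda>z::real^'n. radial_slope p k (norm z)"
  have "isCont ?s 0"
    by (rule isCont_o2[OF _ isCont_radial_slope]) (intro continuous_intros)
  then have "((\<lambda>h. ?s h - k 0) \<longlongrightarrow> 0) (at 0)"
    by (simp add: isCont_def LIM_zero_iff radial_slope_def)
  then have "((\<lambda>h. norm (?s h - k 0)) \<longlongrightarrow> 0) (at 0)" by (rule tendsto_norm_zero)
  then have "((\<lambda>h. norm (?s h *\<^sub>R h - k 0 *\<^sub>R h) / norm h) \<longlongrightarrow> 0) (at 0)"
    by (rule Lim_transform_eventually)
      (simp add: eventually_at_filter flip: scaleR_diff_left)
  moreover have "bounded_linear (\<lambda>h::real^'n. k 0 *\<^sub>R h)" by (rule bounded_linear_scaleR_right)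
  ultimately show ?thesis
    using True by (simp add: has_derivative_at radial_hessian_mult_vec radial_slope_0)
next
  case False
  then have nz: "norm z \<noteq> 0" by simp
  have d: "((\<lambda>r. p r / r) has_real_derivative (k (norm z) - p (norm z) / norm z) / norm z) (at (norm z))"
    using DERIV_divide[OF p DERIV_ident nz] nz by (simp add: diff_divide_distrib)
  have "((\<lambda>x::real^'n. (p (norm x) / norm x) *\<^sub>R x) has_derivative
     (\<lambda>h. (p (norm z) / norm z) *\<^sub>R h + ((k (norm z) - p (norm z) / norm z) / norm z * (sgn z \<bullet> h)) *\<^sub>R z)) (at z)"
    using has_derivative_scaleR[OF has_derivative_compose[OF has_derivative_norm[OF False] d[unfolded has_field_derivative_def]] has_derivative_ident]
    by (simp add: inner_commute)
  then have "((\<lambda>x::real^'n. (p (norm x) / norm x) *\<^sub>R x) has_derivative (\<lambda>h. radial_hessian p k z *v h)) (at z)"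
    using False by (simp add: radial_hessian_mult_vec radial_slope_def sgn_div_norm power2_eq_square divide_inverse mult_ac)
  then show ?thesis
    by (rule has_derivative_transform_within_open[where s="- {0}"]) (use False in \<open>auto simp: radial_slope_def\<close>)
qed

lemma C2_fun_radial:
  fixes x0 :: "real^'n"
  shows "C2_fun (\<lambda>x. \<phi> (norm (x - x0))) (\<lambda>x. radial_slope p k (norm (x - x0)) *\<^sub>R (x - x0))
           (\<lambda>x. radial_hessian p k (x - x0))"
proof -
  have s: "((\<lambda>x. x - x0) has_derivative (\<lambda>h. h)) (at x)" for x
    by (auto intro!: derivative_eq_intros)
  show ?thesis unfolding C2_fun_def
  proof (intro conjI allI)
    show "((\<lambda>x. \<phi> (norm (x - x0))) has_derivative (\<bullet>) (radial_slope p k (norm (y - x0)) *\<^sub>R (y - x0))) (at y)" for y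
      by (rule has_derivative_compose[OF s radial_gradient])
    show "((\<lambda>x. radial_slope p k (norm (x - x0)) *\<^sub>R (x - x0)) has_derivative (*v) (radial_hessian p k (y - x0))) (at y)" for y
      by (rule has_derivative_compose[OF s radial_hessian_derivative])
    show "continuous_on UNIV (\<lambda>x. radial_hessian p k (x - x0))"
      by (auto intro!: continuous_on_compose2[OF continuous_on_radial_hessian] continuous_intros)
  qed
qed

end

section \<open>Comparison with radial supersolutions\<close>

text \<open>Without a maximum, each x has a point m x of larger value, and by semicontinuity h stays
  below h (m x) near x. In a finite subcover take the centre with the largest h (m x): this m x lies
  in some neighbourhood of the cover, so its value would be below that largest one.\<close>

lemma usc_on_attains_sup:
  fixes h :: "'a::metric_space \<Rightarrow> real"
  assumes "compact S" "S \<noteq> {}" "usc_on S h"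
  obtains x where "x \<in> S" "\<And>y. y \<in> S \<Longrightarrow> h y \<le> h x"
proof (rule ccontr)
  assume "\<not> thesis"
  with that have "\<forall>x\<in>S. \<exists>y\<in>S. h x < h y" by force
  then obtain m where m: "\<And>x. x \<in> S \<Longrightarrow> m x \<in> S" "\<And>x. x \<in> S \<Longrightarrow> h x < h (m x)" by metis
  have "\<forall>x\<in>S. \<exists>d>0. \<forall>z\<in>S. dist z x < d \<longrightarrow> h z < h (m x)"
  proof
    fix x assume "x \<in> S"
    then show "\<exists>d>0. \<forall>z\<in>S. dist z x < d \<longrightarrow> h z < h (m x)"
      using assms(3) m(2)[of x] unfolding usc_on_def
      by (metis add.commute diff_add_cancel diff_gt_0_iff_gt)
  qed
  then obtain d where d: "\<And>x. x \<in> S \<Longrightarrow> d x > 0"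
    "\<And>x z. x \<in> S \<Longrightarrow> z \<in> S \<Longrightarrow> dist z x < d x \<Longrightarrow> h z < h (m x)" by metis
  have "S \<subseteq> (\<Union>x\<in>S. ball x (d x))" using d(1) by force
  then obtain D where D: "D \<subseteq> S" "finite D" "S \<subseteq> (\<Union>x\<in>D. ball x (d x))"
    using compactE_image[OF \<open>compact S\<close>, of S "\<lambda>x. ball x (d x)"] by auto
  have "D \<noteq> {}" using D(3) \<open>S \<noteq> {}\<close> by auto
  then have "Max ((\<lambda>x. h (m x)) ` D) \<in> (\<lambda>x. h (m x)) ` D" using D(2) by (intro Max_in) auto
  then obtain x where x: "x \<in> D" "Max ((\<lambda>x. h (m x)) ` D) = h (m x)" by auto
  have max: "h (m z) \<le> h (m x)" if "z \<in> D" for z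
    unfolding x(2)[symmetric] using that D(2) by (intro Max_ge) auto
  have "m x \<in> S" using x(1) D(1) m(1) by auto
  then obtain z where z: "z \<in> D" "dist (m x) z < d z"
    using D(3) by (auto simp: dist_commute)
  then show False using d(2)[of z "m x"] max[of z] D(1) \<open>m x \<in> S\<close> by force
qed

lemma usc_on_subset: "usc_on S h \<Longrightarrow> T \<subseteq> S \<Longrightarrow> usc_on T h"
  unfolding usc_on_def by blast

lemma usc_on_diff_continuous:
  fixes h :: "'a::metric_space \<Rightarrow> real"
  assumes "usc_on S h" "continuous_on S k"
  shows "usc_on S (\<lambda>x. h x - k x)"
  unfolding usc_on_def
proof (intro ballI allI impI)
  fix x :: 'a and e :: real assume x: "x \<in> S" and e: "e > 0"
  obtain d1 where d1: "d1 > 0" "\<And>y. y \<in> S \<Longrightarrow> dist y x < d1 \<Longrightarrow> h y < h x + e / 2"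
    using assms(1) x e unfolding usc_on_def by (metis half_gt_zero)
  obtain d2 where d2: "d2 > 0" "\<And>y. y \<in> S \<Longrightarrow> dist y x < d2 \<Longrightarrow> dist (k y) (k x) < e / 2"
    using assms(2) x e unfolding continuous_on_iff by (metis half_gt_zero)
  have "h y - k y < h x - k x + e" if "y \<in> S" "dist y x < min d1 d2" for y
    using d1(2)[OF that(1)] d2(2)[OF that(1)] that(2) by (auto simp: dist_real_def abs_if split: if_splits)
  then show "\<exists>d>0. \<forall>y\<in>S. dist y x < d \<longrightarrow> h y - k y < h x - k x + e"
    using d1(1) d2(1) by (intro exI[of _ "min d1 d2"]) auto
qed

lemma admissible_F_le_trace:
  assumes "admissible_F F" "sym_mat X" "psd_mat X"
  shows "F x X \<le> trace X"
proof -
  have "sym_mat (0 :: real^'n^'n)" by (simp add: sym_mat_def transpose_def vec_eq_iff)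
  then have "F x (0 + X) - F x 0 \<le> trace X" using assms unfolding admissible_F_def by blast
  then show ?thesis using assms(1) by (simp add: admissible_F_def)
qed

text \<open>Suppose u x0 > \<phi> 0 and let u - \<phi> be maximal at x1. There u > \<phi>, and u < M
  \<le> \<phi> R keeps x1 off the sphere. The right side of the equation at height u x1 exceeds the
  one at height \<phi>, strictly because f is strictly increasing, and this contradicts
  \<open>super\<close>. Only heights below M are tested, which is what permits a truncated
  profile.\<close>

lemma radial_comparison:
  fixes u :: "real^'n \<Rightarrow> real"
  assumes f: "strict_mono f" and g: "mono g" and F: "admissible_F F"
    and usc: "usc_on \<Omega> u" and sub: "visc_subsol F f g q \<Omega> u"
    and R: "R > 0" "cball x0 R \<subseteq> \<Omega>"
    and \<phi>: "\<And>r. (\<phi> has_real_derivative p r) (at r)"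
    and p: "\<And>r. (p has_real_derivative k r) (at r)"
    and p0: "p 0 = 0" and k: "continuous_on UNIV k"
    and nonneg: "\<And>r. r \<ge> 0 \<Longrightarrow> p r \<ge> 0" "\<And>r. r \<ge> 0 \<Longrightarrow> k r \<ge> 0"
    and M: "\<And>x. x \<in> cball x0 R \<Longrightarrow> u x < M" "M \<le> \<phi> R"
    and super: "\<And>r. 0 \<le> r \<Longrightarrow> \<phi> r < M \<Longrightarrow>
      k r + (real CARD('n) - 1) * radial_slope p k r \<le> f (\<phi> r) + g (\<phi> r) * p r powr q"
  shows "u x0 \<le> \<phi> 0"
proof (rule ccontr)
  assume neg: "\<not> u x0 \<le> \<phi> 0"
  let ?\<Phi> = "\<lambda>x. \<phi> (norm (x - x0))"
  have C2: "C2_fun ?\<Phi> (\<lambda>x. radial_slope p k (norm (x - x0)) *\<^sub>R (x - x0)) (\<lambda>x. radial_hessian p k (x - x0))"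
    using C2_fun_radial[OF \<phi> p p0 k] .
  have cont: "continuous_on S ?\<Phi>" for S
    using C2 unfolding C2_fun_def
    by (meson continuous_at_imp_continuous_on has_derivative_continuous)
  obtain x1 where x1: "x1 \<in> cball x0 R" "\<And>x. x \<in> cball x0 R \<Longrightarrow> u x - ?\<Phi> x \<le> u x1 - ?\<Phi> x1"
    using usc_on_attains_sup[of "cball x0 R" "\<lambda>x. u x - ?\<Phi> x"]
      usc_on_diff_continuous[OF usc_on_subset[OF usc R(2)] cont] R(1) by auto
  define z where "z = x1 - x0"
  define r where "r = norm z"
  have "u x1 - \<phi> r > 0" using x1(2)[of x0] R(1) neg by (simp add: r_def z_def)
  then have less: "\<phi> r < u x1" "\<phi> r < M" using M(1)[OF x1(1)] by auto
  have "r \<noteq> R" using less(2) M(2) by auto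
  then have "dist x0 x1 < R" using x1(1) by (simp add: r_def z_def dist_norm norm_minus_commute)
  then have "\<exists>e>0. \<forall>y\<in>\<Omega> \<inter> ball x1 e. u y - ?\<Phi> y \<le> u x1 - ?\<Phi> x1"
  proof (intro exI conjI ballI)
    fix y assume "y \<in> \<Omega> \<inter> ball x1 (R - dist x0 x1)"
    then have "y \<in> cball x0 R" using dist_triangle[of x0 y x1] by simp
    then show "u y - ?\<Phi> y \<le> u x1 - ?\<Phi> x1" by (rule x1(2))
  qed simp
  then have "F x1 (radial_hessian p k z) \<ge> f (u x1) + g (u x1) * norm (radial_slope p k r *\<^sub>R z) powr q"
    using sub C2 x1(1) R(2) unfolding visc_subsol_def z_def r_def by blast
  moreover have "norm (radial_slope p k r *\<^sub>R z) = p r"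
    using nonneg(1)[of r] p0 by (auto simp: r_def radial_slope_def)
  moreover have sl: "radial_slope p k r \<ge> 0"
    using nonneg[of r] by (auto simp: r_def radial_slope_def)
  \<comment> \<open>All eigenvalues are nonnegative, so comparing with the zero matrix bounds F by
    the trace; this is all that is used about F.\<close>
  then have "F x1 (radial_hessian p k z) \<le> trace (radial_hessian p k z)"
    using nonneg(2)[of r]
    by (intro admissible_F_le_trace[OF F] sym_mat_radial_hessian psd_mat_radial_hessian) (auto simp: r_def)
  moreover have "trace (radial_hessian p k z) = k r + (real CARD('n) - 1) * radial_slope p k r"
    by (cases "z = 0") (auto simp: r_def trace_radial_hessian trace_radial_hessian_0 radial_slope_def algebra_simps)
  moreover have "g (u x1) * p r powr q \<ge> g (\<phi> r) * p r powr q"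
    using less(1) by (intro mult_right_mono monoD[OF g]) auto
  moreover have "f (\<phi> r) < f (u x1)" using strict_monoD[OF f less(1)] .
  moreover have "r \<ge> 0" by (simp add: r_def)
  ultimately show False using super[OF _ less(2)] by force
qed

lemma power2_powr_half: "0 \<le> x \<Longrightarrow> (x\<^sup>2) powr (q / 2) = x powr q" for x q :: real
  by (cases "x = 0") (auto simp: powr_powr simp flip: powr_numeral)

text \<open>Reduces every case to a choice of y and v. The nondecreasing majorant v of w / 2 serves
  to control the tangential eigenvalue p r / r, an average of w (\<phi> s) / 2 over s \<le> r, by a
  quantity at the height \<phi> r itself.\<close>

lemma blow_up_bound:
  fixes u :: "real^'n \<Rightarrow> real" and y w v :: "real \<Rightarrow> real"
  assumes f: "strict_mono f" and g: "mono g" and F: "admissible_F F"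
    and usc: "usc_on \<Omega> u" and sub: "visc_subsol F f g q \<Omega> u"
    and ball: "ball x0 d \<subseteq> \<Omega>"
    and w: "continuous_on {a..} w" "\<And>t. t \<ge> a \<Longrightarrow> w t > 0"
    and y: "y a = 0" "\<And>t. t \<ge> a \<Longrightarrow> (y has_real_derivative w t) (at t within {a..})"
    and v: "mono_on {a..} v" "\<And>t. t \<ge> a \<Longrightarrow> w t / 2 \<le> v t"
    and super: "\<And>t. t \<ge> a \<Longrightarrow> w t / 2 + (real CARD('n) - 1) * v t \<le> f t + g t * y t powr (q / 2)"
    and R: "(\<integral>\<^sup>+ t \<in> {a<..}. ennreal (1 / sqrt (y t)) \<partial>lborel) < ennreal d"
  shows "u x0 \<le> a"
proof -
  \<comment> \<open>The radius d' must be below d, so that the closed ball lies in \<Omega> and u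
    has a maximum on it, and above the blow-up radius, so that the profile passes M before
    d'.\<close>
  obtain e where e: "(\<integral>\<^sup>+ t \<in> {a<..}. ennreal (1 / sqrt (y t)) \<partial>lborel) < e" "e < ennreal d"
    using dense[OF R] by auto
  define d' where "d' = enn2real e"
  have "e < top" using e(2) by (metis ennreal_less_top less_trans)
  then have e_eq: "e = ennreal d'" by (simp add: d'_def ennreal_enn2real_if)
  have "e > 0" using e(1) by (rule le_less_trans[OF zero_le])
  then have d': "0 < d'" by (simp add: e_eq)
  then have "d' < d" using e(2) by (simp add: e_eq ennreal_less_iff)
  note d' = d' this
  have cb: "cball x0 d' \<subseteq> \<Omega>" using ball d' by auto
  obtain xm where xm: "\<And>x. x \<in> cball x0 d' \<Longrightarrow> u x \<le> u xm"
    using usc_on_attains_sup[of "cball x0 d'" u] usc_on_subset[OF usc cb] d' by auto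
  define M where "M = max (u xm) a + 1"
  have M: "\<And>x. x \<in> cball x0 d' \<Longrightarrow> u x < M" "a < M"
    using xm by (fastforce simp: M_def)+

  \<comment> \<open>Freezing w outside [a, M] makes it bounded and bounded away from 0, hence the
    profile global. Below the height M nothing changes.\<close>
  define wc where "wc = (\<lambda>t. w (max a (min t M)))"
  have wc_eq: "wc t = w t" if "a \<le> t" "t \<le> M" for t
    using that by (simp add: wc_def)
  have wc: "continuous_on UNIV wc" unfolding wc_def
    by (intro continuous_on_compose2[OF w(1)] continuous_intros) auto
  have wM: "continuous_on {a..M} w" by (rule continuous_on_subset[OF w(1)]) auto
  obtain tc where tc: "tc \<in> {a..M}" "\<And>t. t \<in> {a..M} \<Longrightarrow> w tc \<le> w t"
    using continuous_attains_inf[OF compact_Icc _ wM] M(2) by auto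
  obtain tC where tC: "tC \<in> {a..M}" "\<And>t. t \<in> {a..M} \<Longrightarrow> w t \<le> w tC"
    using continuous_attains_sup[OF compact_Icc _ wM] M(2) by auto
  have clamp: "max a (min t M) \<in> {a..M}" for t using M(2) by auto
  have wcpos: "wc t > 0" for t using w(2) clamp[of t] by (simp add: wc_def)
  obtain yc where yc: "yc a = 0" "\<And>t. (yc has_real_derivative wc t) (at t)"
    using antiderivative_real[OF wc] by metis
  have yc_eq: "yc t = y t" if "a \<le> t" "t \<le> M" for t
  proof -
    have "((\<lambda>t. yc t - y t) has_real_derivative 0) (at t within {a..M})" if "t \<in> {a..M}" for t
      using that DERIV_subset[OF y(2)[of t], of "{a..M}"] has_field_derivative_at_within[OF yc(2)[of t], of "{a..M}"]
      by (auto intro!: derivative_eq_intros simp: wc_eq)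
    then obtain c where "\<forall>t\<in>{a..M}. yc t - y t = c"
      using has_field_derivative_zero_constant[of "{a..M}" "\<lambda>t. yc t - y t"] by auto
    from this[rule_format, of t] this[rule_format, of a] show ?thesis using that y(1) yc(1) by simp
  qed
  obtain \<phi> p where \<phi>0: "\<phi> 0 = a" and p0: "p 0 = 0"
    and \<phi>: "\<And>r. (\<phi> has_real_derivative p r) (at r)"
    and p: "\<And>r. (p has_real_derivative wc (\<phi> r) / 2) (at r)"
    and y\<phi>: "\<And>r. yc (\<phi> r) = (p r)\<^sup>2"
    using radial_profile[of wc "w tc" "w tC" yc a, OF wc] w(2) tc tC clamp yc
    unfolding wc_def by auto
  have p_pos: "p r > 0" if "r > 0" for r
    using DERIV_pos_imp_increasing[of 0 r p] p wcpos that p0 by fastforce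
  have p_nonneg: "p r \<ge> 0" if "r \<ge> 0" for r
    using p_pos[of r] p0 that by (cases "r = 0") auto
  have \<phi>_mono: "\<phi> r \<le> \<phi> s" if "0 \<le> r" "r \<le> s" for r s
    using DERIV_nonneg_imp_nondecreasing[of r s \<phi>] \<phi> p_nonneg that by force
  have \<phi>_ge: "a \<le> \<phi> r" if "0 \<le> r" for r using \<phi>_mono[of 0 r] \<phi>0 that by simp
  have cont: "continuous_on S \<phi>" "continuous_on S p" "continuous_on S yc" for S
    by (rule DERIV_imp_continuous_on, rule \<phi> p yc(2))+

  \<comment> \<open>Otherwise the substitution t = \<phi> r shows that the integral of 1 / sqrt y
    from a to \<phi> d' equals d', which is more than the integral up to \<infinity>.\<close>
  have "M \<le> \<phi> d'"
  proof (rule ccontr)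
    assume "\<not> M \<le> \<phi> d'"
    then have lt: "\<phi> d' < M" by simp
    have [measurable]: "yc \<in> borel_measurable borel" by (intro borel_measurable_continuous_onI cont)
    have "(\<integral>\<^sup>+t. ennreal (1 / sqrt (yc t) * indicator {\<phi> 0..\<phi> d'} t) \<partial>lborel)
        = (\<integral>\<^sup>+r. ennreal (1 / sqrt (yc (\<phi> r)) * p r * indicator {0..d'} r) \<partial>lborel)"
      by (rule nn_integral_substitution)
         (use \<phi> p_nonneg cont d' in \<open>auto simp: set_borel_measurable_def\<close>)
    \<comment> \<open>At r = 0 the integrand is 0 by the convention for division by 0, and not 1;
      hence equality almost everywhere only.\<close>
    also have "\<dots> = (\<integral>\<^sup>+r. indicator {0..d'} r \<partial>lborel)"
    proof (rule nn_integral_cong_AE)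
      show "AE r in lborel. ennreal (1 / sqrt (yc (\<phi> r)) * p r * indicator {0..d'} r) = indicator {0..d'} r"
        using AE_lborel_singleton[of "0::real"]
      proof eventually_elim
        case (elim r)
        then show ?case using p_pos[of r] by (auto simp: y\<phi> indicator_def)
      qed
    qed
    also have "\<dots> = e" using d' by (simp add: e_eq)
    finally have "e = (\<integral>\<^sup>+t. ennreal (1 / sqrt (yc t) * indicator {\<phi> 0..\<phi> d'} t) \<partial>lborel)" ..
    also have "\<dots> \<le> (\<integral>\<^sup>+ t \<in> {a<..}. ennreal (1 / sqrt (y t)) \<partial>lborel)"
    proof (rule nn_integral_mono)
      fix t
      show "ennreal (1 / sqrt (yc t) * indicator {\<phi> 0..\<phi> d'} t) \<le> ennreal (1 / sqrt (y t)) * indicator {a<..} t"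
        using lt by (cases "t = a") (auto simp: indicator_def \<phi>0 yc(1) yc_eq)
    qed
    finally show False using e(1) by simp
  qed
  show ?thesis
  proof (rule radial_comparison[OF f g F usc sub d'(1) cb \<phi> p p0 _ p_nonneg _ M(1) \<open>M \<le> \<phi> d'\<close>, unfolded \<phi>0])
    show "continuous_on UNIV (\<lambda>r. wc (\<phi> r) / 2)"
      by (intro continuous_intros continuous_on_compose2[OF wc] cont) auto
    show "0 \<le> wc (\<phi> r) / 2" for r using wcpos[of "\<phi> r"] by simp
    fix r assume r: "0 \<le> r" "\<phi> r < M"
    have bound: "wc (\<phi> s) / 2 \<le> v (\<phi> r)" if "0 \<le> s" "s \<le> r" for s
    proof -
      have "\<phi> s \<le> \<phi> r" "a \<le> \<phi> s" using \<phi>_mono \<phi>_ge that by auto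
      then show ?thesis
        using wc_eq[of "\<phi> s"] v(2)[of "\<phi> s"] monotone_onD[OF v(1), of "\<phi> s" "\<phi> r"] r by auto
    qed
    \<comment> \<open>By the mean value theorem p r / r = p' s for some s < r, and heights increase
      with the radius.\<close>
    have slope: "radial_slope p (\<lambda>r. wc (\<phi> r) / 2) r \<le> v (\<phi> r)"
    proof (cases "r = 0")
      case True
      then show ?thesis using bound[of 0] by (simp add: radial_slope_def)
    next
      case False
      then obtain s where "0 < s" "s < r" "p r - p 0 = (r - 0) * (wc (\<phi> s) / 2)"
        using MVT2[of 0 r p "\<lambda>r. wc (\<phi> r) / 2"] p r(1) by (metis less_eq_real_def)
      moreover from this have "p r / r = wc (\<phi> s) / 2" using False p0 by (simp add: field_simps)
      ultimately have "p r / r \<le> v (\<phi> r)" using bound[of s] by linarith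
      then show ?thesis using False by (simp add: radial_slope_def)
    qed
    have "1 \<le> CARD('n)" by (simp add: Suc_leI)
    then have "(real CARD('n) - 1) * radial_slope p (\<lambda>r. wc (\<phi> r) / 2) r \<le> (real CARD('n) - 1) * v (\<phi> r)"
      by (intro mult_left_mono slope) auto
    moreover have "y (\<phi> r) = (p r)\<^sup>2"
      using yc_eq[of "\<phi> r"] y\<phi>[of r] \<phi>_ge r by simp
    then have "y (\<phi> r) powr (q / 2) = p r powr q"
      using p_nonneg r by (simp add: power2_powr_half)
    ultimately show "wc (\<phi> r) / 2 + (real CARD('n) - 1) * radial_slope p (\<lambda>r. wc (\<phi> r) / 2) r
        \<le> f (\<phi> r) + g (\<phi> r) * p r powr q"
      using super[of "\<phi> r"] \<phi>_ge[of r] r wc_eq[of "\<phi> r"] by auto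
  qed
qed

section \<open>Exponentially weighted integrals\<close>

text \<open>Variation of constants: as a function of t \<ge> a this solves W' = e W + f with W a =
  0. For e = 0 it is the plain integral of f, so these lemmas cover both.\<close>

definition expint :: "(real \<Rightarrow> real) \<Rightarrow> (real \<Rightarrow> real) \<Rightarrow> real \<Rightarrow> real \<Rightarrow> real" where
  "expint e f a t = integral {a..t} (\<lambda>s. exp (integral {s..t} e) * f s)"

lemma expint_zero: "expint (\<lambda>_. 0) f a t = integral {a..t} f"
  by (simp add: expint_def)

lemma DERIV_shift_left:
  "(F has_real_derivative D) (at (c + x)) \<Longrightarrow> ((\<lambda>x. F (c + x)) has_real_derivative D) (at x)"
  by (simp add: DERIV_shift add.commute[of c])

lemma integral_antiderivative:
  fixes H :: "real \<Rightarrow> real"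
  assumes "a \<le> b" "\<And>x. (H has_real_derivative h x) (at x)"
  shows "(h has_integral H b - H a) {a..b}"
  using assms by (intro fundamental_theorem_of_calculus)
    (auto simp: has_real_derivative_iff_has_vector_derivative[symmetric] intro: has_field_derivative_at_within)

context
  fixes e f :: "real \<Rightarrow> real"
  assumes e: "continuous_on UNIV e" and f: "continuous_on UNIV f"
begin

text \<open>Taking exp (E t) out of the integral separates t from a; differentiability in t and
  continuity and monotonicity in a can then be read off.\<close>

lemma expint_antiderivatives:
  obtains E J where "\<And>x. (E has_real_derivative e x) (at x)"
    "\<And>x. (J has_real_derivative exp (- E x) * f x) (at x)"
    "\<And>a t. a \<le> t \<Longrightarrow> expint e f a t = exp (E t) * (J t - J a)"
proof -
  obtain E where E: "\<And>x. (E has_real_derivative e x) (at x)"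
    using antiderivative_real[OF e] by metis
  have "continuous_on UNIV E"
    by (rule DERIV_imp_continuous_on[OF E])
  then have "continuous_on UNIV (\<lambda>x. exp (- E x) * f x)" by (intro continuous_intros f)
  then obtain J where "J 0 = 0" and J: "\<And>x. (J has_real_derivative exp (- E x) * f x) (at x)"
    by (rule antiderivative_real) blast
  have "expint e f a t = exp (E t) * (J t - J a)" if "a \<le> t" for a t
  proof -
    have int: "((\<lambda>s. exp (E t) * (exp (- E s) * f s)) has_integral exp (E t) * (J t - J a)) {a..t}"
      by (intro has_integral_mult_right integral_antiderivative that J)
    have "exp (E t) * (exp (- E s) * f s) = exp (integral {s..t} e) * f s" if "s \<in> {a..t}" for s
      using integral_unique[OF integral_antiderivative[OF _ E, of s t]] that
      by (simp add: exp_diff exp_minus divide_inverse)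
    from has_integral_eq[OF this int]
    have "integral {a..t} (\<lambda>s. exp (integral {s..t} e) * f s) = exp (E t) * (J t - J a)"
      by (rule integral_unique)
    then show ?thesis by (simp add: expint_def)
  qed
  then show thesis by (rule that[OF E J])
qed

lemma expint_refl: "expint e f a a = 0"
  by (simp add: expint_def)

text \<open>One-sided at t = a, because for t < a the interval is empty and the value 0.\<close>

lemma expint_has_derivative:
  assumes "a \<le> t"
  shows "(expint e f a has_real_derivative e t * expint e f a t + f t) (at t within {a..})"
proof -
  obtain E J where E: "\<And>x. (E has_real_derivative e x) (at x)"
    and J: "\<And>x. (J has_real_derivative exp (- E x) * f x) (at x)"
    and eq: "\<And>a t. a \<le> t \<Longrightarrow> expint e f a t = exp (E t) * (J t - J a)"
    by (rule expint_antiderivatives) blast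
  have "((\<lambda>t. exp (E t) * (J t - J a)) has_real_derivative e t * expint e f a t + f t) (at t)"
    unfolding eq[OF assms]
    by (auto intro!: derivative_eq_intros E J simp: algebra_simps exp_minus)
  then have "((\<lambda>t. exp (E t) * (J t - J a)) has_real_derivative e t * expint e f a t + f t) (at t within {a..})"
    by (rule has_field_derivative_at_within)
  then show ?thesis
    by (rule has_field_derivative_transform_within[where d=1]) (use assms eq in auto)
qed

lemma continuous_on_expint: "continuous_on {a..} (expint e f a)"
  by (rule DERIV_continuous_on[OF expint_has_derivative]) auto

lemma continuous_on_expint_base:
  assumes "0 \<le> s"
  shows "continuous_on UNIV (\<lambda>a. expint e f a (a + s))"
proof -
  obtain E J where E: "\<And>x. (E has_real_derivative e x) (at x)"
    and J: "\<And>x. (J has_real_derivative exp (- E x) * f x) (at x)"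
    and eq: "\<And>a t. a \<le> t \<Longrightarrow> expint e f a t = exp (E t) * (J t - J a)"
    by (rule expint_antiderivatives) blast
  have contE: "continuous_on UNIV E" by (rule DERIV_imp_continuous_on[OF E])
  have contJ: "continuous_on UNIV J" by (rule DERIV_imp_continuous_on[OF J])
  have "continuous_on UNIV (\<lambda>a. exp (E (a + s)) * (J (a + s) - J a))"
    by (intro continuous_intros continuous_on_compose2[OF contE] continuous_on_compose2[OF contJ]) auto
  then show ?thesis using assms by (simp add: eq)
qed

lemma expint_shift_has_derivative:
  assumes "s > 0"
  shows "((\<lambda>s. expint e f a (a + s)) has_real_derivative e (a + s) * expint e f a (a + s) + f (a + s)) (at s)"
proof -
  have "at (a + s) within {a..} = at (a + s)" using assms by (intro at_within_interior) simp
  then have "(expint e f a has_real_derivative e (a + s) * expint e f a (a + s) + f (a + s)) (at (a + s))"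
    using expint_has_derivative[of a "a + s"] assms by simp
  then show ?thesis by (rule DERIV_shift_left)
qed

lemma continuous_on_expint_shift: "continuous_on {0..} (\<lambda>s. expint e f a (a + s))"
  by (intro continuous_on_compose2[OF continuous_on_expint] continuous_intros) auto

lemma expint_pos:
  assumes "a < t" "\<And>t. f t > 0"
  shows "expint e f a t > 0"
proof -
  obtain E J where E: "\<And>x. (E has_real_derivative e x) (at x)"
    and J: "\<And>x. (J has_real_derivative exp (- E x) * f x) (at x)"
    and eq: "\<And>a t. a \<le> t \<Longrightarrow> expint e f a t = exp (E t) * (J t - J a)"
    by (rule expint_antiderivatives) blast
  have "J a < J t"
    by (rule DERIV_pos_imp_increasing[OF assms(1)]) (use J assms(2) in \<open>auto intro!: exI mult_pos_pos\<close>)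
  then show ?thesis using assms(1) by (simp add: eq)
qed

lemma expint_nonneg:
  assumes "\<And>t. f t \<ge> 0"
  shows "expint e f a t \<ge> 0"
  unfolding expint_def
  by (cases "(\<lambda>s. exp (integral {s..t} e) * f s) integrable_on {a..t}")
    (auto intro!: integral_nonneg mult_nonneg_nonneg assms simp: not_integrable_integral)

lemma expint_antimono_base:
  assumes "a \<le> b" "b \<le> t" "\<And>t. f t \<ge> 0"
  shows "expint e f b t \<le> expint e f a t"
proof -
  obtain E J where E: "\<And>x. (E has_real_derivative e x) (at x)"
    and J: "\<And>x. (J has_real_derivative exp (- E x) * f x) (at x)"
    and eq: "\<And>a t. a \<le> t \<Longrightarrow> expint e f a t = exp (E t) * (J t - J a)"
    by (rule expint_antiderivatives) blast
  have "J a \<le> J b"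
    by (rule DERIV_nonneg_imp_nondecreasing[OF assms(1)]) (use J assms(3) in \<open>auto intro!: exI mult_nonneg_nonneg\<close>)
  then show ?thesis using assms(1,2) by (simp add: eq)
qed

text \<open>The difference of two translates satisfies a linear differential inequality;
  its integrating factor is \<^term>\<open>exp (- E (b + s))\<close>.\<close>

lemma expint_shift_mono:
  assumes emono: "mono e" and nonneg: "\<And>t. f t \<ge> 0" and ab: "a \<le> b" and "0 \<le> s" and fmono: "mono f"
  shows "expint e f a (a + s) \<le> expint e f b (b + s)"
    and "strict_mono f \<Longrightarrow> a < b \<Longrightarrow> 0 < s \<Longrightarrow> expint e f a (a + s) < expint e f b (b + s)"
proof -
  obtain E J where E: "\<And>x. (E has_real_derivative e x) (at x)"
    by (rule expint_antiderivatives) blast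
  have contE: "continuous_on UNIV E"
    by (rule DERIV_imp_continuous_on[OF E])
  define D where "D = (\<lambda>s. exp (- E (b + s)) * (expint e f b (b + s) - expint e f a (a + s)))"
  define D' where "D' = (\<lambda>s. exp (- E (b + s)) *
    ((e (b + s) - e (a + s)) * expint e f a (a + s) + (f (b + s) - f (a + s))))"
  have D: "(D has_real_derivative D' s) (at s)" if "s > 0" for s
  proof -
    have "((\<lambda>s. E (b + s)) has_real_derivative e (b + s)) (at s)"
      by (rule DERIV_shift_left[OF E])
    from DERIV_mult[OF DERIV_fun_exp[OF DERIV_minus[OF this]]
        DERIV_diff[OF expint_shift_has_derivative[OF that, of b] expint_shift_has_derivative[OF that, of a]]]
    show ?thesis unfolding D_def D'_def by (rule DERIV_cong) (simp add: algebra_simps)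
  qed
  have contD: "continuous_on {0..s} D" unfolding D_def
    by (intro continuous_intros continuous_on_compose2[OF contE] continuous_on_subset[OF continuous_on_expint_shift]) auto
  have D0: "D 0 = 0" by (simp add: D_def expint_refl)
  \<comment> \<open>The term with e is dropped: it is nonnegative, as e is nondecreasing and the
    integral is nonnegative.\<close>
  have D'_ge: "D' s \<ge> exp (- E (b + s)) * (f (b + s) - f (a + s))" if "s > 0" for s
    unfolding D'_def using monoD[OF emono, of "a + s" "b + s"] ab expint_nonneg[OF nonneg, of a "a + s"]
    by (intro mult_left_mono) auto
  have "D' s \<ge> 0" if "s > 0" for s
    using D'_ge[OF that] monoD[OF fmono, of "a + s" "b + s"] ab
    by (meson diff_ge_0_iff_ge add_right_mono exp_ge_zero mult_nonneg_nonneg order_trans)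
  then have "D 0 \<le> D s"
    using DERIV_nonneg_imp_increasing_open[OF \<open>0 \<le> s\<close> _ contD] D by blast
  then show "expint e f a (a + s) \<le> expint e f b (b + s)"
    using D0 by (simp add: D_def zero_le_mult_iff)
  assume sf: "strict_mono f" "a < b" "0 < s"
  have "D' s > 0" if "s > 0" for s
  proof -
    have "0 < exp (- E (b + s)) * (f (b + s) - f (a + s))"
      using strict_monoD[OF sf(1), of "a + s" "b + s"] sf(2) by (intro mult_pos_pos) auto
    then show ?thesis using D'_ge[OF that] by (rule less_le_trans)
  qed
  then have "D 0 < D s"
    using DERIV_pos_imp_increasing_open[OF \<open>0 < s\<close> _ contD] D by blast
  then show "expint e f a (a + s) < expint e f b (b + s)"
    using D0 by (simp add: D_def zero_less_mult_iff)
qed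

text \<open>Jensen's inequality in tangent form: after replacing e and f by their values at a, the
  exponential is bounded below by its tangent at the mean exponent e a * s / 2, and the linear part
  of the tangent integrates to 0. The bound does not depend on the sign of e a.\<close>

lemma expint_ge:
  assumes emono: "mono e" and fmono: "mono f" and nonneg: "\<And>t. f t \<ge> 0" and "0 \<le> s"
  shows "f a * s * exp (e a * s / 2) \<le> expint e f a (a + s)"
proof -
  let ?t = "a + s"
  obtain E J where E: "\<And>x. (E has_real_derivative e x) (at x)"
    and J: "\<And>x. (J has_real_derivative exp (- E x) * f x) (at x)"
    by (rule expint_antiderivatives) blast
  have int: "integral {x..?t} e = E ?t - E x" if "x \<le> ?t" for x
    using integral_unique[OF integral_antiderivative[OF that E]] .
  have "((\<lambda>x. 1 + e a * (?t - x - s / 2)) has_integral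
      (?t + e a * ((?t - s / 2) * ?t - ?t\<^sup>2 / 2)) - (a + e a * ((?t - s / 2) * a - a\<^sup>2 / 2))) {a..?t}"
    using \<open>0 \<le> s\<close> by (intro integral_antiderivative[where H="\<lambda>x. x + e a * ((?t - s / 2) * x - x\<^sup>2 / 2)"])
      (auto intro!: derivative_eq_intros simp: algebra_simps)
  moreover have "(?t + e a * ((?t - s / 2) * ?t - ?t\<^sup>2 / 2)) - (a + e a * ((?t - s / 2) * a - a\<^sup>2 / 2)) = s"
    by (simp add: field_simps power2_eq_square)
  ultimately have "((\<lambda>x. 1 + e a * (?t - x - s / 2)) has_integral s) {a..?t}"
    by (simp only:)
  then have "((\<lambda>x. f a * exp (e a * s / 2) * (1 + e a * (?t - x - s / 2))) has_integral f a * exp (e a * s / 2) * s) {a..?t}"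
    by (intro has_integral_mult_right) simp
  moreover have contE: "continuous_on UNIV E"
    by (rule DERIV_imp_continuous_on[OF E])
  then have "continuous_on {a..?t} (\<lambda>x. exp (E ?t - E x) * f x)"
    by (intro continuous_intros continuous_on_subset[OF f] continuous_on_compose2[OF contE]) auto
  then have "(\<lambda>x. exp (E ?t - E x) * f x) integrable_on {a..?t}"
    by (rule integrable_continuous_interval)
  then have "(\<lambda>x. exp (integral {x..?t} e) * f x) integrable_on {a..?t}"
    by (rule integrable_eq) (simp add: int)
  then have "((\<lambda>x. exp (integral {x..?t} e) * f x) has_integral expint e f a ?t) {a..?t}"
    unfolding expint_def by (rule integrable_integral)
  ultimately have "f a * exp (e a * s / 2) * s \<le> expint e f a ?t"
  proof (rule has_integral_le)
    fix x assume x: "x \<in> {a..?t}"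
    have "integral {x..?t} (\<lambda>_. e a) \<le> integral {x..?t} e"
      using x by (intro integral_le integrable_continuous_interval continuous_on_subset[OF e] continuous_intros)
        (auto intro: monoD[OF emono])
    then have "e a * (?t - x) \<le> integral {x..?t} e" using x by (simp add: mult.commute)
    then have "e a * s / 2 + e a * (?t - x - s / 2) \<le> integral {x..?t} e"
      by (simp add: algebra_simps)
    then have "exp (e a * s / 2) * exp (e a * (?t - x - s / 2)) \<le> exp (integral {x..?t} e)"
      by (simp flip: exp_add)
    moreover have "exp (e a * s / 2) * (1 + e a * (?t - x - s / 2)) \<le> exp (e a * s / 2) * exp (e a * (?t - x - s / 2))"
      by (intro mult_left_mono exp_ge_add_one_self) auto
    ultimately have "f a * (exp (e a * s / 2) * (1 + e a * (?t - x - s / 2))) \<le> f a * exp (integral {x..?t} e)"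
      by (intro mult_left_mono nonneg) linarith
    also have "\<dots> \<le> f x * exp (integral {x..?t} e)"
      using x by (intro mult_right_mono monoD[OF fmono]) auto
    finally show "f a * exp (e a * s / 2) * (1 + e a * (?t - x - s / 2)) \<le> exp (integral {x..?t} e) * f x"
      by (simp add: mult_ac)
  qed
  then show ?thesis by (simp add: mult_ac)
qed

lemma expint_ge_tail:
  assumes emono: "mono e" and fmono: "mono f" and nonneg: "\<And>t. f t \<ge> 0" and "a \<le> b" "b \<le> t"
  shows "f b * (t - b) * exp (e b * (t - b) / 2) \<le> expint e f a t"
  using expint_ge[OF emono fmono nonneg, of "t - b" b] expint_antimono_base[OF \<open>a \<le> b\<close> \<open>b \<le> t\<close> nonneg] \<open>b \<le> t\<close>
  by simp

end

section \<open>The inverse of the blow-up radius\<close>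

lemma measurable_ennreal_indicator:
  fixes H :: "real \<Rightarrow> real"
  assumes "continuous_on A H" "A \<in> sets borel"
  shows "(\<lambda>t. ennreal (H t) * indicator A t) \<in> borel_measurable borel"
proof -
  have "(\<lambda>t. indicator A t *\<^sub>R H t) \<in> borel_measurable borel"
    by (rule borel_measurable_continuous_on_indicator) (use assms in auto)
  then have "(\<lambda>t. ennreal (indicator A t *\<^sub>R H t)) \<in> borel_measurable borel" by measurable
  moreover have "ennreal (indicator A t *\<^sub>R H t) = ennreal (H t) * indicator A t" for t
    by (auto simp: indicator_def)
  ultimately show ?thesis by simp
qed

text \<open>Moves a from the domain into the kernel, so that monotonicity, continuity and limits in
  a can be checked pointwise in s.\<close>

lemma nn_integral_Ioi_shift:
  fixes H :: "real \<Rightarrow> real"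
  assumes "continuous_on {a<..} H"
  shows "(\<integral>\<^sup>+ t \<in> {a<..}. ennreal (H t) \<partial>lborel) = (\<integral>\<^sup>+ s \<in> {0<..}. ennreal (H (a + s)) \<partial>lborel)"
proof -
  have "(\<integral>\<^sup>+ t \<in> {a<..}. ennreal (H t) \<partial>lborel)
      = ennreal \<bar>1\<bar> * (\<integral>\<^sup>+ s. ennreal (H (a + 1 * s)) * indicator {a<..} (a + 1 * s) \<partial>lborel)"
    by (rule nn_integral_real_affine) (use measurable_ennreal_indicator[OF assms] in auto)
  also have "\<dots> = (\<integral>\<^sup>+ s \<in> {0<..}. ennreal (H (a + s)) \<partial>lborel)"
    by (auto intro!: nn_integral_cong simp: indicator_def)
  finally show ?thesis .
qed

lemma nn_integral_tail_affine_finite: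
  fixes h :: "real \<Rightarrow> real"
  assumes "continuous_on {0<..} h" "c > 0" "0 \<le> a + c * L"
    and fin: "(\<integral>\<^sup>+ t \<in> {0<..}. ennreal (h t) \<partial>lborel) < \<infinity>"
  shows "(\<integral>\<^sup>+ s \<in> {L<..}. ennreal (h (a + c * s)) \<partial>lborel) < \<infinity>"
proof -
  let ?X = "\<integral>\<^sup>+ s. ennreal (h (a + c * s)) * indicator {0<..} (a + c * s) \<partial>lborel"
  have "(\<integral>\<^sup>+ t \<in> {0<..}. ennreal (h t) \<partial>lborel) = ennreal \<bar>c\<bar> * ?X"
    by (rule nn_integral_real_affine) (use measurable_ennreal_indicator[OF assms(1)] assms(2) in auto)
  then have "ennreal \<bar>c\<bar> * ?X \<noteq> \<infinity>" using fin by auto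
  then have "?X < \<infinity>" using \<open>c > 0\<close> by (auto simp: ennreal_mult_eq_top_iff top.not_eq_extremum)
  moreover have "(\<integral>\<^sup>+ s \<in> {L<..}. ennreal (h (a + c * s)) \<partial>lborel) \<le> ?X"
  proof (rule nn_integral_mono)
    fix s
    have "L < s \<Longrightarrow> 0 < a + c * s"
      using assms(2,3) mult_strict_left_mono[of L s c] by linarith
    then show "ennreal (h (a + c * s)) * indicator {L<..} s \<le> ennreal (h (a + c * s)) * indicator {0<..} (a + c * s)"
      by (auto simp: indicator_def)
  qed
  ultimately show ?thesis by (rule le_less_trans[rotated])
qed

lemma nn_integral_powr_tail_finite:
  fixes r L :: real
  assumes "r < -1" "L > 0"
  shows "(\<integral>\<^sup>+ s \<in> {L<..}. ennreal (s powr r) \<partial>lborel) < \<infinity>"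
proof -
  have "(\<integral>\<^sup>+ s \<in> {L..}. ennreal (s powr r) \<partial>lborel) = ennreal (-(L powr (r+1)) / (r+1))"
    by (rule nn_integral_has_integral_lebesgue') (use has_integral_powr_to_inf[OF assms] in auto)
  moreover have "(\<integral>\<^sup>+ s \<in> {L<..}. ennreal (s powr r) \<partial>lborel) \<le> (\<integral>\<^sup>+ s \<in> {L..}. ennreal (s powr r) \<partial>lborel)"
    by (intro nn_integral_mono) (auto simp: indicator_def)
  ultimately show ?thesis by (simp add: le_less_trans)
qed

lemma nn_integral_inverse_sqrt_finite:
  fixes L :: real
  assumes "L \<ge> 0"
  shows "(\<integral>\<^sup>+ s \<in> {0<..L}. ennreal (1 / sqrt s) \<partial>lborel) < \<infinity>"
proof -
  have "(\<integral>\<^sup>+ s \<in> {0..L}. ennreal (s powr (-1/2)) \<partial>lborel) = ennreal (L powr (-1/2+1) / (-1/2+1))"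
    by (rule nn_integral_has_integral_lebesgue') (use has_integral_powr_from_0[of "-1/2" L] assms in auto)
  moreover have "(\<integral>\<^sup>+ s \<in> {0<..L}. ennreal (1 / sqrt s) \<partial>lborel) \<le> (\<integral>\<^sup>+ s \<in> {0..L}. ennreal (s powr (-1/2)) \<partial>lborel)"
    by (intro nn_integral_mono) (auto simp: indicator_def powr_minus_divide powr_half_sqrt)
  ultimately show ?thesis by (simp add: le_less_trans)
qed

lemma nn_integral_kernel_finite:
  fixes K H :: "real \<Rightarrow> real"
  assumes "L \<ge> 0" "A \<ge> 0" "B \<ge> 0"
    and near: "\<And>s. 0 < s \<Longrightarrow> s \<le> L \<Longrightarrow> K s \<le> A / sqrt s"
    and far: "\<And>s. s > L \<Longrightarrow> K s \<le> B * H s"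
    and H: "continuous_on {L<..} H" "(\<integral>\<^sup>+ s \<in> {L<..}. ennreal (H s) \<partial>lborel) < \<infinity>"
  shows "(\<integral>\<^sup>+ s \<in> {0<..}. ennreal (K s) \<partial>lborel) < \<infinity>"
proof -
  have mS: "(\<lambda>s. ennreal (1 / sqrt s) * indicator {0<..L} s) \<in> borel_measurable lborel"
    by simp
  have mH: "(\<lambda>s. ennreal (H s) * indicator {L<..} s) \<in> borel_measurable lborel"
    using measurable_ennreal_indicator[OF H(1)] by simp
  have "(\<integral>\<^sup>+ s \<in> {0<..}. ennreal (K s) \<partial>lborel)
      \<le> (\<integral>\<^sup>+ s. ennreal A * (ennreal (1 / sqrt s) * indicator {0<..L} s)
              + ennreal B * (ennreal (H s) * indicator {L<..} s) \<partial>lborel)"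
  proof (rule nn_integral_mono)
    fix s
    consider "s \<le> 0" | "0 < s" "s \<le> L" | "s > L" by linarith
    then show "ennreal (K s) * indicator {0<..} s \<le> ennreal A * (ennreal (1 / sqrt s) * indicator {0<..L} s)
              + ennreal B * (ennreal (H s) * indicator {L<..} s)"
    proof cases
      case 2
      then have "ennreal (K s) \<le> ennreal A * ennreal (1 / sqrt s)"
        using near[of s] \<open>A \<ge> 0\<close> by (auto simp flip: ennreal_mult intro!: ennreal_leI)
      then show ?thesis using 2 by simp
    next
      case 3
      have "ennreal (K s) \<le> ennreal (B * H s)" using far[OF 3] by (rule ennreal_leI)
      also have "\<dots> = ennreal B * ennreal (H s)" using \<open>B \<ge> 0\<close> by (rule ennreal_mult')
      finally show ?thesis using 3 \<open>L \<ge> 0\<close> by simp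
    qed simp
  qed
  also have "\<dots> = ennreal A * (\<integral>\<^sup>+ s \<in> {0<..L}. ennreal (1 / sqrt s) \<partial>lborel) + ennreal B * (\<integral>\<^sup>+ s \<in> {L<..}. ennreal (H s) \<partial>lborel)"
    using mS mH by (simp add: nn_integral_add nn_integral_cmult)
  also have "\<dots> < \<infinity>"
    using nn_integral_inverse_sqrt_finite[OF \<open>L \<ge> 0\<close>] H(2) by (simp add: ennreal_mult_less_top)
  finally show ?thesis .
qed

text \<open>The pointwise properties of K make R finite, continuous, strictly decreasing and
  convergent to 0. If R a = d, then R < d to the right of a, and b is at most every a' > a above
  \<tau>. If d is not attained, the limit 0 and the intermediate value theorem force R < d
  everywhere, so b \<le> \<tau>; for \<tau> = - \<infinity> this is a contradiction, in accordance
  with the value - \<infinity> of \<open>R_inv\<close>.\<close>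

lemma R_inv_bound:
  fixes K :: "real \<Rightarrow> real \<Rightarrow> real" and R :: "real \<Rightarrow> ennreal"
  assumes R: "\<And>a. R a = ennreal C * (\<integral>\<^sup>+ s \<in> {0<..}. ennreal (K a s) \<partial>lborel)"
    and "C > 0" "d > 0"
    and K: "\<And>a. continuous_on {0<..} (K a)"
    and pos: "\<And>a s. s > 0 \<Longrightarrow> K a s \<ge> 0"
    and anti: "\<And>a b s. a < b \<Longrightarrow> s > 0 \<Longrightarrow> K b s < K a s"
    and cont: "\<And>s. s > 0 \<Longrightarrow> continuous_on UNIV (\<lambda>a. K a s)"
    and lim: "\<And>s. s > 0 \<Longrightarrow> ((\<lambda>a. K a s) \<longlongrightarrow> 0) at_top"
    and fin: "\<And>a. (\<integral>\<^sup>+ s \<in> {0<..}. ennreal (K a s) \<partial>lborel) < \<infinity>"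
    and bound: "\<And>a. \<tau> < ereal a \<Longrightarrow> R a < ennreal d \<Longrightarrow> b \<le> a"
  shows "ereal b \<le> max \<tau> (R_inv R d)"
proof -
  let ?k = "\<lambda>a s. indicator {0<..} s *\<^sub>R K a s"
  define I where "I = (\<lambda>a. \<integral>s. ?k a s \<partial>lborel)"
  have meas: "?k a \<in> borel_measurable lborel" for a
    using borel_measurable_continuous_on_indicator[OF _ K[of a]] by simp
  have k_nonneg: "?k a s \<ge> 0" for a s using pos by (auto simp: indicator_def)
  have eq: "ennreal (K a s) * indicator {0<..} s = ennreal (?k a s)" for a s
    by (auto simp: indicator_def)
  have int: "integrable lborel (?k a)" for a
    using fin[of a] k_nonneg[of _ a] by (intro integrableI_nonneg meas) (auto simp: eq)
  have R_eq: "R a = ennreal (C * I a)" for a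
    unfolding R I_def eq using \<open>C > 0\<close>
    by (simp only: nn_integral_eq_integral[OF int AE_I2[OF k_nonneg]] ennreal_mult' less_imp_le)
  have I_nonneg: "I a \<ge> 0" for a unfolding I_def by (intro integral_nonneg_AE AE_I2 k_nonneg)
  have I_less: "I b < I a" if "a < b" for a b
  proof -
    let ?h = "\<lambda>s. ?k a s - ?k b s"
    have h_nonneg: "AE s in lborel. 0 \<le> ?h s"
      using anti[OF that] by (intro AE_I2) (auto simp: indicator_def less_imp_le)
    have h_int: "integrable lborel ?h" by (intro Bochner_Integration.integrable_diff int)
    have "integral\<^sup>L lborel ?h \<noteq> 0"
    proof
      assume "integral\<^sup>L lborel ?h = 0"
      then have "AE s in lborel. ?h s = 0"
        using integral_nonneg_eq_0_iff_AE[OF h_int h_nonneg] by simp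
      then have "AE s in lborel. s \<notin> {0<..<1::real}"
      proof eventually_elim
        case (elim s)
        then show ?case using anti[OF that, of s] by (auto simp: indicator_def)
      qed
      then have "{0<..<1::real} \<in> null_sets lborel" by (simp add: AE_iff_null_sets)
      then show False by (auto simp: null_sets_def)
    qed
    moreover have "integral\<^sup>L lborel ?h \<ge> 0" by (rule integral_nonneg_AE[OF h_nonneg])
    moreover have "integral\<^sup>L lborel ?h = I a - I b"
      unfolding I_def by (rule Bochner_Integration.integral_diff[OF int int])
    ultimately show ?thesis by simp
  qed
  have dom: "norm (?k b s) \<le> ?k a s" if "a \<le> b" for a b s
    using anti[of a b s] that pos[of s b] by (cases "a = b") (auto simp: indicator_def)
  have I_cont: "isCont I a" for a
    unfolding continuous_at_sequentially comp_def
  proof (intro allI impI)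
    fix x assume x: "x \<longlonglongrightarrow> a"
    \<comment> \<open>Cutting the sequence off at a - 1 changes at most finitely many terms and
      makes the kernel at a - 1 a common majorant.\<close>
    define y where "y = (\<lambda>n. max (a - 1) (x n))"
    have "\<forall>\<^sub>F n in sequentially. a - 1 < x n" using order_tendstoD(1)[OF x] by simp
    then have ev: "\<forall>\<^sub>F n in sequentially. I (y n) = I (x n)" by eventually_elim (simp add: y_def)
    have "y \<longlonglongrightarrow> a" using tendsto_max[OF tendsto_const[of "a - 1"] x] by (simp add: y_def max_def)
    have "(\<lambda>n. I (y n)) \<longlonglongrightarrow> I a" unfolding I_def
    proof (rule integral_dominated_convergence[OF meas meas int[of "a - 1"]])
      show "AE s in lborel. (\<lambda>n. ?k (y n) s) \<longlonglongrightarrow> ?k a s"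
      proof (rule AE_I2)
        fix s
        show "(\<lambda>n. ?k (y n) s) \<longlonglongrightarrow> ?k a s"
          using continuous_on_tendsto_compose[OF cont[of s] \<open>y \<longlonglongrightarrow> a\<close>] by (cases "s > 0") auto
      qed
      show "AE s in lborel. norm (?k (y n) s) \<le> ?k (a - 1) s" for n
        by (rule AE_I2, rule dom) (simp add: y_def)
    qed
    then show "(\<lambda>n. I (x n)) \<longlonglongrightarrow> I a"
      using ev by (rule Lim_transform_eventually)
  qed
  have I_lim: "(\<lambda>n. I (real n)) \<longlonglongrightarrow> (\<integral>s. (0::real) \<partial>(lborel::real measure))" unfolding I_def
  proof (rule integral_dominated_convergence[OF _ meas int[of 0]])
    show "AE s in lborel. (\<lambda>n. ?k (real n) s) \<longlonglongrightarrow> 0"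
    proof (rule AE_I2)
      fix s
      show "(\<lambda>n. ?k (real n) s) \<longlonglongrightarrow> 0"
        using filterlim_compose[OF lim[of s] filterlim_real_sequentially] by (cases "s > 0") auto
    qed
    show "AE s in lborel. norm (?k (real n) s) \<le> ?k 0 s" for n
      by (rule AE_I2, rule dom) simp
  qed simp
  have below: "ereal b \<le> max \<tau> c" if c: "\<And>a. c < ereal a \<Longrightarrow> C * I a < d" for c
  proof (rule ccontr)
    assume "\<not> ereal b \<le> max \<tau> c"
    then have "max \<tau> c < ereal b" by (simp only: not_le)
    from ereal_dense2[OF this] obtain a where a: "max \<tau> c < ereal a" "ereal a < ereal b"
      by blast
    then have "C * I a < d" using c by simp
    then have "R a < ennreal d" using I_nonneg[of a] \<open>C > 0\<close> by (simp add: R_eq ennreal_less_iff)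
    then show False using bound[of a] a by simp
  qed
  show ?thesis
  proof (cases "\<exists>a. R a = ennreal d")
    case True
    then obtain a where a: "R a = ennreal d" by blast
    have uniq: "a' = a" if "R a' = ennreal d" for a'
    proof -
      have "C * I a' = C * I a" using that a R_eq I_nonneg \<open>C > 0\<close> 
        by (metis ennreal_inj less_imp_le mult_nonneg_nonneg)
      then show ?thesis using I_less[of a a'] I_less[of a' a] \<open>C > 0\<close> by (cases a a' rule: linorder_cases) auto
    qed
    have "R_inv R d = ereal a"
      unfolding R_inv_def using a uniq by (metis (mono_tags, lifting) the_equality)
    moreover have "ereal b \<le> max \<tau> (ereal a)"
    proof (rule below)
      fix a' assume "ereal a < ereal a'"
      then have "C * I a' < C * I a" using I_less \<open>C > 0\<close> by simp
      moreover have "C * I a = d"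
        using a I_nonneg[of a] \<open>C > 0\<close> \<open>d > 0\<close> by (simp add: R_eq)
      ultimately show "C * I a' < d" by simp
    qed
    ultimately show ?thesis by simp
  next
    case False
    then have "R_inv R d = - \<infinity>" by (auto simp: R_inv_def)
    moreover have "C * I a < d" for a
    proof (rule ccontr)
      assume "\<not> C * I a < d"
      then have ge: "d / C \<le> I a" using \<open>C > 0\<close> by (simp add: field_simps)
      have "\<forall>\<^sub>F n in sequentially. I (real n) < d / C"
        using order_tendstoD(2)[OF I_lim] \<open>C > 0\<close> \<open>d > 0\<close> by simp
      then obtain n where n: "I (real n) < d / C" by (auto simp: eventually_sequentially)
      then have "a \<le> real n" using I_less[of "real n" a] ge by force
      then obtain x where "I x = d / C"
        using IVT2'[of I "real n" "d / C" a] n ge I_cont by (auto intro: continuous_at_imp_continuous_on)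
      then have "R x = ennreal d" using \<open>C > 0\<close> by (simp add: R_eq)
      then show False using False by blast
    qed
    ultimately show ?thesis using below[of "- \<infinity>"] by simp
  qed
qed

section \<open>Growth at infinity\<close>

lemma lim_top_eq_SUP:
  assumes "mono g"
  shows "lim_top g = (SUP t. ereal (g t))"
proof -
  have "((\<lambda>t. ereal (g t)) \<longlongrightarrow> (SUP t. ereal (g t))) at_top"
  proof (rule increasing_tendsto)
    show "\<forall>\<^sub>F t in at_top. ereal (g t) \<le> (SUP t. ereal (g t))"
      by (intro always_eventually allI SUP_upper) simp
    fix x assume "x < (SUP t. ereal (g t))"
    then obtain s where s: "x < ereal (g s)" by (auto simp: less_SUP_iff)
    show "\<forall>\<^sub>F t in at_top. x < ereal (g t)"
      using eventually_ge_at_top[of s]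
    proof eventually_elim
      case (elim t)
      then have "ereal (g s) \<le> ereal (g t)" using monoD[OF assms] by simp
      then show ?case using s by (rule less_le_trans[rotated])
    qed
  qed
  then show ?thesis unfolding lim_top_def by (intro tendsto_Lim) auto
qed

lemma lim_top_infinite:
  assumes "mono g" "\<not> lim_top g < \<infinity>"
  shows "filterlim g at_top at_top"
  unfolding filterlim_at_top
proof
  fix Z
  have "(SUP t. ereal (g t)) = \<infinity>" using assms lim_top_eq_SUP[OF assms(1)] by simp
  then have "ereal Z < (SUP t. ereal (g t))" by simp
  then obtain s where s: "Z < g s" by (auto simp: less_SUP_iff)
  show "\<forall>\<^sub>F t in at_top. Z \<le> g t"
    using eventually_ge_at_top[of s] by eventually_elim (use s monoD[OF assms(1)] in force)
qed

text \<open>In the lower bound f a * s * exp (e a * s / 2) of \<open>expint_ge\<close>, one factor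
  diverges and the other stays bounded below for a \<ge> 0.\<close>

lemma expint_tendsto_infinity:
  assumes e: "continuous_on UNIV e" "mono e" and f: "continuous_on UNIV f" "mono f" "\<And>t. f t > 0"
    and growth: "filterlim f at_top at_top \<or> filterlim e at_top at_top"
    and s: "s > 0"
  shows "filterlim (\<lambda>a. expint e f a (a + s)) at_top at_top"
  using growth
proof
  assume "filterlim f at_top at_top"
  then have "filterlim (\<lambda>a. s * exp (e 0 * s / 2) * f a) at_top at_top"
    using s by (intro filterlim_tendsto_pos_mult_at_top[OF tendsto_const]) auto
  moreover have "\<forall>\<^sub>F a in at_top. s * exp (e 0 * s / 2) * f a \<le> expint e f a (a + s)"
    using eventually_ge_at_top[of 0]
  proof eventually_elim
    case (elim a)
    have "s * exp (e 0 * s / 2) * f a \<le> f a * s * exp (e a * s / 2)"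
      using s f(3)[of a] monoD[OF e(2) elim] by (auto simp: mult_ac intro!: mult_left_mono mult_right_mono)
    also have "\<dots> \<le> expint e f a (a + s)"
      using expint_ge[OF e(1) f(1) e(2) f(2)] f(3) s by (simp add: less_imp_le)
    finally show ?case .
  qed
  ultimately show ?thesis by (rule filterlim_at_top_mono)
next
  assume "filterlim e at_top at_top"
  then have "filterlim (\<lambda>a. s / 2 * e a) at_top at_top"
    using s by (intro filterlim_tendsto_pos_mult_at_top[OF tendsto_const]) auto
  from filterlim_compose[OF exp_at_top this]
  have "filterlim (\<lambda>a. f 0 * s * exp (s / 2 * e a)) at_top at_top"
    using s f(3)[of 0] by (intro filterlim_tendsto_pos_mult_at_top[OF tendsto_const]) auto
  moreover have "\<forall>\<^sub>F a in at_top. f 0 * s * exp (s / 2 * e a) \<le> expint e f a (a + s)"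
    using eventually_ge_at_top[of 0]
  proof eventually_elim
    case (elim a)
    have "f 0 * s * exp (s / 2 * e a) \<le> f a * s * exp (e a * s / 2)"
      using s monoD[OF f(2) elim] by (auto simp: mult_ac intro!: mult_left_mono)
    also have "\<dots> \<le> expint e f a (a + s)"
      using expint_ge[OF e(1) f(1) e(2) f(2)] f(3) s by (simp add: less_imp_le)
    finally show ?case .
  qed
  ultimately show ?thesis by (rule filterlim_at_top_mono)
qed

lemma tendsto_inverse_sqrt_at_top:
  assumes "filterlim h at_top F"
  shows "((\<lambda>x. 1 / sqrt (h x)) \<longlongrightarrow> 0) F"
  using tendsto_inverse_0_at_top[OF filterlim_compose[OF sqrt_at_top assms]]
  by (simp add: divide_inverse)

text \<open>Isolates what depends on the integral hypotheses. Near s = 0 every kernel is at most a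
  multiple of 1 / sqrt s, so only large s matters. Continuity of the majorant H provides
  measurability.\<close>

definition finite_tail :: "(real \<Rightarrow> real) \<Rightarrow> bool" where
  "finite_tail K \<longleftrightarrow> (\<exists>L B H. L \<ge> 0 \<and> B \<ge> 0 \<and> (\<forall>s>L. K s \<le> B * H s) \<and>
     continuous_on {L<..} H \<and> (\<integral>\<^sup>+ s \<in> {L<..}. ennreal (H s) \<partial>lborel) < \<infinity>)"

lemma finite_tailI:
  assumes "L \<ge> 0" "B \<ge> 0" "\<And>s. s > L \<Longrightarrow> K s \<le> B * H s"
    "continuous_on {L<..} H" "(\<integral>\<^sup>+ s \<in> {L<..}. ennreal (H s) \<partial>lborel) < \<infinity>"
  shows "finite_tail K"
  unfolding finite_tail_def using assms by blast

lemma finite_tail_integral: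
  assumes "finite_tail K" and near: "\<And>L. L \<ge> 0 \<Longrightarrow> \<exists>A\<ge>0. \<forall>s. 0 < s \<longrightarrow> s \<le> L \<longrightarrow> K s \<le> A / sqrt s"
  shows "(\<integral>\<^sup>+ s \<in> {0<..}. ennreal (K s) \<partial>lborel) < \<infinity>"
proof -
  obtain L B H where L: "L \<ge> 0" "B \<ge> 0" "\<And>s. s > L \<Longrightarrow> K s \<le> B * H s" "continuous_on {L<..} H"
    "(\<integral>\<^sup>+ s \<in> {L<..}. ennreal (H s) \<partial>lborel) < \<infinity>"
    using assms(1) unfolding finite_tail_def by blast
  obtain A where "A \<ge> 0" "\<And>s. 0 < s \<Longrightarrow> s \<le> L \<Longrightarrow> K s \<le> A / sqrt s"
    using near[OF L(1)] by blast
  with L show ?thesis by (intro nn_integral_kernel_finite[of L A B K H]) auto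
qed

text \<open>Covers q = 2 in (i), where e is nonnegative, and (ii), where it is nonpositive.\<close>

lemma expint_R_inv_bound:
  fixes R :: "real \<Rightarrow> ennreal"
  assumes e: "continuous_on UNIV e" "mono e"
    and f: "continuous_on UNIV f" "strict_mono f" "\<And>t. f t > 0"
    and growth: "filterlim f at_top at_top \<or> filterlim e at_top at_top"
    and tail: "\<And>a. finite_tail (\<lambda>s. 1 / sqrt (expint e f a (a + s)))"
    and R: "\<And>a. R a = ennreal C * (\<integral>\<^sup>+ t \<in> {a<..}. ennreal (1 / sqrt (expint e f a t)) \<partial>lborel)"
    and "C > 0" "d > 0"
    and bound: "\<And>a. \<tau> < ereal a \<Longrightarrow> R a < ennreal d \<Longrightarrow> b \<le> a"
  shows "ereal b \<le> max \<tau> (R_inv R d)"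
proof -
  define K where "K = (\<lambda>a s. 1 / sqrt (expint e f a (a + s)))"
  have fm: "mono f" using f(2) by (rule strict_mono_mono)
  have fn: "\<And>t. f t \<ge> 0" using f(3) by (simp add: less_imp_le)
  have W_pos: "expint e f a (a + s) > 0" if "s > 0" for a s
    using expint_pos[OF e(1) f(1) _ f(3)] that by simp
  have contK: "continuous_on {a<..} (\<lambda>t. 1 / sqrt (expint e f a t))" for a
    using expint_pos[OF e(1) f(1) _ f(3), of a]
    by (intro continuous_intros continuous_on_subset[OF continuous_on_expint[OF e(1) f(1)]]) (auto simp: less_le)
  have cont_shift: "continuous_on {0<..} (K a)" for a
    unfolding K_def by (intro continuous_on_compose2[OF contK] continuous_intros) auto
  show ?thesis
  proof (rule R_inv_bound[where K=K and C=C])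
    show "R a = ennreal C * (\<integral>\<^sup>+ s \<in> {0<..}. ennreal (K a s) \<partial>lborel)" for a
      unfolding R K_def nn_integral_Ioi_shift[OF contK] ..
    show "K a s \<ge> 0" if "s > 0" for a s
      using W_pos[OF that, of a] by (simp add: K_def)
    show "K b s < K a s" if "a < b" "s > 0" for a b s
      using expint_shift_mono(2)[OF e(1) f(1) e(2) fn _ _ fm f(2) that] W_pos[OF that(2), of a] that
      by (auto simp: K_def intro!: divide_strict_left_mono mult_pos_pos W_pos)
    show "continuous_on UNIV (\<lambda>a. K a s)" if "s > 0" for s
      unfolding K_def using W_pos[OF that] that
      by (intro continuous_intros continuous_on_expint_base e f) (auto simp: less_le)
    show "((\<lambda>a. K a s) \<longlongrightarrow> 0) at_top" if "s > 0" for s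
      unfolding K_def
      by (intro tendsto_inverse_sqrt_at_top expint_tendsto_infinity e f fm growth that)
    show "(\<integral>\<^sup>+ s \<in> {0<..}. ennreal (K a s) \<partial>lborel) < \<infinity>" for a
    proof (rule finite_tail_integral)
      show "finite_tail (K a)" using tail[of a] by (simp add: K_def)
      fix L :: real assume "L \<ge> 0"
      \<comment> \<open>For 0 < s \<le> L the exponential in \<open>expint_ge\<close> is at least
        this one, whatever the sign of e a.\<close>
      define c where "c = f a * exp (- \<bar>e a\<bar> * L / 2)"
      have "c > 0" using f(3) by (simp add: c_def)
      have "K a s \<le> (1 / sqrt c) / sqrt s" if s: "0 < s" "s \<le> L" for s
      proof -
        have "\<bar>e a\<bar> * s \<le> \<bar>e a\<bar> * L" using s by (intro mult_left_mono) auto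
        moreover have "- (\<bar>e a\<bar> * s) \<le> e a * s" using s by (simp add: abs_if mult_le_0_iff)
        ultimately have "exp (- \<bar>e a\<bar> * L / 2) \<le> exp (e a * s / 2)" by simp
        then have "c * s \<le> f a * s * exp (e a * s / 2)"
          using s f(3)[of a] by (auto simp: c_def mult_ac)
        also have "\<dots> \<le> expint e f a (a + s)"
          using expint_ge[OF e(1) f(1) e(2) fm fn] s by simp
        finally have "sqrt (c * s) \<le> sqrt (expint e f a (a + s))" by (rule real_sqrt_le_mono)
        then show ?thesis using \<open>c > 0\<close> s W_pos[of s a]
          by (simp add: K_def real_sqrt_mult frac_le)
      qed
      then show "\<exists>A\<ge>0. \<forall>s. 0 < s \<longrightarrow> s \<le> L \<longrightarrow> K a s \<le> A / sqrt s"
        using \<open>c > 0\<close> by (intro exI[of _ "1 / sqrt c"]) auto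
    qed
  qed (use assms cont_shift in auto)
qed

section \<open>Kernels built from plain integrals\<close>

lemma mono_zero: "mono (\<lambda>_::real. 0::real)"
  by (rule monoI) simp

lemmas integral_has_derivative =
  expint_has_derivative[OF continuous_on_const[of UNIV "0::real"], unfolded expint_zero mult_zero_left add_0]
lemmas continuous_on_integral_upper =
  continuous_on_expint[OF continuous_on_const[of UNIV "0::real"], unfolded expint_zero]
lemmas continuous_on_integral_base =
  continuous_on_expint_base[OF continuous_on_const[of UNIV "0::real"], unfolded expint_zero]
lemmas integral_Icc_pos =
  expint_pos[OF continuous_on_const[of UNIV "0::real"], unfolded expint_zero]
lemmas integral_Icc_nonneg =
  expint_nonneg[OF continuous_on_const[of UNIV "0::real"], unfolded expint_zero]
lemmas integral_shift_mono =
  expint_shift_mono[OF continuous_on_const[of UNIV "0::real"] _ mono_zero, unfolded expint_zero]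
lemmas integral_tendsto_infinity =
  expint_tendsto_infinity[OF continuous_on_const[of UNIV "0::real"] mono_zero, unfolded expint_zero]

lemma integral_ge_tail:
  fixes f :: "real \<Rightarrow> real"
  assumes "continuous_on UNIV f" "mono f" "\<And>t. f t \<ge> 0" "a \<le> b" "b \<le> t"
  shows "f b * (t - b) \<le> integral {a..t} f"
  using expint_ge_tail[OF continuous_on_const assms(1) mono_zero assms(2-5), unfolded expint_zero] by simp

text \<open>The kernel of (i) for q < 2. Strict monotonicity in a comes from f, since h may vanish;
  the limit 0 comes from whichever of f and h diverges.\<close>

lemma drift_R_inv_bound:
  fixes R :: "real \<Rightarrow> ennreal" and f h :: "real \<Rightarrow> real"
  assumes f: "continuous_on UNIV f" "strict_mono f" "\<And>t. f t > 0"
    and h: "continuous_on UNIV h" "mono h" "\<And>t. h t \<ge> 0"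
    and "\<sigma> > 0"
    and growth: "filterlim f at_top at_top \<or> filterlim h at_top at_top"
    and tail: "\<And>a. finite_tail (\<lambda>s. 1 / (sqrt (integral {a..a + s} f) + (integral {a..a + s} h) powr \<sigma>))"
    and R: "\<And>a. R a = ennreal C * (\<integral>\<^sup>+ t \<in> {a<..}. ennreal
      (1 / (sqrt (integral {a..t} f) + (integral {a..t} h) powr \<sigma>)) \<partial>lborel)"
    and "C > 0" "d > 0"
    and bound: "\<And>a. \<tau> < ereal a \<Longrightarrow> R a < ennreal d \<Longrightarrow> b \<le> a"
  shows "ereal b \<le> max \<tau> (R_inv R d)"
proof -
  define K where "K = (\<lambda>a s. 1 / (sqrt (integral {a..a + s} f) + (integral {a..a + s} h) powr \<sigma>))"
  have fm: "mono f" using f(2) by (rule strict_mono_mono)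
  have fn: "\<And>t. f t \<ge> 0" using f(3) by (simp add: less_imp_le)
  have P_pos: "integral {a..t} f > 0" if "a < t" for a t
    using integral_Icc_pos[OF f(1) that f(3)] .
  have den_pos: "sqrt (integral {a..t} f) + (integral {a..t} h) powr \<sigma> > 0" if "a < t" for a t
    using P_pos[OF that] by (simp add: add_pos_nonneg)
  have contK: "continuous_on {a<..} (\<lambda>t. 1 / (sqrt (integral {a..t} f) + (integral {a..t} h) powr \<sigma>))" for a
    using den_pos[of a] \<open>\<sigma> > 0\<close> integral_Icc_nonneg[OF h(1,3)]
    by (intro continuous_intros continuous_on_powr' continuous_on_subset[OF continuous_on_integral_upper[OF f(1)]]
      continuous_on_subset[OF continuous_on_integral_upper[OF h(1)]]) (auto simp: less_le)
  have cont_shift: "continuous_on {0<..} (K a)" for a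
    unfolding K_def by (intro continuous_on_compose2[OF contK] continuous_intros) auto
  have le: "K a s \<le> 1 / sqrt (integral {a..a + s} f)" if "s > 0" for a s
    using P_pos[of a "a + s"] that by (auto simp: K_def intro!: frac_le)
  have nonneg: "K a s \<ge> 0" if "s > 0" for a s
    using den_pos[of a "a + s"] that by (simp add: K_def)
  show ?thesis
  proof (rule R_inv_bound[where K=K and C=C])
    show "R a = ennreal C * (\<integral>\<^sup>+ s \<in> {0<..}. ennreal (K a s) \<partial>lborel)" for a
      unfolding R K_def nn_integral_Ioi_shift[OF contK] ..
    show "K b s < K a s" if "a < b" "s > 0" for a b s
    proof -
      have "sqrt (integral {a..a + s} f) < sqrt (integral {b..b + s} f)"
        using integral_shift_mono(2)[OF f(1) fn _ _ fm f(2) that] that by simp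
      moreover have "(integral {a..a + s} h) powr \<sigma> \<le> (integral {b..b + s} h) powr \<sigma>"
        using integral_shift_mono(1)[OF h(1) h(3) _ _ h(2), of a b s] that \<open>\<sigma> > 0\<close>
        by (intro powr_mono2 integral_Icc_nonneg h) auto
      ultimately have "sqrt (integral {a..a + s} f) + (integral {a..a + s} h) powr \<sigma>
          < sqrt (integral {b..b + s} f) + (integral {b..b + s} h) powr \<sigma>"
        by (rule add_less_le_mono)
      then show ?thesis
        unfolding K_def using den_pos[of a "a + s"] den_pos[of b "b + s"] that
        by (intro divide_strict_left_mono mult_pos_pos) auto
    qed
    show "continuous_on UNIV (\<lambda>a. K a s)" if "s > 0" for s
    proof -
      have "sqrt (integral {a..a + s} f) + (integral {a..a + s} h) powr \<sigma> \<noteq> 0" for a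
        using den_pos[of a "a + s"] that by simp
      then show ?thesis unfolding K_def using that \<open>\<sigma> > 0\<close> integral_Icc_nonneg[OF h(1,3)]
        by (intro continuous_intros continuous_on_powr' continuous_on_integral_base f h) auto
    qed
    show "((\<lambda>a. K a s) \<longlongrightarrow> 0) at_top" if s: "s > 0" for s
      using growth
    proof
      assume "filterlim f at_top at_top"
      then have "((\<lambda>a. 1 / sqrt (integral {a..a + s} f)) \<longlongrightarrow> 0) at_top"
        by (intro tendsto_inverse_sqrt_at_top integral_tendsto_infinity f fm s) simp
      then show ?thesis
        by (rule tendsto_sandwich[OF _ _ tendsto_const, rotated 2]) (use nonneg le s in auto)
    next
      assume lim: "filterlim h at_top at_top"
      have "filterlim (\<lambda>a. s * h a) at_top at_top"
        using s lim by (intro filterlim_tendsto_pos_mult_at_top[OF tendsto_const]) auto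
      then have "((\<lambda>a. (s * h a) powr - \<sigma>) \<longlongrightarrow> 0) at_top"
        using \<open>\<sigma> > 0\<close> by (intro tendsto_neg_powr) auto
      moreover have "\<forall>\<^sub>F a in at_top. K a s \<le> (s * h a) powr - \<sigma>"
        using filterlim_at_top_dense[THEN iffD1, OF lim, rule_format, of 0]
      proof eventually_elim
        case (elim a)
        have "s * h a \<le> integral {a..a + s} h"
          using integral_ge_tail[OF h, of a a "a + s"] s by (simp add: mult.commute)
        then have "(s * h a) powr \<sigma> \<le> (integral {a..a + s} h) powr \<sigma>"
          using s h(3)[of a] \<open>\<sigma> > 0\<close> by (intro powr_mono2) auto
        then have "(s * h a) powr \<sigma> \<le> sqrt (integral {a..a + s} f) + (integral {a..a + s} h) powr \<sigma>"
          using P_pos[of a "a + s"] s by (simp add: add_increasing)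
        then show ?case using elim s by (simp add: K_def powr_minus_divide frac_le)
      qed
      ultimately show ?thesis
        by (intro tendsto_sandwich[where g="\<lambda>a. K a s", OF _ _ tendsto_const]) (use nonneg s in auto)
    qed
    show "(\<integral>\<^sup>+ s \<in> {0<..}. ennreal (K a s) \<partial>lborel) < \<infinity>" for a
    proof (rule finite_tail_integral)
      show "finite_tail (K a)" using tail[of a] by (simp add: K_def)
      fix L :: real assume "L \<ge> 0"
      have "K a s \<le> (1 / sqrt (f a)) / sqrt s" if s: "0 < s" for s
      proof -
        have "f a * s \<le> integral {a..a + s} f"
          using integral_ge_tail[OF f(1) fm fn, of a a "a + s"] s by simp
        then have "sqrt (f a) * sqrt s \<le> sqrt (integral {a..a + s} f)"
          by (simp flip: real_sqrt_mult)
        then have "1 / sqrt (integral {a..a + s} f) \<le> (1 / sqrt (f a)) / sqrt s"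
          using f(3)[of a] s by (simp add: frac_le)
        then show ?thesis using le[OF s, of a] by linarith
      qed
      then show "\<exists>A\<ge>0. \<forall>s. 0 < s \<longrightarrow> s \<le> L \<longrightarrow> K a s \<le> A / sqrt s"
        using f(3)[of a] by (intro exI[of _ "1 / sqrt (f a)"]) (auto simp: less_imp_le)
    qed
  qed (use assms cont_shift nonneg in auto)
qed

lemma integral_shift_antimono:
  fixes k :: "real \<Rightarrow> real"
  assumes "continuous_on UNIV k" "antimono k" "a \<le> b" "0 \<le> s"
  shows "integral {b..b + s} k \<le> integral {a..a + s} k"
proof -
  have "integral {0 + b..s + b} k \<le> integral {0 + a..s + a} k"
    unfolding integral_shift_Icc_real[symmetric] comp_def using assms(3)
    by (intro integral_le integrable_continuous_interval continuous_on_compose2[OF assms(1)] continuous_intros)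
      (auto intro: antimonoD[OF assms(2)])
  then show ?thesis by (simp add: add.commute)
qed

lemma integral_le_base:
  fixes k :: "real \<Rightarrow> real"
  assumes "continuous_on UNIV k" "antimono k" "a \<le> t"
  shows "integral {a..t} k \<le> k a * (t - a)"
proof -
  have "integral {a..t} k \<le> integral {a..t} (\<lambda>_. k a)" using assms
    by (intro integral_le integrable_continuous_interval continuous_on_subset[OF assms(1)] continuous_intros)
      (auto intro: antimonoD)
  then show ?thesis using \<open>a \<le> t\<close> by (simp add: mult.commute)
qed

text \<open>The kernel of (iii). As k is nonincreasing and f increasing, the quotient of their
  integrals is at most k a / f a. This bounds the second term near s = 0 and makes it vanish for
  large a.\<close>

lemma absorption_R_inv_bound:
  fixes R :: "real \<Rightarrow> ennreal" and f k :: "real \<Rightarrow> real"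
  assumes f: "continuous_on UNIV f" "strict_mono f" "\<And>t. f t > 0"
    and k: "continuous_on UNIV k" "antimono k" "\<And>t. k t \<ge> 0"
    and "\<sigma> > 0"
    and growth: "filterlim f at_top at_top"
    and tail: "\<And>a. finite_tail (\<lambda>s. 1 / sqrt (integral {a..a + s} f) + (integral {a..a + s} k / integral {a..a + s} f) powr \<sigma>)"
    and R: "\<And>a. R a = ennreal C * (\<integral>\<^sup>+ t \<in> {a<..}. ennreal
      (1 / sqrt (integral {a..t} f) + (integral {a..t} k / integral {a..t} f) powr \<sigma>) \<partial>lborel)"
    and "C > 0" "d > 0"
    and bound: "\<And>a. \<tau> < ereal a \<Longrightarrow> R a < ennreal d \<Longrightarrow> b \<le> a"
  shows "ereal b \<le> max \<tau> (R_inv R d)"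
proof -
  define K where "K = (\<lambda>a s. 1 / sqrt (integral {a..a + s} f) + (integral {a..a + s} k / integral {a..a + s} f) powr \<sigma>)"
  have fm: "mono f" using f(2) by (rule strict_mono_mono)
  have fn: "\<And>t. f t \<ge> 0" using f(3) by (simp add: less_imp_le)
  have P_pos: "integral {a..t} f > 0" if "a < t" for a t
    using integral_Icc_pos[OF f(1) that f(3)] .
  have G_nonneg: "integral {a..t} k \<ge> 0" for a t
    using integral_Icc_nonneg[OF k(1,3)] .
  have contK: "continuous_on {a<..} (\<lambda>t. 1 / sqrt (integral {a..t} f) + (integral {a..t} k / integral {a..t} f) powr \<sigma>)" for a
    using P_pos[of a] \<open>\<sigma> > 0\<close> G_nonneg
    by (intro continuous_intros continuous_on_powr' continuous_on_subset[OF continuous_on_integral_upper[OF f(1)]]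
      continuous_on_subset[OF continuous_on_integral_upper[OF k(1)]]) (auto simp: less_le)
  have cont_shift: "continuous_on {0<..} (K a)" for a
    unfolding K_def by (intro continuous_on_compose2[OF contK] continuous_intros) auto
  have P_ge: "f a * s \<le> integral {a..a + s} f" if "s > 0" for a s
    using integral_ge_tail[OF f(1) fm fn, of a a "a + s"] that by simp
  have ratio: "(integral {a..a + s} k / integral {a..a + s} f) powr \<sigma> \<le> (k a / f a) powr \<sigma>" if "s > 0" for a s
  proof -
    have "integral {a..a + s} k / integral {a..a + s} f \<le> (k a * s) / (f a * s)"
      using integral_le_base[OF k(1,2), of a "a + s"] that f(3)[of a] k(3)[of a]
      by (intro frac_le P_ge) auto
    then show ?thesis using that G_nonneg P_pos[of a "a + s"] \<open>\<sigma> > 0\<close> by (intro powr_mono2) auto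
  qed
  show ?thesis
  proof (rule R_inv_bound[where K=K and C=C])
    show "R a = ennreal C * (\<integral>\<^sup>+ s \<in> {0<..}. ennreal (K a s) \<partial>lborel)" for a
      unfolding R K_def nn_integral_Ioi_shift[OF contK] ..
    show "K a s \<ge> 0" if "s > 0" for a s
      using P_pos[of a "a + s"] that by (simp add: K_def)
    show "K b s < K a s" if "a < b" "s > 0" for a b s
    proof -
      have P: "integral {a..a + s} f < integral {b..b + s} f"
        using integral_shift_mono(2)[OF f(1) fn _ _ fm f(2) that] that by simp
      have pos: "integral {a..a + s} f > 0" "integral {b..b + s} f > 0" using P_pos that by auto
      have "1 / sqrt (integral {b..b + s} f) < 1 / sqrt (integral {a..a + s} f)"
        using P pos by (intro divide_strict_left_mono) auto
      moreover have "(integral {b..b + s} k / integral {b..b + s} f) powr \<sigma> \<le> (integral {a..a + s} k / integral {a..a + s} f) powr \<sigma>"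
        using integral_shift_antimono[OF k(1,2), of a b s] that \<open>\<sigma> > 0\<close> P pos G_nonneg
        by (intro powr_mono2 frac_le) auto
      ultimately show ?thesis by (simp add: K_def)
    qed
    show "continuous_on UNIV (\<lambda>a. K a s)" if "s > 0" for s
    proof -
      have "integral {a..a + s} f \<noteq> 0" for a using P_pos[of a "a + s"] that by simp
      moreover have "integral {a..a + s} k / integral {a..a + s} f \<ge> 0" for a
        using P_pos[of a "a + s"] G_nonneg that by simp
      ultimately show ?thesis unfolding K_def using that \<open>\<sigma> > 0\<close>
        by (intro continuous_intros continuous_on_powr' continuous_on_integral_base f k) auto
    qed
    show "((\<lambda>a. K a s) \<longlongrightarrow> 0) at_top" if s: "s > 0" for s
    proof -
      have "((\<lambda>a. k 0 / f a) \<longlongrightarrow> 0) at_top"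
        using growth by (intro real_tendsto_divide_at_top[OF tendsto_const])
      then have "((\<lambda>a. (k 0 / f a) powr \<sigma>) \<longlongrightarrow> 0 powr \<sigma>) at_top"
        using f(3) k(3) \<open>\<sigma> > 0\<close> by (intro tendsto_powr' tendsto_const) (auto simp: less_imp_le)
      then have "((\<lambda>a. (k 0 / f a) powr \<sigma>) \<longlongrightarrow> 0) at_top" by simp
      then have "((\<lambda>a. 1 / sqrt (integral {a..a + s} f) + (k 0 / f a) powr \<sigma>) \<longlongrightarrow> 0 + 0) at_top"
        using growth \<open>\<sigma> > 0\<close>
        by (intro tendsto_add tendsto_inverse_sqrt_at_top integral_tendsto_infinity f fm s) auto
      moreover have "\<forall>\<^sub>F a in at_top. K a s \<le> 1 / sqrt (integral {a..a + s} f) + (k 0 / f a) powr \<sigma>"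
        using eventually_ge_at_top[of 0]
      proof eventually_elim
        case (elim a)
        have "(k a / f a) powr \<sigma> \<le> (k 0 / f a) powr \<sigma>"
          using f(3)[of a] k(3)[of a] antimonoD[OF k(2) elim] \<open>\<sigma> > 0\<close> by (intro powr_mono2 divide_right_mono) auto
        then show ?case using ratio[OF s, of a] by (simp add: K_def)
      qed
      moreover have "K a s \<ge> 0" for a using P_pos[of a "a + s"] s by (simp add: K_def)
      ultimately show ?thesis
        by (intro tendsto_sandwich[where g="\<lambda>a. K a s", OF _ _ tendsto_const]) auto
    qed
    show "(\<integral>\<^sup>+ s \<in> {0<..}. ennreal (K a s) \<partial>lborel) < \<infinity>" for a
    proof (rule finite_tail_integral)
      show "finite_tail (K a)" using tail[of a] by (simp add: K_def)
      fix L :: real assume "L \<ge> 0"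
      \<comment> \<open>The quotient term is only bounded; the factor sqrt L / sqrt s \<ge> 1 brings
        it into the form A / sqrt s.\<close>
      define A where "A = 1 / sqrt (f a) + (k a / f a) powr \<sigma> * sqrt L"
      have "K a s \<le> A / sqrt s" if s: "0 < s" "s \<le> L" for s
      proof -
        have "sqrt (f a) * sqrt s \<le> sqrt (integral {a..a + s} f)"
          using P_ge[OF s(1)] by (simp flip: real_sqrt_mult)
        then have "1 / sqrt (integral {a..a + s} f) \<le> (1 / sqrt (f a)) / sqrt s"
          using f(3)[of a] s by (simp add: frac_le)
        moreover have "(k a / f a) powr \<sigma> * 1 \<le> (k a / f a) powr \<sigma> * (sqrt L / sqrt s)"
          using s by (intro mult_left_mono) (auto simp: le_divide_eq)
        ultimately show ?thesis using ratio[OF s(1), of a] by (simp add: K_def A_def add_divide_distrib)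
      qed
      then show "\<exists>A\<ge>0. \<forall>s. 0 < s \<longrightarrow> s \<le> L \<longrightarrow> K a s \<le> A / sqrt s"
        using f(3)[of a] \<open>L \<ge> 0\<close> by (intro exI[of _ A]) (auto simp: A_def)
    qed
  qed (use assms cont_shift in auto)
qed

section \<open>Barriers\<close>

text \<open>The tangent at 1 to a concave power, obtained from Young's inequality with second factor
  1.\<close>

lemma Bernoulli_powr:
  fixes x p :: real
  assumes "0 \<le> x" "0 < p" "p \<le> 1"
  shows "x powr p \<le> 1 + p * (x - 1)"
proof (cases "x = 0")
  case False
  then show ?thesis
    using Youngs_inequality_0[of p "1 - p" x 1] assms by (simp add: algebra_simps)
qed (use assms in simp)

lemma power2_powr: "(x powr s)\<^sup>2 = x powr (2 * s)" for x s :: real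
  by (simp only: power2_eq_square mult_2 powr_add)

text \<open>Used at the base point, where the integral of g^+ is 0; there the one-sided difference
  quotient is a positive power of the variable.\<close>

lemma powr_has_derivative_nonneg:
  fixes x r :: real
  assumes "0 \<le> x" "1 < r"
  shows "((\<lambda>x. x powr r) has_real_derivative r * x powr (r - 1)) (at x within {0..})"
proof (cases "x = 0")
  case False
  then have "((\<lambda>x. x powr r) has_real_derivative r * x powr (r - 1)) (at x)"
    using DERIV_fun_powr[OF DERIV_ident, of x r] assms by simp
  then show ?thesis by (rule has_field_derivative_at_within)
next
  case True
  have "((\<lambda>y. y powr (r - 1)) \<longlongrightarrow> 0 powr (r - 1)) (at (0::real) within {0..})"
    using assms by (intro tendsto_powr' tendsto_const tendsto_ident_at) (auto simp: eventually_at_filter)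
  then have "((\<lambda>y. y powr (r - 1)) \<longlongrightarrow> 0) (at (0::real) within {0..})" by simp
  moreover have "\<forall>\<^sub>F y in at (0::real) within {0..}. y powr (r - 1) = y powr r / y"
    by (auto simp: eventually_at_filter powr_diff)
  ultimately have "((\<lambda>y. y powr r / y) \<longlongrightarrow> 0) (at (0::real) within {0..})"
    by (rule Lim_transform_eventually)
  then show ?thesis using True assms by (simp add: has_field_derivative_iff)
qed

text \<open>On the interval e \<le> e t and f \<le> f t, and with both frozen at t the integral is
  elementary. Multiplying by - e t instead of dividing keeps e t = 0 in the statement. In the damped
  case this yields y' > 0.\<close>

lemma expint_le:
  fixes e f :: "real \<Rightarrow> real"
  assumes e: "continuous_on UNIV e" "mono e" and f: "continuous_on UNIV f" "mono f" "\<And>t. f t \<ge> 0"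
    and "a \<le> t" "e t \<le> 0"
  shows "- e t * expint e f a t \<le> f t * (1 - exp (e t * (t - a)))"
proof -
  obtain E where E: "\<And>x. (E has_real_derivative e x) (at x)"
    by (rule antiderivative_real[OF e(1)]) blast
  have contE: "continuous_on UNIV E" by (rule DERIV_imp_continuous_on[OF E])
  have int: "integral {x..t} e = E t - E x" if "x \<le> t" for x
    using integral_unique[OF integral_antiderivative[OF that E]] .
  have "((\<lambda>x. - e t * exp (e t * (t - x))) has_integral exp (e t * (t - t)) - exp (e t * (t - a))) {a..t}"
    using \<open>a \<le> t\<close> by (intro integral_antiderivative) (auto intro!: derivative_eq_intros)
  then have int1: "((\<lambda>x. f t * (- e t * exp (e t * (t - x)))) has_integral f t * (exp (e t * (t - t)) - exp (e t * (t - a)))) {a..t}"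
    by (rule has_integral_mult_right)
  have "continuous_on {a..t} (\<lambda>x. exp (E t - E x) * f x)"
    by (intro continuous_intros continuous_on_subset[OF f(1)] continuous_on_compose2[OF contE]) auto
  then have "(\<lambda>x. exp (E t - E x) * f x) integrable_on {a..t}"
    by (rule integrable_continuous_interval)
  then have "(\<lambda>x. exp (integral {x..t} e) * f x) integrable_on {a..t}"
    by (rule integrable_eq) (simp add: int)
  then have "((\<lambda>x. exp (integral {x..t} e) * f x) has_integral expint e f a t) {a..t}"
    unfolding expint_def by (rule integrable_integral)
  then have int2: "((\<lambda>x. - e t * (exp (integral {x..t} e) * f x)) has_integral - e t * expint e f a t) {a..t}"
    by (rule has_integral_mult_right)
  from int2 int1 have "- e t * expint e f a t \<le> f t * (exp (e t * (t - t)) - exp (e t * (t - a)))"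
  proof (rule has_integral_le)
    fix x assume x: "x \<in> {a..t}"
    have "integral {x..t} e \<le> integral {x..t} (\<lambda>_. e t)"
      using x by (intro integral_le integrable_continuous_interval continuous_on_subset[OF e(1)] continuous_intros)
        (auto intro: monoD[OF e(2)])
    then have "exp (integral {x..t} e) \<le> exp (e t * (t - x))" using x by (simp add: mult.commute)
    then have "exp (integral {x..t} e) * f x \<le> exp (e t * (t - x)) * f t"
      using x f(3) monoD[OF f(2), of x t] by (intro mult_mono) auto
    then have "- e t * (exp (integral {x..t} e) * f x) \<le> - e t * (exp (e t * (t - x)) * f t)"
      using \<open>e t \<le> 0\<close> by (intro mult_left_mono) auto
    then show "- e t * (exp (integral {x..t} e) * f x) \<le> f t * (- e t * exp (e t * (t - x)))"
      by (simp add: mult_ac)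
  qed
  then show ?thesis by simp
qed

lemma nn_integral_Ioi_scale_le:
  fixes a :: real
  assumes c: "c \<ge> 0" and le: "\<And>t. t > a \<Longrightarrow> h t \<le> c * k t"
    and k: "continuous_on {a<..} k" and R: "ennreal c * (\<integral>\<^sup>+ t \<in> {a<..}. ennreal (k t) \<partial>lborel) < D"
  shows "(\<integral>\<^sup>+ t \<in> {a<..}. ennreal (h t) \<partial>lborel) < D"
proof -
  have "(\<integral>\<^sup>+ t \<in> {a<..}. ennreal (h t) \<partial>lborel) \<le> (\<integral>\<^sup>+ t. ennreal c * (ennreal (k t) * indicator {a<..} t) \<partial>lborel)"
  proof (rule nn_integral_mono)
    fix t
    show "ennreal (h t) * indicator {a<..} t \<le> ennreal c * (ennreal (k t) * indicator {a<..} t)"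
      using le[of t] c by (auto simp: indicator_def simp flip: ennreal_mult' intro: ennreal_leI)
  qed
  also have "\<dots> = ennreal c * (\<integral>\<^sup>+ t \<in> {a<..}. ennreal (k t) \<partial>lborel)"
    using measurable_ennreal_indicator[OF k] by (intro nn_integral_cmult) simp
  finally show ?thesis using R by (rule le_less_trans)
qed

text \<open>One point and one ball are fixed, so d is just a radius here; it becomes the distance to
  the frontier in the final theorem. The dimension is a real n to keep casts out of the
  formulas.\<close>

locale subsolution =
  fixes f g :: "real \<Rightarrow> real" and F :: "real^'n \<Rightarrow> real^'n^'n \<Rightarrow> real"
    and \<Omega> :: "(real^'n) set" and q :: real and u :: "real^'n \<Rightarrow> real"
    and x0 :: "real^'n" and d n :: real
  assumes f_cont: "continuous_on UNIV f" and g_cont: "continuous_on UNIV g"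
    and f_mono: "strict_mono f" and g_mono: "mono g" and f_pos: "f t > 0"
    and q_pos: "0 < q" and q_le: "q \<le> 2"
    and F: "admissible_F F" and usc: "usc_on \<Omega> u" and sub: "visc_subsol F f g q \<Omega> u"
    and ball: "ball x0 d \<subseteq> \<Omega>" and d_pos: "d > 0"
    and n_eq: "n = real CARD('n)"
begin

lemma n_ge_1: "n \<ge> 1"
  by (simp add: n_eq Suc_leI)

lemmas blow_up = blow_up_bound[OF f_mono g_mono F usc sub ball, folded n_eq]

lemma f_mono': "mono f"
  using f_mono by (rule strict_mono_mono)

lemma f_nonneg: "f t \<ge> 0"
  using f_pos by (rule less_imp_le)

lemma pos_part_cont: "continuous_on UNIV (\<lambda>t. pos_part (g t))"
  unfolding pos_part_def by (intro continuous_intros g_cont)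

lemma pos_part_mono: "mono (\<lambda>t. pos_part (g t))"
  using g_mono by (auto simp: mono_def pos_part_def intro: max.coboundedI1)

lemma pos_part_nonneg: "pos_part a \<ge> 0"
  by (simp add: pos_part_def)

lemma neg_part_cont: "continuous_on UNIV (\<lambda>t. neg_part (g t))"
  unfolding neg_part_def by (intro continuous_intros g_cont)

lemma neg_part_antimono: "antimono (\<lambda>t. neg_part (g t))"
  using g_mono by (auto simp: monotone_def neg_part_def intro: max.coboundedI1)

lemma neg_part_nonneg: "neg_part a \<ge> 0"
  by (simp add: neg_part_def)

text \<open>From a on, g = g^+ = h. The two summands of y solve n y' / 2 = f and n y' / 2 = h
  y^(q/2), each starting from 0. Their sum satisfies the inequality because y dominates its second
  summand.\<close>

lemma bound_drift:
  assumes q: "q < 2" and a: "g a \<ge> 0" and R: "R_i CARD('n) q f g a < ennreal d"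
  shows "u x0 \<le> a"
proof -
  define h where "h = (\<lambda>t. pos_part (g t))"
  have h: "continuous_on UNIV h" "mono h" "\<And>t. h t \<ge> 0"
    unfolding h_def using pos_part_cont pos_part_mono pos_part_nonneg by auto
  have h_eq: "h t = g t" if "t \<ge> a" for t
    using monoD[OF g_mono that] a by (simp add: h_def pos_part_def)
  define \<sigma> where "\<sigma> = 1 / (2 - q)"
  define c where "c = (2 - q) / n"
  have "\<sigma> > 0" "c > 0" using q n_ge_1 by (auto simp: \<sigma>_def c_def)
  have exps: "2 / (2 - q) = 2 * \<sigma>" "q / (2 - q) = q * \<sigma>" "2 * \<sigma> - 1 = q * \<sigma>" "2 * \<sigma> > 1"
    using q q_pos by (auto simp: \<sigma>_def field_simps)
  define P where "P = (\<lambda>t. integral {a..t} f)"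
  define Q where "Q = (\<lambda>t. integral {a..t} h)"
  have P: "P a = 0" "\<And>t. t \<ge> a \<Longrightarrow> (P has_real_derivative f t) (at t within {a..})" "\<And>t. P t \<ge> 0"
    "\<And>t. t > a \<Longrightarrow> P t > 0" "continuous_on {a..} P"
    unfolding P_def using integral_has_derivative[OF f_cont] integral_Icc_nonneg[OF f_cont f_nonneg]
      integral_Icc_pos[OF f_cont _ f_pos] continuous_on_integral_upper[OF f_cont] by auto
  have Q: "Q a = 0" "\<And>t. t \<ge> a \<Longrightarrow> (Q has_real_derivative h t) (at t within {a..})" "\<And>t. Q t \<ge> 0"
    "continuous_on {a..} Q"
    unfolding Q_def using integral_has_derivative[OF h(1)] integral_Icc_nonneg[OF h(1,3)]
      continuous_on_integral_upper[OF h(1)] by auto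
  have Q_mono: "Q s \<le> Q t" if "a \<le> s" "s \<le> t" for s t
    unfolding Q_def using that h(3)
    by (intro integral_subset_le integrable_continuous_interval continuous_on_subset[OF h(1)]) auto
  define y where "y = (\<lambda>t. 2 / n * P t + (c * Q t) powr (2 * \<sigma>))"
  define w where "w = (\<lambda>t. 2 / n * f t + 2 / n * h t * (c * Q t) powr (q * \<sigma>))"
  show ?thesis
  proof (rule blow_up[where y=y and w=w and v="\<lambda>t. w t / 2"])
    show "continuous_on {a..} w" unfolding w_def
      using \<open>c > 0\<close> Q(3) q_pos \<open>\<sigma> > 0\<close>
      by (intro continuous_intros continuous_on_powr' continuous_on_subset[OF f_cont] continuous_on_subset[OF h(1)] Q(4)) auto
    show "w t > 0" for t
      unfolding w_def using n_ge_1 f_pos[of t] h(3)[of t] by (intro add_pos_nonneg) auto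
    show "y a = 0" by (simp add: y_def P(1) Q(1))
    show "(y has_real_derivative w t) (at t within {a..})" if "t \<ge> a" for t
    proof -
      have "((\<lambda>t. c * Q t) has_real_derivative c * h t) (at t within {a..})"
        by (rule DERIV_cmult[OF Q(2)[OF that]])
      moreover have "((\<lambda>x. x powr (2 * \<sigma>)) has_real_derivative 2 * \<sigma> * (c * Q t) powr (2 * \<sigma> - 1))
          (at (c * Q t) within (\<lambda>t. c * Q t) ` {a..})"
        using \<open>c > 0\<close> Q(3) exps(4)
        by (intro DERIV_subset[OF powr_has_derivative_nonneg]) auto
      ultimately have "((\<lambda>t. (c * Q t) powr (2 * \<sigma>)) has_real_derivative
          (2 * \<sigma> * (c * Q t) powr (2 * \<sigma> - 1)) * (c * h t)) (at t within {a..})"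
        using DERIV_image_chain[of "\<lambda>x. x powr (2 * \<sigma>)" _ "\<lambda>t. c * Q t"] by (simp add: comp_def)
      from DERIV_add[OF DERIV_cmult[OF P(2)[OF that], of "2 / n"] this]
      have "(y has_real_derivative 2 / n * f t + (2 * \<sigma> * (c * Q t) powr (2 * \<sigma> - 1)) * (c * h t)) (at t within {a..})"
        by (simp add: y_def)
      moreover have "\<sigma> * c = 1 / n" using q by (simp add: \<sigma>_def c_def)
      then have "(2 * \<sigma> * (c * Q t) powr (2 * \<sigma> - 1)) * (c * h t) = 2 / n * h t * (c * Q t) powr (q * \<sigma>)"
        unfolding exps(3) by (metis (no_types, opaque_lifting) mult.assoc mult.commute times_divide_eq_right mult.right_neutral)
      ultimately show ?thesis by (simp add: w_def)
    qed
    show "mono_on {a..} (\<lambda>t. w t / 2)"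
    proof (rule monotone_onI)
      fix s t assume "s \<in> {a..}" "t \<in> {a..}" "s \<le> t"
      then show "w s / 2 \<le> w t / 2"
        unfolding w_def using n_ge_1 \<open>c > 0\<close> h(3) Q(3) q_pos \<open>\<sigma> > 0\<close> Q_mono[of s t]
        by (intro divide_right_mono add_mono mult_mono powr_mono2 monoD[OF f_mono'] monoD[OF h(2)])
          (auto intro!: mult_nonneg_nonneg mult_left_mono f_nonneg)
    qed
    show "w t / 2 + (n - 1) * (w t / 2) \<le> f t + g t * y t powr (q / 2)" if "t \<ge> a" for t
    proof -
      have "(c * Q t) powr (q * \<sigma>) = ((c * Q t) powr (2 * \<sigma>)) powr (q / 2)"
        by (simp add: powr_powr mult.commute)
      also have "\<dots> \<le> y t powr (q / 2)"
        using n_ge_1 P(3)[of t] q_pos by (intro powr_mono2) (auto simp: y_def)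
      finally have "h t * (c * Q t) powr (q * \<sigma>) \<le> h t * y t powr (q / 2)"
        using h(3) by (rule mult_left_mono)
      moreover have "w t / 2 + (n - 1) * (w t / 2) = f t + h t * (c * Q t) powr (q * \<sigma>)"
        using n_ge_1 by (simp add: w_def field_simps)
      ultimately show ?thesis using h_eq[OF that] by simp
    qed
    show "(\<integral>\<^sup>+ t \<in> {a<..}. ennreal (1 / sqrt (y t)) \<partial>lborel) < ennreal d"
    proof (rule nn_integral_Ioi_scale_le)
      define k where "k = (\<lambda>t. 1 / (sqrt (P t) + Q t powr \<sigma>))"
      have pos: "sqrt (P t) + Q t powr \<sigma> > 0" if "t > a" for t
        using P(4)[OF that] by (simp add: add_pos_nonneg)
      show "continuous_on {a<..} k" unfolding k_def using pos \<open>\<sigma> > 0\<close> Q(3)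
        by (intro continuous_intros continuous_on_powr' continuous_on_subset[OF P(5)] continuous_on_subset[OF Q(4)])
          (auto simp: less_le)
      define C where "C = 2 * (n / (2 - q)) powr \<sigma>"
      show "ennreal C * (\<integral>\<^sup>+ t \<in> {a<..}. ennreal (k t) \<partial>lborel) < ennreal d"
        using R q by (simp add: R_i_def n_eq C_def \<sigma>_def k_def P_def Q_def h_def)
      show "C \<ge> 0" by (simp add: C_def)
      fix t assume t: "t > a"
      have C_eq: "C = 2 / c powr \<sigma>"
        using q n_ge_1 by (simp add: C_def c_def powr_divide)
      \<comment> \<open>The radius has one constant for both terms of its denominator, so the
        coefficient sqrt (2 / n) of sqrt P is weakened to that of the second term. In logarithms
        this follows from ln x \<le> x - 1 at (2 - q) / 2 and at 2 / n.\<close>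
      have "c powr \<sigma> \<le> sqrt (2 / n)"
      proof -
        have "ln (2 / n) \<le> 2 / n - 1" using n_ge_1 by (intro ln_le_minus_one) simp
        also have "\<dots> \<le> 1" using n_ge_1 by (simp add: divide_le_eq)
        finally have L: "q * ln (2 / n) \<le> q * 1" using q_pos by (intro mult_left_mono) auto
        have A: "ln ((2 - q) / 2) \<le> (2 - q) / 2 - 1" using q by (intro ln_le_minus_one) auto
        have c: "ln c = ln ((2 - q) / 2) + ln (2 / n)"
          using q n_ge_1 by (simp add: c_def ln_div ln_mult)
        have arith: "2 * x \<le> - y + 2 * l" if "y \<le> q * 1" "z \<le> (2 - q) / 2 - 1" "x = z + l" for x y z l :: real
          using that by (simp add: field_simps)
        have "2 * ln c \<le> - (q * ln (2 / n)) + 2 * ln (2 / n)" by (rule arith[OF L A c])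
        then have "2 * ln c \<le> (2 - q) * ln (2 / n)" by (simp add: algebra_simps)
        then have "\<sigma> * ln c \<le> ln (2 / n) / 2" using q by (simp add: \<sigma>_def field_simps)
        then have "exp (\<sigma> * ln c) \<le> exp (1 / 2 * ln (2 / n))" by simp
        moreover have "exp (\<sigma> * ln c) = c powr \<sigma>" using \<open>c > 0\<close> by (simp add: powr_def)
        moreover have "exp (1 / 2 * ln (2 / n)) = (2 / n) powr (1 / 2)" using n_ge_1 by (simp add: powr_def)
        ultimately show ?thesis using n_ge_1 by (simp add: powr_half_sqrt)
      qed
      then have "c powr \<sigma> * sqrt (P t) \<le> sqrt (2 / n * P t)"
        unfolding real_sqrt_mult using P(3) by (intro mult_right_mono) auto
      also have "\<dots> \<le> sqrt (y t)" by (simp add: y_def)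
      finally have 1: "c powr \<sigma> * sqrt (P t) \<le> sqrt (y t)" .
      have "((c * Q t) powr \<sigma>)\<^sup>2 = (c * Q t) powr (2 * \<sigma>)"
        by (rule power2_powr)
      also have "\<dots> \<le> y t" using n_ge_1 P(3)[of t] by (simp add: y_def)
      finally have "(c * Q t) powr \<sigma> \<le> sqrt (y t)" by (rule real_le_rsqrt)
      then have "c powr \<sigma> * Q t powr \<sigma> \<le> sqrt (y t)"
        using \<open>c > 0\<close> Q(3)[of t] by (simp add: powr_mult)
      \<comment> \<open>Both terms are at most sqrt y, hence so is their mean; this is the factor 2
        in the radius.\<close>
      with 1 have "c powr \<sigma> * (sqrt (P t) + Q t powr \<sigma>) / 2 \<le> sqrt (y t)"
        by (simp add: algebra_simps)
      moreover have "c powr \<sigma> * (sqrt (P t) + Q t powr \<sigma>) / 2 > 0"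
        using \<open>c > 0\<close> pos[OF t] by simp
      ultimately have "1 / sqrt (y t) \<le> 1 / (c powr \<sigma> * (sqrt (P t) + Q t powr \<sigma>) / 2)"
        by (intro frac_le) auto
      also have "\<dots> = C * k t" using \<open>c > 0\<close> by (simp add: C_eq k_def)
      finally show "1 / sqrt (y t) \<le> C * k t" .
    qed
  qed simp
qed

lemma R_i_eq_expint:
  assumes "q = 2"
  shows "R_i CARD('n) q f g a = ennreal (sqrt (n / 2)) * (\<integral>\<^sup>+ t \<in> {a<..}. ennreal
    (1 / sqrt (expint (\<lambda>t. 2 / n * pos_part (g t)) f a t)) \<partial>lborel)"
  using assms by (simp add: R_i_def expint_def n_eq)

text \<open>For q = 2 the equation n y' / 2 = f + g y is linear, and y = 2 W / n solves it
  exactly.\<close>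

lemma bound_quadratic_drift:
  assumes q: "q = 2" and a: "g a \<ge> 0" and R: "R_i CARD('n) q f g a < ennreal d"
  shows "u x0 \<le> a"
proof -
  define e where "e = (\<lambda>t. 2 / n * pos_part (g t))"
  have e: "continuous_on UNIV e" "mono e" "\<And>t. e t \<ge> 0"
    unfolding e_def using pos_part_cont monoD[OF pos_part_mono] pos_part_nonneg n_ge_1
    by (auto intro!: continuous_intros monoI divide_right_mono)
  have e_eq: "e t = 2 / n * g t" if "t \<ge> a" for t
    using monoD[OF g_mono that] a by (simp add: e_def pos_part_def)
  define W where "W = expint e f a"
  have W: "W a = 0" "\<And>t. t \<ge> a \<Longrightarrow> (W has_real_derivative e t * W t + f t) (at t within {a..})" "\<And>t. W t \<ge> 0"
    "\<And>t. t > a \<Longrightarrow> W t > 0" "continuous_on {a..} W"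
    unfolding W_def using expint_has_derivative[OF e(1) f_cont] expint_nonneg[OF e(1) f_cont f_nonneg]
      expint_pos[OF e(1) f_cont _ f_pos] continuous_on_expint[OF e(1) f_cont] expint_refl[OF e(1) f_cont] by auto
  have W_mono: "W s \<le> W t" if "a \<le> s" "s \<le> t" for s t
  proof (rule DERIV_nonneg_imp_increasing_open[OF that(2)])
    fix x assume x: "s < x" "x < t"
    then have "at x within {a..} = at x" using that by (intro at_within_interior) simp
    then have "(W has_real_derivative e x * W x + f x) (at x)" using W(2)[of x] x that by simp
    moreover have "e x * W x + f x \<ge> 0" using e(3) W(3) f_nonneg by simp
    ultimately show "\<exists>y. (W has_real_derivative y) (at x) \<and> y \<ge> 0" by blast
  qed (rule continuous_on_subset[OF W(5)], use that in auto)
  define y where "y = (\<lambda>t. 2 / n * W t)"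
  define w where "w = (\<lambda>t. 2 / n * (e t * W t + f t))"
  show ?thesis
  proof (rule blow_up[where y=y and w=w and v="\<lambda>t. w t / 2"])
    show "continuous_on {a..} w" unfolding w_def
      by (intro continuous_intros continuous_on_subset[OF f_cont] continuous_on_subset[OF e(1)] W(5)) auto
    show "w t > 0" for t
      unfolding w_def using n_ge_1 f_pos[of t] e(3)[of t] W(3)[of t] by (intro mult_pos_pos add_nonneg_pos) auto
    show "y a = 0" by (simp add: y_def W(1))
    show "(y has_real_derivative w t) (at t within {a..})" if "t \<ge> a" for t
      unfolding y_def w_def by (rule DERIV_cmult[OF W(2)[OF that]])
    show "mono_on {a..} (\<lambda>t. w t / 2)"
    proof (rule monotone_onI)
      fix s t assume "s \<in> {a..}" "t \<in> {a..}" "s \<le> t"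
      then show "w s / 2 \<le> w t / 2"
        unfolding w_def using n_ge_1 e(3) W(3) W_mono[of s t]
        by (intro divide_right_mono mult_left_mono add_mono mult_mono monoD[OF f_mono'] monoD[OF e(2)]) auto
    qed
    show "w t / 2 + (n - 1) * (w t / 2) \<le> f t + g t * y t powr (q / 2)" if "t \<ge> a" for t
    proof -
      have "y t powr (q / 2) = y t" using q W(3)[of t] n_ge_1 by (simp add: y_def)
      moreover have "w t / 2 + (n - 1) * (w t / 2) = f t + g t * y t"
        using n_ge_1 e_eq[OF that] by (simp add: w_def y_def field_simps)
      ultimately show ?thesis by simp
    qed
    show "(\<integral>\<^sup>+ t \<in> {a<..}. ennreal (1 / sqrt (y t)) \<partial>lborel) < ennreal d"
    proof (rule nn_integral_Ioi_scale_le)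
      show "continuous_on {a<..} (\<lambda>t. 1 / sqrt (W t))" using W(4)
        by (intro continuous_intros continuous_on_subset[OF W(5)]) (auto simp: less_le)
      show "ennreal (sqrt (n / 2)) * (\<integral>\<^sup>+ t \<in> {a<..}. ennreal (1 / sqrt (W t)) \<partial>lborel) < ennreal d"
        using R unfolding R_i_eq_expint[OF q] W_def e_def .
      show "1 / sqrt (y t) \<le> sqrt (n / 2) * (1 / sqrt (W t))" for t
        by (simp add: y_def real_sqrt_mult real_sqrt_divide)
    qed (use n_ge_1 in simp)
  qed simp
qed

lemma W_ii_eq_expint:
  "W_ii q f g a t = expint (\<lambda>t. - 2 * ((neg_part (g t) / f t) powr (2 / q) * f t)) f a t"
  unfolding W_ii_def expint_def integral_mult_right ..

lemma damping_cont: "continuous_on UNIV (\<lambda>t. - 2 * ((neg_part (g t) / f t) powr (2 / q) * f t))"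
proof -
  have "neg_part (g t) / f t \<ge> 0" for t using neg_part_nonneg f_nonneg by simp
  moreover have "f t \<noteq> 0" for t using f_pos[of t] by simp
  ultimately show ?thesis using q_pos by (intro continuous_intros continuous_on_powr' neg_part_cont f_cont) auto
qed

text \<open>The damping rate equals (g^-)^(2/q) * f^(1 - 2/q) up to the factor - 2. Both powers are
  nonincreasing in t, the second because q \<le> 2 makes its exponent nonpositive.\<close>

lemma damping_mono: "mono (\<lambda>t. - 2 * ((neg_part (g t) / f t) powr (2 / q) * f t))"
proof (rule monoI)
  fix s t :: real assume "s \<le> t"
  have eq: "(neg_part (g t) / f t) powr (2 / q) * f t = neg_part (g t) powr (2 / q) * f t powr (1 - 2 / q)" for t
    using f_pos[of t] neg_part_nonneg[of "g t"] by (simp add: powr_divide powr_diff)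
  have "neg_part (g t) powr (2 / q) * f t powr (1 - 2 / q) \<le> neg_part (g s) powr (2 / q) * f s powr (1 - 2 / q)"
    using q_pos q_le antimonoD[OF neg_part_antimono \<open>s \<le> t\<close>] monoD[OF f_mono' \<open>s \<le> t\<close>] f_pos neg_part_nonneg
    by (intro mult_mono powr_mono2 powr_mono2') (auto simp: field_simps)
  then show "- 2 * ((neg_part (g s) / f s) powr (2 / q) * f s) \<le> - 2 * ((neg_part (g t) / f t) powr (2 / q) * f t)"
    by (simp add: eq)
qed

lemma n_powr_le_1: "n powr (1 - 2 / q) \<le> 1"
proof -
  have "n powr (1 - 2 / q) \<le> n powr 0"
    using n_ge_1 q_pos q_le by (intro powr_mono) (auto simp: field_simps)
  then show ?thesis using n_ge_1 by simp
qed

text \<open>Since \<^prop>\<open>g t \<le> 0\<close>, the second derivative of the profile need not be monotone. It is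
  however at most \<^term>\<open>f t / n\<close>, which is: this bounds the \<^term>\<open>n - 1\<close> tangential eigenvalues of
  the Hessian.\<close>

lemma bound_damped:
  assumes g: "\<And>t. g t \<le> 0" and R: "R_ii CARD('n) q f g a < ennreal d"
  shows "u x0 \<le> a"
proof -
  define z where "z = (\<lambda>t. neg_part (g t) / f t)"
  define m where "m = (\<lambda>t. z t powr (2 / q) * f t)"
  define e where "e = (\<lambda>t. - 2 * m t)"
  have e: "continuous_on UNIV e" "mono e"
    unfolding e_def m_def z_def using damping_cont damping_mono by auto
  have z_nonneg: "z t \<ge> 0" for t unfolding z_def using neg_part_nonneg f_nonneg by simp
  have m_nonneg: "m t \<ge> 0" for t unfolding m_def using f_nonneg by simp
  have g_eq: "g t = - (z t * f t)" for t
    using g[of t] f_pos[of t] by (simp add: z_def neg_part_def)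
  define W where "W = expint e f a"
  have W: "W a = 0" "\<And>t. t \<ge> a \<Longrightarrow> (W has_real_derivative e t * W t + f t) (at t within {a..})" "\<And>t. W t \<ge> 0"
    "\<And>t. t > a \<Longrightarrow> W t > 0" "continuous_on {a..} W"
    unfolding W_def using expint_has_derivative[OF e(1) f_cont] expint_nonneg[OF e(1) f_cont f_nonneg]
      expint_pos[OF e(1) f_cont _ f_pos] continuous_on_expint[OF e(1) f_cont] expint_refl[OF e(1) f_cont] by auto
  define X where "X = (\<lambda>t. z t powr (2 / q) * W t)"
  have X_nonneg: "X t \<ge> 0" for t using W(3) by (simp add: X_def)
  have mW: "m t * W t = f t * X t" for t by (simp add: m_def X_def)
  \<comment> \<open>The damping never overtakes the source f, which is to say w > 0.\<close>
  have X_less: "2 * X t < 1" if "t \<ge> a" for t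
  proof -
    have "2 * m t * W t \<le> f t * (1 - exp (e t * (t - a)))"
      using expint_le[OF e f_cont f_mono' f_nonneg that] m_nonneg[of t] by (simp add: e_def W_def)
    also have "\<dots> < f t * 1" using f_pos by (intro mult_strict_left_mono) auto
    finally have "f t * (2 * X t) < f t * 1" using mW[of t] by (simp add: mult_ac)
    then show ?thesis using f_pos[of t] by (simp only: mult_less_cancel_left_pos)
  qed
  \<comment> \<open>Chosen so that 1 / sqrt \<kappa> is the constant of the radius. Then also
    \<kappa>^(q/2) = q^(q/2) / n, which is the factor 1 / n needed in the gradient term.\<close>
  define \<kappa> where "\<kappa> = q * n powr (- 2 / q)"
  have "\<kappa> > 0" using q_pos n_ge_1 by (simp add: \<kappa>_def)
  have n\<kappa>: "n * \<kappa> \<le> q"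
  proof -
    have "n * \<kappa> = q * n powr (1 - 2 / q)"
      using n_ge_1 by (simp add: \<kappa>_def powr_diff powr_minus_divide)
    also have "\<dots> \<le> q * 1" using n_powr_le_1 q_pos by (intro mult_left_mono) auto
    finally show ?thesis by simp
  qed
  define y where "y = (\<lambda>t. \<kappa> * W t)"
  define w where "w = (\<lambda>t. \<kappa> * (e t * W t + f t))"
  have w_eq: "w t = \<kappa> * f t * (1 - 2 * X t)" for t
    using mW[of t] by (simp add: w_def e_def algebra_simps)
  have w_le: "n * w t / 2 \<le> f t * (q / 2 * (1 - 2 * X t))" if "t \<ge> a" for t
  proof -
    have "n * \<kappa> * (f t * (1 - 2 * X t) / 2) \<le> q * (f t * (1 - 2 * X t) / 2)"
      using n\<kappa> X_less[OF that] f_nonneg[of t] by (intro mult_right_mono) auto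
    then show ?thesis by (simp add: w_eq mult_ac)
  qed
  show ?thesis
  proof (rule blow_up[where y=y and w=w and v="\<lambda>t. f t / n"])
    show "continuous_on {a..} w" unfolding w_def
      by (intro continuous_intros continuous_on_subset[OF f_cont] continuous_on_subset[OF e(1)] W(5)) auto
    show "w t > 0" if "t \<ge> a" for t
      unfolding w_eq using \<open>\<kappa> > 0\<close> f_pos[of t] X_less[OF that] by simp
    show "y a = 0" by (simp add: y_def W(1))
    show "(y has_real_derivative w t) (at t within {a..})" if "t \<ge> a" for t
      unfolding y_def w_def by (rule DERIV_cmult[OF W(2)[OF that]])
    show "mono_on {a..} (\<lambda>t. f t / n)"
      using n_ge_1 by (auto intro!: monotone_onI divide_right_mono monoD[OF f_mono'])
    show "w t / 2 \<le> f t / n" if "t \<ge> a" for t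
    proof -
      have "q / 2 * (1 - 2 * X t) \<le> 1 * 1"
        using q_pos q_le X_nonneg[of t] X_less[OF that] by (intro mult_mono) auto
      then have "f t * (q / 2 * (1 - 2 * X t)) \<le> f t * 1"
        using f_nonneg[of t] by (intro mult_left_mono) auto
      then have "n * w t / 2 \<le> f t" using w_le[OF that] by simp
      then show ?thesis using n_ge_1 by (simp add: field_simps)
    qed
    show "w t / 2 + (n - 1) * (f t / n) \<le> f t + g t * y t powr (q / 2)" if "t \<ge> a" for t
    proof -
      have "z t = (z t powr (2 / q)) powr (q / 2)"
        using z_nonneg[of t] q_pos by (simp add: powr_powr)
      then have "z t * y t powr (q / 2) = (\<kappa> * X t) powr (q / 2)"
        using \<open>\<kappa> > 0\<close> W(3)[of t] by (simp add: y_def X_def powr_mult mult_ac)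
      also have "\<kappa> * X t = (q * X t) * n powr (- 2 / q)" by (simp add: \<kappa>_def)
      also have "\<dots> powr (q / 2) = (q * X t) powr (q / 2) * (n powr (- 2 / q)) powr (q / 2)"
        by (rule powr_mult)
      also have "(n powr (- 2 / q)) powr (q / 2) = 1 / n"
        using q_pos n_ge_1 by (subst powr_powr) (simp add: powr_minus_divide)
      also have "(q * X t) powr (q / 2) * (1 / n) = (q * X t) powr (q / 2) / n" by simp
      also have "\<dots> \<le> (2 * X t) powr (q / 2) / n"
        using q_pos q_le n_ge_1 X_nonneg[of t] by (intro divide_right_mono powr_mono2 mult_right_mono) auto
      \<comment> \<open>The tangent bound at 2 X is exactly complementary to \<open>w_le\<close>:
        multiplied by n * f t, the two bounds add up to f t.\<close>
      also have "\<dots> \<le> (1 + q / 2 * (2 * X t - 1)) / n"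
        using q_pos q_le n_ge_1 X_nonneg[of t] by (intro divide_right_mono Bernoulli_powr) auto
      finally have "f t * (z t * y t powr (q / 2)) \<le> f t * ((1 + q / 2 * (2 * X t - 1)) / n)"
        using f_nonneg by (rule mult_left_mono)
      then have "n * (f t * (z t * y t powr (q / 2))) \<le> f t * (1 + q / 2 * (2 * X t - 1))"
        using n_ge_1 by (simp add: field_simps)
      then have "n * (w t / 2) \<le> f t + n * (g t * y t powr (q / 2))"
        using w_le[OF that] by (simp add: g_eq algebra_simps)
      then show ?thesis using n_ge_1 by (simp add: field_simps)
    qed
    show "(\<integral>\<^sup>+ t \<in> {a<..}. ennreal (1 / sqrt (y t)) \<partial>lborel) < ennreal d"
    proof (rule nn_integral_Ioi_scale_le)
      show "continuous_on {a<..} (\<lambda>t. 1 / sqrt (W t))" using W(4)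
        by (intro continuous_intros continuous_on_subset[OF W(5)]) (auto simp: less_le)
      show "ennreal (n powr (1 / q) / sqrt q) * (\<integral>\<^sup>+ t \<in> {a<..}. ennreal (1 / sqrt (W t)) \<partial>lborel) < ennreal d"
        using R unfolding R_ii_def W_ii_eq_expint W_def e_def m_def z_def n_eq .
      have "sqrt \<kappa> = sqrt q / n powr (1 / q)"
        using n_ge_1 by (simp add: \<kappa>_def real_sqrt_mult powr_minus_divide real_sqrt_divide powr_powr flip: powr_half_sqrt)
      then show "1 / sqrt (y t) \<le> n powr (1 / q) / sqrt q * (1 / sqrt (W t))" for t
        by (simp add: y_def real_sqrt_mult)
    qed (use q_pos in simp)
  qed
qed

text \<open>The numerical inequality behind the barrier of the third case, with \<^term>\<open>p = q / 2\<close>; it is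
  affine in \<^term>\<open>\<zeta>\<close>, so it suffices to treat \<^term>\<open>\<zeta> \<in> {0, 1}\<close>.\<close>

lemma absorption_inequality:
  fixes p \<theta> \<zeta> :: real
  assumes p: "0 < p" "p \<le> 1" and \<theta>: "0 \<le> \<theta>" "\<theta> \<le> 1" and \<zeta>: "0 \<le> \<zeta>" "\<zeta> \<le> 1"
  shows "p\<^sup>2 * ((1 - \<theta>) ^ 3 / 2) + p / 2 * \<theta> * (1 - \<theta>)\<^sup>2 * (1 - \<zeta>) + \<zeta> * (p * \<theta>) powr (2 * p) \<le> 1"
proof -
  have cube: "(1 - \<theta>) ^ 3 \<le> 1 - \<theta>" using \<theta> power_decreasing[of 1 3 "1 - \<theta>"] by simp
  have p2: "p\<^sup>2 \<le> p" using p by (simp add: power2_eq_square mult_left_le)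
  \<comment> \<open>The endpoint \<zeta> = 1. For 2 p \<le> 1 the power is estimated by its tangent
    at 1; for 2 p > 1 it is at most its base, which is at most 1.\<close>
  have A: "p\<^sup>2 * ((1 - \<theta>) ^ 3 / 2) + (p * \<theta>) powr (2 * p) \<le> 1"
  proof (cases "2 * p \<le> 1")
    case True
    have "(p * \<theta>) powr (2 * p) \<le> 1 + 2 * p * (p * \<theta> - 1)"
      using True p \<theta> by (intro Bernoulli_powr) auto
    moreover have "p\<^sup>2 * ((1 - \<theta>) ^ 3 / 2) \<le> p\<^sup>2 * ((1 - \<theta>) / 2)"
      using cube by (intro mult_left_mono) auto
    moreover have "p\<^sup>2 * \<theta> \<le> p\<^sup>2" using \<theta> by (simp add: mult_left_le)
    moreover have "2 * p * (p * \<theta> - 1) = 2 * (p\<^sup>2 * \<theta>) - 2 * p" by (simp add: algebra_simps power2_eq_square)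
    moreover have "p\<^sup>2 * ((1 - \<theta>) / 2) = p\<^sup>2 / 2 - p\<^sup>2 * \<theta> / 2" by (simp add: algebra_simps diff_divide_distrib)
    ultimately show ?thesis using p2 by linarith
  next
    case False
    have "p * \<theta> \<le> 1" using p \<theta> by (simp add: mult_le_one)
    then have "(p * \<theta>) powr (2 * p) \<le> (p * \<theta>) powr 1"
      using False p \<theta> by (intro powr_mono') auto
    then have "(p * \<theta>) powr (2 * p) \<le> p * \<theta>" using p \<theta> by simp
    moreover have "p\<^sup>2 * ((1 - \<theta>) ^ 3 / 2) \<le> p * (1 - \<theta>)"
      using cube p2 \<theta> p by (intro mult_mono) auto
    ultimately show ?thesis using p by (simp add: algebra_simps)
  qed
  \<comment> \<open>The endpoint \<zeta> = 0: each of the two summands is at most 1 / 2.\<close>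
  have "p\<^sup>2 * ((1 - \<theta>) ^ 3 / 2) \<le> 1 * (1 / 2)"
    using cube p2 \<theta> p by (intro mult_mono) auto
  moreover have "p / 2 * (\<theta> * (1 - \<theta>)\<^sup>2) \<le> 1 / 2 * 1"
    using \<theta> p by (intro mult_mono mult_le_one power_le_one) auto
  ultimately have B: "p\<^sup>2 * ((1 - \<theta>) ^ 3 / 2) + p / 2 * (\<theta> * (1 - \<theta>)\<^sup>2) \<le> 1" by simp
  have "\<zeta> * (p\<^sup>2 * ((1 - \<theta>) ^ 3 / 2) + (p * \<theta>) powr (2 * p))
      + (1 - \<zeta>) * (p\<^sup>2 * ((1 - \<theta>) ^ 3 / 2) + p / 2 * (\<theta> * (1 - \<theta>)\<^sup>2)) \<le> \<zeta> * 1 + (1 - \<zeta>) * 1"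
    using A B \<zeta> by (intro add_mono mult_left_mono) auto
  moreover have "\<zeta> * (a + b) + (1 - \<zeta>) * (a + c) = a + c * (1 - \<zeta>) + \<zeta> * b" for a b c
    by (simp add: algebra_simps)
  ultimately show ?thesis by (simp add: mult.assoc)
qed

text \<open>Here y is prescribed by the radius: 1 / sqrt y must be c times the integrand, so y = P /
  (c^2 (1 + \<gamma>)^2) with \<gamma> = sqrt P * \<beta>. The derivative of y involves \<zeta>, the
  ratio of k / f at t to the quotient G / P of the integrals.\<close>

lemma bound_absorption:
  assumes g: "\<And>t. g t < 0" and R: "R_iii CARD('n) q f g a < ennreal d"
  shows "u x0 \<le> a"
proof -
  define k where "k = (\<lambda>t. neg_part (g t))"
  have k: "continuous_on UNIV k" "antimono k" "\<And>t. k t \<ge> 0"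
    unfolding k_def using neg_part_cont neg_part_antimono neg_part_nonneg by auto
  have k_pos: "k t > 0" for t using g[of t] by (simp add: k_def neg_part_def)
  have g_eq: "g t = - k t" for t using g[of t] by (simp add: k_def neg_part_def)
  define P where "P = (\<lambda>t. integral {a..t} f)"
  define G where "G = (\<lambda>t. integral {a..t} k)"
  have P: "P a = 0" "\<And>t. t \<ge> a \<Longrightarrow> (P has_real_derivative f t) (at t within {a..})" "\<And>t. P t \<ge> 0"
    "\<And>t. t > a \<Longrightarrow> P t > 0" "continuous_on {a..} P"
    unfolding P_def using integral_has_derivative[OF f_cont] integral_Icc_nonneg[OF f_cont f_nonneg]
      integral_Icc_pos[OF f_cont _ f_pos] continuous_on_integral_upper[OF f_cont] by auto
  have G: "\<And>t. t \<ge> a \<Longrightarrow> (G has_real_derivative k t) (at t within {a..})" "\<And>t. G t \<ge> 0"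
    "\<And>t. t > a \<Longrightarrow> G t > 0" "continuous_on {a..} G"
    unfolding G_def using integral_has_derivative[OF k(1)] integral_Icc_nonneg[OF k(1,3)]
      integral_Icc_pos[OF k(1) _ k_pos] continuous_on_integral_upper[OF k(1)] by auto
  have interior: "at t within {a..} = at t" if "t > a" for t
    using that by (intro at_within_interior) simp
  \<comment> \<open>As f is nondecreasing and k nonincreasing, k / f at t is at most the quotient of
    the integrals; this is \<zeta> \<le> 1.\<close>
  have kP_le: "k t * P t \<le> f t * G t" if t: "t > a" for t
  proof -
    have "P t \<le> f t * (t - a)"
    proof -
      have "P t \<le> integral {a..t} (\<lambda>_. f t)" unfolding P_def
        by (intro integral_le integrable_continuous_interval continuous_on_subset[OF f_cont] continuous_intros)
          (auto intro: monoD[OF f_mono'])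
      then show ?thesis using t by (simp add: mult.commute)
    qed
    moreover have "k t * (t - a) \<le> G t"
    proof -
      have "integral {a..t} (\<lambda>_. k t) \<le> G t" unfolding G_def
        by (intro integral_le integrable_continuous_interval continuous_on_subset[OF k(1)] continuous_intros)
          (auto intro: antimonoD[OF k(2)])
      then show ?thesis using t by (simp add: mult.commute)
    qed
    ultimately have "k t * P t \<le> k t * (f t * (t - a))" "f t * (k t * (t - a)) \<le> f t * G t"
      using k(3) f_nonneg by (auto intro!: mult_left_mono)
    then show ?thesis by (simp add: mult_ac)
  qed
  define c where "c = 2 * n powr (1 / q) / q"
  have "c > 0" using q_pos n_ge_1 by (simp add: c_def)
  define p where "p = q / 2"
  have p: "0 < p" "p \<le> 1" using q_pos q_le by (auto simp: p_def)
  \<comment> \<open>After multiplication by n, the Hessian term carries n / c^2 and the gradient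
    term n / c^q. The constant c makes the latter exactly p^q and the former at most p^2.\<close>
  have nc: "n / c\<^sup>2 \<le> p\<^sup>2"
  proof -
    have "(n powr (1 / q))\<^sup>2 = n powr (2 / q)" using power2_powr[of n "1 / q"] by simp
    moreover have "n powr (1 - 2 / q) = n / n powr (2 / q)" using n_ge_1 by (simp add: powr_diff)
    ultimately have "n / c\<^sup>2 = p\<^sup>2 * n powr (1 - 2 / q)"
      by (simp add: c_def p_def power_mult_distrib power_divide)
    also have "\<dots> \<le> p\<^sup>2 * 1" using n_powr_le_1 by (intro mult_left_mono) auto
    finally show ?thesis by simp
  qed
  have nc': "n / c powr q = p powr q"
    using q_pos n_ge_1 by (simp add: c_def p_def powr_divide powr_mult powr_powr)
  define \<beta> where "\<beta> = (\<lambda>t. (G t / P t) powr (1 / q))"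
  define \<gamma> where "\<gamma> = (\<lambda>t. sqrt (P t) * \<beta> t)"
  define \<zeta> where "\<zeta> = (\<lambda>t. k t * P t / (f t * G t))"
  have \<beta>_nonneg: "\<beta> t \<ge> 0" and \<gamma>_nonneg: "\<gamma> t \<ge> 0" for t
    using P(3) by (auto simp: \<beta>_def \<gamma>_def)
  have \<zeta>: "0 \<le> \<zeta> t" "\<zeta> t \<le> 1" if "t \<ge> a" for t
  proof -
    show "0 \<le> \<zeta> t" using k(3) P(3) G(2) f_nonneg by (simp add: \<zeta>_def)
    show "\<zeta> t \<le> 1"
    proof (cases "t = a")
      case False
      then show ?thesis using kP_le[of t] that f_pos[of t] G(3)[of t] by (simp add: \<zeta>_def)
    qed (simp add: \<zeta>_def P(1))
  qed
  define r where "r = (\<lambda>t. 1 / (c\<^sup>2 * (1 + \<gamma> t)\<^sup>2))"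
  define y where "y = (\<lambda>t. P t * r t)"
  define w where "w = (\<lambda>t. f t / c\<^sup>2 * ((1 + 2 * \<gamma> t * (1 - \<zeta> t) / q) / (1 + \<gamma> t) ^ 3))"
  have \<gamma>_a: "\<gamma> a = 0" by (simp add: \<gamma>_def P(1))
  \<comment> \<open>G / P is bounded by k a / f a, so \<gamma> tends to 0 at a although G / P is
    there a quotient 0 / 0.\<close>
  have \<gamma>_le: "\<gamma> t \<le> sqrt (P t) * (k a / f a) powr (1 / q)" if "t > a" for t
  proof -
    have "G t / P t \<le> (k a * (t - a)) / (f a * (t - a))"
      using integral_le_base[OF k(1,2), of a t] integral_ge_tail[OF f_cont f_mono' f_nonneg, of a a t]
        that k(3)[of a] f_pos[of a] by (intro frac_le) (auto simp: G_def P_def)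
    also have "\<dots> = k a / f a" using that by simp
    finally have "\<beta> t \<le> (k a / f a) powr (1 / q)"
      unfolding \<beta>_def using q_pos P(3) G(2) by (intro powr_mono2) auto
    then show ?thesis unfolding \<gamma>_def using P(3) by (intro mult_left_mono) auto
  qed
  have \<gamma>_lim: "(\<gamma> \<longlongrightarrow> 0) (at a within {a..})"
  proof (rule tendsto_sandwich[where f="\<lambda>_. 0" and h="\<lambda>t. sqrt (P t) * (k a / f a) powr (1 / q)"])
    have "(P \<longlongrightarrow> 0) (at a within {a..})"
      using P(5) P(1) by (metis atLeast_iff continuous_on order_refl)
    then have "((\<lambda>t. sqrt (P t) * (k a / f a) powr (1 / q)) \<longlongrightarrow> sqrt 0 * (k a / f a) powr (1 / q)) (at a within {a..})"
      by (intro tendsto_intros)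
    then show "((\<lambda>t. sqrt (P t) * (k a / f a) powr (1 / q)) \<longlongrightarrow> 0) (at a within {a..})" by simp
    show "\<forall>\<^sub>F t in at a within {a..}. \<gamma> t \<le> sqrt (P t) * (k a / f a) powr (1 / q)"
      using \<gamma>_le by (auto simp: eventually_at_filter)
    show "\<forall>\<^sub>F t in at a within {a..}. 0 \<le> \<gamma> t" using \<gamma>_nonneg by simp
  qed simp
  \<comment> \<open>The logarithmic derivative of G / P is k / G - f / P = - (f / P) (1 - \<zeta>),
    and sqrt P contributes f / (2 P).\<close>
  have \<gamma>_deriv: "(\<gamma> has_real_derivative f t / P t * (\<gamma> t / 2 - \<gamma> t * (1 - \<zeta> t) / q)) (at t)" if t: "t > a" for t
  proof -
    have pos: "P t > 0" "G t > 0" "f t > 0" using P(4) G(3) f_pos t by auto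
    have dP: "(P has_real_derivative f t) (at t)" and dG: "(G has_real_derivative k t) (at t)"
      using P(2)[of t] G(1)[of t] t interior[OF t] by auto
    have d\<beta>: "(\<beta> has_real_derivative - (\<beta> t * f t * (1 - \<zeta> t) / (q * P t))) (at t)"
    proof -
      have "((\<lambda>t. G t / P t) has_real_derivative (k t * P t - G t * f t) / (P t * P t)) (at t)"
        using DERIV_divide[OF dG dP] pos by simp
      from DERIV_fun_powr[OF this, of "1 / q"] pos
      have "(\<beta> has_real_derivative 1 / q * (G t / P t) powr (1 / q - 1) * ((k t * P t - G t * f t) / (P t * P t))) (at t)"
        unfolding \<beta>_def by simp
      moreover have "(G t / P t) powr (1 / q - 1) = \<beta> t * P t / G t"
        using pos by (simp add: \<beta>_def powr_diff)
      moreover have "1 / q * (\<beta> t * P t / G t) * ((k t * P t - G t * f t) / (P t * P t))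
          = - (\<beta> t * f t * (1 - \<zeta> t) / (q * P t))"
        using pos q_pos by (simp add: \<zeta>_def field_simps)
      ultimately show ?thesis by simp
    qed
    have "((\<lambda>t. sqrt (P t)) has_real_derivative f t / (2 * sqrt (P t))) (at t)"
      using pos by (auto intro!: derivative_eq_intros dP simp: field_simps)
    from DERIV_mult[OF this d\<beta>]
    have "(\<gamma> has_real_derivative f t / (2 * sqrt (P t)) * \<beta> t + - (\<beta> t * f t * (1 - \<zeta> t) / (q * P t)) * sqrt (P t)) (at t)"
      unfolding \<gamma>_def .
    moreover have "1 / sqrt (P t) = sqrt (P t) / P t"
      using pos by (simp add: field_simps)
    then have "f t / (2 * sqrt (P t)) * \<beta> t = f t * \<beta> t / 2 * (sqrt (P t) / P t)"
      by (metis (no_types, opaque_lifting) mult.commute mult.right_neutral times_divide_eq_left times_divide_times_eq)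
    ultimately show ?thesis
      by (rule_tac DERIV_cong) (auto simp: \<gamma>_def algebra_simps diff_divide_distrib)
  qed
  have \<gamma>_isCont: "isCont \<gamma> t" if "t > a" for t
    by (rule DERIV_isCont[OF \<gamma>_deriv[OF that]])
  have den: "c\<^sup>2 * (1 + \<gamma> t)\<^sup>2 > 0" for t using \<open>c > 0\<close> \<gamma>_nonneg[of t] by simp
  show ?thesis
  proof (rule blow_up[where y=y and w=w and v="\<lambda>t. f t / n"])
    show "continuous_on {a..} w"
      unfolding continuous_on
    proof
      fix t assume "t \<in> {a..}"
      then consider "t = a" | "t > a" by fastforce
      then show "(w \<longlongrightarrow> w t) (at t within {a..})"
      proof cases
        case 1
        \<comment> \<open>The value \<zeta> a = 0 is only the convention for 0 / 0, but in w the
          factor 1 - \<zeta> comes with \<gamma>, which vanishes at a.\<close>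
        have "((\<lambda>t. \<gamma> t * (1 - \<zeta> t)) \<longlongrightarrow> 0) (at a within {a..})"
        proof (rule tendsto_sandwich[OF _ _ tendsto_const \<gamma>_lim])
          show "\<forall>\<^sub>F t in at a within {a..}. 0 \<le> \<gamma> t * (1 - \<zeta> t)"
            using \<gamma>_nonneg \<zeta> by (auto simp: eventually_at_filter)
          have "\<gamma> t * (1 - \<zeta> t) \<le> \<gamma> t" if "t \<ge> a" for t
            using \<gamma>_nonneg \<zeta>[OF that] by (intro mult_left_le) auto
          then show "\<forall>\<^sub>F t in at a within {a..}. \<gamma> t * (1 - \<zeta> t) \<le> \<gamma> t"
            by (simp add: eventually_at_filter)
        qed
        then have "((\<lambda>t. f t / c\<^sup>2 * ((1 + 2 / q * (\<gamma> t * (1 - \<zeta> t))) / (1 + \<gamma> t) ^ 3)) \<longlongrightarrow>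
            f a / c\<^sup>2 * ((1 + 2 / q * 0) / (1 + 0) ^ 3)) (at a within {a..})"
          using f_cont \<open>c > 0\<close>
          by (intro tendsto_intros \<gamma>_lim) (auto simp: continuous_on intro: tendsto_within_subset)
        then show ?thesis using 1 by (simp add: w_def \<gamma>_a mult.assoc)
      next
        case 2
        have "isCont P t" "isCont G t"
          using P(2)[of t] G(1)[of t] 2 interior[OF 2] by (auto intro: DERIV_isCont)
        moreover have "isCont f t" "isCont k t"
          using f_cont k(1) by (auto simp: continuous_on_eq_continuous_at)
        ultimately have "isCont w t"
          unfolding w_def \<zeta>_def using \<gamma>_isCont[OF 2] f_pos[of t] G(3)[OF 2] \<gamma>_nonneg[of t] q_pos \<open>c > 0\<close>
          by (intro continuous_intros) auto
        then show ?thesis using interior[OF 2] by (simp add: isCont_def)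
      qed
    qed
    show "w t > 0" if "t \<ge> a" for t
    proof -
      have "\<gamma> t * (1 - \<zeta> t) \<ge> 0" using \<gamma>_nonneg \<zeta>[OF that] by simp
      then have "1 + 2 * \<gamma> t * (1 - \<zeta> t) / q > 0"
        using q_pos by (intro add_pos_nonneg) (auto simp: mult.assoc)
      then show ?thesis unfolding w_def using \<gamma>_nonneg[of t] f_pos[of t] \<open>c > 0\<close>
        by (intro mult_pos_pos divide_pos_pos) auto
    qed
    show "y a = 0" by (simp add: y_def P(1))
    show "(y has_real_derivative w t) (at t within {a..})" if "t \<ge> a" for t
    proof (cases "t = a")
      case True
      \<comment> \<open>At a the difference quotient of y is that of P times r, so continuity of
        \<gamma> at a suffices.\<close>
      have "((\<lambda>t. (P t - P a) / (t - a)) \<longlongrightarrow> f a) (at a within {a..})"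
        using P(2)[of a] by (simp add: has_field_derivative_iff)
      moreover have "(r \<longlongrightarrow> 1 / (c\<^sup>2 * (1 + 0)\<^sup>2)) (at a within {a..})"
        unfolding r_def using \<open>c > 0\<close> by (intro tendsto_intros \<gamma>_lim) auto
      ultimately have "((\<lambda>t. (P t - P a) / (t - a) * r t) \<longlongrightarrow> f a * (1 / (c\<^sup>2 * (1 + 0)\<^sup>2))) (at a within {a..})"
        by (rule tendsto_mult)
      then show ?thesis
        using True by (simp add: has_field_derivative_iff y_def P(1) w_def \<gamma>_a)
    next
      case False
      then have t: "t > a" using that by simp
      have dP: "(P has_real_derivative f t) (at t)" using P(2)[OF that] interior[OF t] by simp
      have Pt: "P t > 0" by (rule P(4)[OF t])
      define D where "D = f t / P t * (\<gamma> t / 2 - \<gamma> t * (1 - \<zeta> t) / q)"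
      have "((\<lambda>t. c\<^sup>2 * (1 + \<gamma> t)\<^sup>2) has_real_derivative c\<^sup>2 * (2 * (1 + \<gamma> t) * D)) (at t)"
        using \<gamma>_deriv[OF t] by (auto intro!: derivative_eq_intros simp: D_def)
      from DERIV_divide[OF dP this less_imp_neq[OF den, symmetric]]
      have "((\<lambda>t. P t / (c\<^sup>2 * (1 + \<gamma> t)\<^sup>2)) has_real_derivative
          (f t * (c\<^sup>2 * (1 + \<gamma> t)\<^sup>2) - P t * (c\<^sup>2 * (2 * (1 + \<gamma> t) * D))) / ((c\<^sup>2 * (1 + \<gamma> t)\<^sup>2) * (c\<^sup>2 * (1 + \<gamma> t)\<^sup>2))) (at t)"
        .
      moreover have "(f t * (c\<^sup>2 * (1 + \<gamma> t)\<^sup>2) - P t * (c\<^sup>2 * (2 * (1 + \<gamma> t) * D))) / ((c\<^sup>2 * (1 + \<gamma> t)\<^sup>2) * (c\<^sup>2 * (1 + \<gamma> t)\<^sup>2)) = w t"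
      proof -
        define e where "e = 1 + \<gamma> t"
        have "e > 0" using \<gamma>_nonneg[of t] by (simp add: e_def)
        have PD: "P t * D = f t * (\<gamma> t / 2 - \<gamma> t * (1 - \<zeta> t) / q)" using Pt by (simp add: D_def)
        have "f t * (c\<^sup>2 * e\<^sup>2) - P t * (c\<^sup>2 * (2 * e * D)) = c\<^sup>2 * e * (f t * e - 2 * (P t * D))"
          by (simp add: algebra_simps power2_eq_square)
        also have "f t * e - 2 * (P t * D) = f t * (1 + 2 * \<gamma> t * (1 - \<zeta> t) / q)"
          unfolding PD by (simp add: e_def algebra_simps diff_divide_distrib)
        finally show ?thesis
          unfolding w_def e_def[symmetric] using \<open>e > 0\<close> \<open>c > 0\<close>
          by (simp add: power2_eq_square power3_eq_cube)
      qed
      ultimately show ?thesis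
        unfolding interior[OF t] y_def r_def by simp
    qed
    show "mono_on {a..} (\<lambda>t. f t / n)"
      using n_ge_1 by (auto intro!: monotone_onI divide_right_mono monoD[OF f_mono'])
    have super: "n * w t / 2 \<le> f t - n * (k t * y t powr (q / 2))" if "t \<ge> a" for t
    proof -
      \<comment> \<open>The share of \<beta> in 1 / sqrt P + \<beta>. In terms of \<theta> and
        \<zeta>, the integrals P and G disappear, and after division by f only
        \<open>absorption_inequality\<close> remains.\<close>
      define \<theta> where "\<theta> = \<gamma> t / (1 + \<gamma> t)"
      have \<theta>: "0 \<le> \<theta>" "\<theta> \<le> 1" "1 - \<theta> = 1 / (1 + \<gamma> t)"
        using \<gamma>_nonneg[of t] by (auto simp: \<theta>_def field_simps)
      have ky: "n * (k t * y t powr (q / 2)) = f t * (\<zeta> t * (p * \<theta>) powr (2 * p))"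
      proof (cases "t = a")
        case True
        then show ?thesis using q_pos by (simp add: y_def P(1) \<zeta>_def)
      next
        case False
        then have pos: "P t > 0" "G t > 0" using P(4) G(3) that by auto
        have "y t = (sqrt (P t) / (c * (1 + \<gamma> t)))\<^sup>2"
          using pos by (simp add: y_def r_def power_divide power_mult_distrib)
        then have "y t powr (q / 2) = (sqrt (P t) / (c * (1 + \<gamma> t))) powr q"
          using \<gamma>_nonneg[of t] \<open>c > 0\<close> pos by (simp add: power2_powr_half)
        moreover have "\<beta> t powr q = G t / P t"
          using pos q_pos by (simp add: \<beta>_def powr_powr)
        then have "k t = f t * \<zeta> t * \<beta> t powr q"
          using pos f_pos[of t] by (simp add: \<zeta>_def)
        ultimately have "n * (k t * y t powr (q / 2)) = f t * \<zeta> t * (n * (\<beta> t powr q * (sqrt (P t) / (c * (1 + \<gamma> t))) powr q))"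
          by simp
        also have "\<beta> t powr q * (sqrt (P t) / (c * (1 + \<gamma> t))) powr q = (\<beta> t * (sqrt (P t) / (c * (1 + \<gamma> t)))) powr q"
          by (rule powr_mult[symmetric])
        also have "\<beta> t * (sqrt (P t) / (c * (1 + \<gamma> t))) = \<theta> / c"
          by (simp add: \<theta>_def \<gamma>_def mult.commute)
        also have "n * (\<theta> / c) powr q = n / c powr q * \<theta> powr q"
          using \<theta>(1) \<open>c > 0\<close> by (simp add: powr_divide)
        also have "\<dots> = (p * \<theta>) powr (2 * p)"
          unfolding nc' powr_mult[symmetric] by (simp add: p_def)
        finally show ?thesis by simp
      qed
      have s: "1 / 2 + \<gamma> t * (1 - \<zeta> t) / q \<ge> 0"
        using \<gamma>_nonneg[of t] \<zeta>[OF that] q_pos by simp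
      have "n * w t / 2 = f t * (n / c\<^sup>2 * ((1 / 2 + \<gamma> t * (1 - \<zeta> t) / q) / (1 + \<gamma> t) ^ 3))"
        by (simp add: w_def field_simps)
      also have "\<dots> \<le> f t * (p\<^sup>2 * ((1 / 2 + \<gamma> t * (1 - \<zeta> t) / q) / (1 + \<gamma> t) ^ 3))"
        using nc s f_nonneg[of t] \<gamma>_nonneg[of t] by (intro mult_left_mono mult_right_mono) auto
      also have "p\<^sup>2 * ((1 / 2 + \<gamma> t * (1 - \<zeta> t) / q) / (1 + \<gamma> t) ^ 3)
          = p\<^sup>2 * ((1 - \<theta>) ^ 3 / 2) + p / 2 * \<theta> * (1 - \<theta>)\<^sup>2 * (1 - \<zeta> t)"
      proof -
        have "p\<^sup>2 * ((1 / 2 + x * (1 - z) / q) / e ^ 3) = p\<^sup>2 * ((1 / e) ^ 3 / 2) + p / 2 * (x / e) * (1 / e)\<^sup>2 * (1 - z)"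
          if "e > 0" for e x z
          using that q_pos by (simp add: p_def field_simps power2_eq_square power3_eq_cube)
        from this[of "1 + \<gamma> t"] show ?thesis
          unfolding \<theta>(3) unfolding \<theta>_def using \<gamma>_nonneg[of t] by simp
      qed
      finally have "n * w t / 2 \<le> f t * (p\<^sup>2 * ((1 - \<theta>) ^ 3 / 2) + p / 2 * \<theta> * (1 - \<theta>)\<^sup>2 * (1 - \<zeta> t))" .
      moreover have "f t * (p\<^sup>2 * ((1 - \<theta>) ^ 3 / 2) + p / 2 * \<theta> * (1 - \<theta>)\<^sup>2 * (1 - \<zeta> t) + \<zeta> t * (p * \<theta>) powr (2 * p)) \<le> f t * 1"
        using absorption_inequality[OF p \<theta>(1,2) \<zeta>[OF that]] f_nonneg by (rule mult_left_mono)
      ultimately show ?thesis unfolding ky by (simp add: distrib_left)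
    qed
    show "w t / 2 \<le> f t / n" if "t \<ge> a" for t
    proof -
      have "n * (k t * y t powr (q / 2)) \<ge> 0" using n_ge_1 k(3)[of t] by simp
      then have "n * w t / 2 \<le> f t" using super[OF that] by linarith
      then show ?thesis using n_ge_1 by (simp add: field_simps)
    qed
    show "w t / 2 + (n - 1) * (f t / n) \<le> f t + g t * y t powr (q / 2)" if "t \<ge> a" for t
      using super[OF that] n_ge_1 by (simp add: g_eq field_simps)
    show "(\<integral>\<^sup>+ t \<in> {a<..}. ennreal (1 / sqrt (y t)) \<partial>lborel) < ennreal d"
    proof (rule nn_integral_Ioi_scale_le)
      show "continuous_on {a<..} (\<lambda>t. 1 / sqrt (P t) + \<beta> t)" unfolding \<beta>_def using P(3,4) G(2) q_pos
        by (intro continuous_intros continuous_on_powr' continuous_on_subset[OF P(5)] continuous_on_subset[OF G(4)])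
          (auto simp: less_le)
      show "ennreal c * (\<integral>\<^sup>+ t \<in> {a<..}. ennreal (1 / sqrt (P t) + \<beta> t) \<partial>lborel) < ennreal d"
        using R by (simp add: R_iii_def c_def \<beta>_def P_def G_def k_def n_eq)
      fix t assume t: "t > a"
      have "sqrt (y t) = sqrt (P t) / (c * (1 + \<gamma> t))"
        using \<open>c > 0\<close> \<gamma>_nonneg[of t] by (simp add: y_def r_def real_sqrt_mult real_sqrt_divide)
      then have "1 / sqrt (y t) = c * (1 / sqrt (P t) + \<gamma> t / sqrt (P t))"
        by (simp add: add_divide_distrib distrib_left)
      also have "\<gamma> t / sqrt (P t) = \<beta> t" using P(4)[OF t] by (simp add: \<gamma>_def)
      finally show "1 / sqrt (y t) \<le> c * (1 / sqrt (P t) + \<beta> t)" by simp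
    qed (use \<open>c > 0\<close> in simp)
  qed
qed

section \<open>The estimates\<close>

lemma pos_part_growth:
  assumes f_lim: "lim_top g < \<infinity> \<Longrightarrow> filterlim f at_top at_top"
  shows "filterlim f at_top at_top \<or> filterlim (\<lambda>t. pos_part (g t)) at_top at_top"
proof (cases "lim_top g < \<infinity>")
  case False
  then have "filterlim (\<lambda>t. pos_part (g t)) at_top at_top"
    by (intro filterlim_at_top_mono[OF lim_top_infinite[OF g_mono]]) (auto simp: pos_part_def)
  then show ?thesis ..
qed (use f_lim in simp)

lemma lim_top_pos:
  assumes "lim_top g > 0"
  obtains b where "a \<le> b" "pos_part (g b) > 0"
proof -
  obtain s where "g s > 0"
    using assms unfolding lim_top_eq_SUP[OF g_mono] by (auto simp: less_SUP_iff)
  then have "g (max a s) > 0" using monoD[OF g_mono, of s "max a s"] by simp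
  then show thesis by (intro that[of "max a s"]) (auto simp: pos_part_def)
qed

text \<open>Links a kernel with base a to the hypotheses, which involve t * h t. For s > 4 |a| the
  point s / 4 is to the right of a, and the rest of the interval, from s / 4 to a + s, is longer
  than s / 4.\<close>

lemma quarter_le_integral:
  fixes h :: "real \<Rightarrow> real"
  assumes "continuous_on UNIV h" "mono h" "\<And>t. h t \<ge> 0" "s > 4 * \<bar>a\<bar>"
  shows "1 / 4 * s * h (1 / 4 * s) \<le> integral {a..a + s} h"
proof -
  have "1 / 4 * s * h (1 / 4 * s) \<le> h (1 / 4 * s) * (a + s - 1 / 4 * s)"
    using assms(3)[of "1 / 4 * s"] assms(4) by (subst mult.commute, intro mult_left_mono) auto
  also have "\<dots> \<le> integral {a..a + s} h"
    using assms(4) by (intro integral_ge_tail assms(1-3)) auto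
  finally show ?thesis .
qed

section \<open>Finiteness of the tails\<close>

lemma drift_tail_sublinear:
  assumes "q \<le> 1" and fin: "(\<integral>\<^sup>+ t \<in> {0<..}. ennreal (1 / (sqrt (t * f t)
            + (t * pos_part (g t)) powr (1 / (2 - q)))) \<partial>lborel) < \<infinity>"
  shows "finite_tail (\<lambda>s. 1 / (sqrt (integral {a..a + s} f)
            + (integral {a..a + s} (\<lambda>t. pos_part (g t))) powr (1 / (2 - q))))"
proof -
  define h where "h = (\<lambda>t. 1 / (sqrt (t * f t) + (t * pos_part (g t)) powr (1 / (2 - q))))"
  have pos: "sqrt (t * f t) + (t * pos_part (g t)) powr (1 / (2 - q)) > 0" if "t > 0" for t
    using that f_pos by (intro add_pos_nonneg) auto
  have cont: "continuous_on {0<..} h"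
    unfolding h_def using pos pos_part_nonneg \<open>q \<le> 1\<close>
    by (intro continuous_intros continuous_on_powr' continuous_on_subset[OF f_cont] continuous_on_subset[OF pos_part_cont])
      (auto simp: less_le)
  have le: "1 / (sqrt (integral {a..a + s} f) + (integral {a..a + s} (\<lambda>t. pos_part (g t))) powr (1 / (2 - q)))
      \<le> 1 * h (0 + 1 / 4 * s)" if s: "s > 4 * \<bar>a\<bar>" for s
  proof -
    have "s > 0" using s by simp
    have "sqrt (1 / 4 * s * f (1 / 4 * s)) \<le> sqrt (integral {a..a + s} f)"
      by (rule real_sqrt_le_mono[OF quarter_le_integral[OF f_cont f_mono' f_nonneg s]])
    moreover have "(1 / 4 * s * pos_part (g (1 / 4 * s))) powr (1 / (2 - q))
        \<le> (integral {a..a + s} (\<lambda>t. pos_part (g t))) powr (1 / (2 - q))"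
      using quarter_le_integral[OF pos_part_cont pos_part_mono pos_part_nonneg s] \<open>s > 0\<close> \<open>q \<le> 1\<close>
        pos_part_nonneg
      by (intro powr_mono2) auto
    ultimately have den: "sqrt (1 / 4 * s * f (1 / 4 * s)) + (1 / 4 * s * pos_part (g (1 / 4 * s))) powr (1 / (2 - q))
        \<le> sqrt (integral {a..a + s} f) + (integral {a..a + s} (\<lambda>t. pos_part (g t))) powr (1 / (2 - q))"
      by (rule add_mono)
    show ?thesis
      unfolding h_def add_0 mult_1 using pos[of "1 / 4 * s"] \<open>s > 0\<close> by (intro frac_le den) auto
  qed
  show ?thesis
  proof (rule finite_tailI[OF _ _ le])
    show "continuous_on {4 * \<bar>a\<bar><..} (\<lambda>s. h (0 + 1 / 4 * s))"
      by (intro continuous_on_compose2[OF cont] continuous_intros) auto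
    show "(\<integral>\<^sup>+ s \<in> {4 * \<bar>a\<bar><..}. ennreal (h (0 + 1 / 4 * s)) \<partial>lborel) < \<infinity>"
      using fin by (intro nn_integral_tail_affine_finite[OF cont]) (auto simp: h_def)
  qed auto
qed

text \<open>For q > 1 the exponent 1 / (2 - q) exceeds 1, and the integral of g^+ grows at least
  linearly beyond a point where g is positive. This is why (i) has an integral condition for q \<le>
  1 only.\<close>

lemma drift_tail_superlinear:
  assumes "1 < q" "q < 2" and lim: "lim_top g > 0"
  shows "finite_tail (\<lambda>s. 1 / (sqrt (integral {a..a + s} f)
            + (integral {a..a + s} (\<lambda>t. pos_part (g t))) powr (1 / (2 - q))))"
proof -
  obtain b where b: "a \<le> b" "pos_part (g b) > 0" using lim_top_pos[OF lim] .
  define \<sigma> where "\<sigma> = 1 / (2 - q)"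
  have "\<sigma> > 1" using assms by (simp add: \<sigma>_def)
  define B where "B = 1 / (pos_part (g b) / 2) powr \<sigma>"
  define L where "L = 2 * (b - a) + 1"
  have le: "1 / (sqrt (integral {a..a + s} f) + (integral {a..a + s} (\<lambda>t. pos_part (g t))) powr \<sigma>)
      \<le> B * s powr - \<sigma>" if s: "s > L" for s
  proof -
    have "s > 0" using s b by (simp add: L_def)
    have "pos_part (g b) / 2 * s = pos_part (g b) * (s / 2)" by simp
    also have "\<dots> \<le> pos_part (g b) * (a + s - b)"
      using s b by (intro mult_left_mono) (auto simp: L_def)
    also have "\<dots> \<le> integral {a..a + s} (\<lambda>t. pos_part (g t))"
      using s b by (intro integral_ge_tail pos_part_cont pos_part_mono pos_part_nonneg) (auto simp: L_def)
    finally have "(pos_part (g b) / 2 * s) powr \<sigma> \<le> (integral {a..a + s} (\<lambda>t. pos_part (g t))) powr \<sigma>"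
      using b \<open>s > 0\<close> \<open>\<sigma> > 1\<close> by (intro powr_mono2) auto
    moreover have "sqrt (integral {a..a + s} f) \<ge> 0"
      using integral_Icc_nonneg[OF f_cont f_nonneg] by simp
    ultimately have den: "(pos_part (g b) / 2 * s) powr \<sigma>
        \<le> sqrt (integral {a..a + s} f) + (integral {a..a + s} (\<lambda>t. pos_part (g t))) powr \<sigma>"
      by linarith
    have "1 / (sqrt (integral {a..a + s} f) + (integral {a..a + s} (\<lambda>t. pos_part (g t))) powr \<sigma>)
        \<le> 1 / (pos_part (g b) / 2 * s) powr \<sigma>"
      using b \<open>s > 0\<close> by (intro frac_le den) auto
    also have "\<dots> = B * s powr - \<sigma>"
      unfolding B_def powr_mult by (simp add: powr_minus_divide)
    finally show ?thesis .
  qed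
  show ?thesis unfolding \<sigma>_def[symmetric]
  proof (rule finite_tailI[OF _ _ le])
    show "L \<ge> 0" using b by (simp add: L_def)
    show "B \<ge> 0" by (simp add: B_def)
    show "continuous_on {L<..} (\<lambda>s. s powr - \<sigma>)"
      using b by (intro continuous_intros) (auto simp: L_def)
    show "(\<integral>\<^sup>+ s \<in> {L<..}. ennreal (s powr - \<sigma>) \<partial>lborel) < \<infinity>"
      using \<open>\<sigma> > 1\<close> b by (intro nn_integral_powr_tail_finite) (auto simp: L_def)
  qed auto
qed

text \<open>The weight grows exponentially beyond a point b with g b > 0. Its quadratic Taylor term
  times the linear factor is already cubic in s, and s powr (-3/2) is integrable.\<close>

lemma quadratic_drift_tail:
  assumes lim: "lim_top g > 0"
  shows "finite_tail (\<lambda>s. 1 / sqrt (expint (\<lambda>t. 2 / n * pos_part (g t)) f a (a + s)))"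
proof -
  define e where "e = (\<lambda>t. 2 / n * pos_part (g t))"
  have e: "continuous_on UNIV e" "mono e"
    unfolding e_def using pos_part_cont monoD[OF pos_part_mono] n_ge_1
    by (auto intro!: continuous_intros monoI divide_right_mono)
  obtain b where b: "a \<le> b" "pos_part (g b) > 0" using lim_top_pos[OF lim] .
  then have eb: "e b > 0" using n_ge_1 by (simp add: e_def)
  \<comment> \<open>The 64 collects s / 2 from the linear factor and (e b * s / 4)^2 / 2 from the
    Taylor term.\<close>
  define c where "c = f b * (e b)\<^sup>2 / 64"
  have "c > 0" using f_pos[of b] eb by (simp add: c_def)
  define L where "L = 2 * (b - a) + 1"
  have le: "1 / sqrt (expint e f a (a + s)) \<le> 1 / sqrt c * s powr (-3/2)" if s: "s > L" for s
  proof -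
    have "s > 0" and half: "s / 2 \<le> a + s - b" using s b by (auto simp: L_def)
    have "c * s ^ 3 = f b * (s / 2) * ((e b * (s / 2) / 2)\<^sup>2 / 2)"
      by (simp add: c_def power2_eq_square power3_eq_cube)
    also have "\<dots> \<le> f b * (s / 2) * exp (e b * (s / 2) / 2)"
    proof -
      have "0 \<le> e b * (s / 2) / 2" using eb \<open>s > 0\<close> by simp
      from exp_lower_Taylor_quadratic[OF this] this
      have "(e b * (s / 2) / 2)\<^sup>2 / 2 \<le> exp (e b * (s / 2) / 2)" by linarith
      then show ?thesis using f_nonneg \<open>s > 0\<close> by (intro mult_left_mono) auto
    qed
    also have "\<dots> \<le> f b * (a + s - b) * exp (e b * (a + s - b) / 2)"
      using half f_nonneg[of b] eb \<open>s > 0\<close>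
      by (intro mult_mono) (auto intro!: mult_left_mono)
    also have "\<dots> \<le> expint e f a (a + s)"
      using b half \<open>s > 0\<close> by (intro expint_ge_tail e f_cont f_mono' f_nonneg) auto
    finally have "sqrt (c * s ^ 3) \<le> sqrt (expint e f a (a + s))" by (rule real_sqrt_le_mono)
    then have "1 / sqrt (expint e f a (a + s)) \<le> 1 / sqrt (c * s ^ 3)"
      using \<open>c > 0\<close> \<open>s > 0\<close> by (intro frac_le) auto
    also have "sqrt (s ^ 3) = s powr (3 / 2)"
      using \<open>s > 0\<close> by (simp add: powr_powr flip: powr_half_sqrt powr_numeral)
    then have "1 / sqrt (c * s ^ 3) = 1 / sqrt c * s powr (-3/2)"
      by (simp add: real_sqrt_mult powr_minus_divide)
    finally show ?thesis .
  qed
  show ?thesis unfolding e_def[symmetric]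
  proof (rule finite_tailI[OF _ _ le])
    show "L \<ge> 0" using b by (simp add: L_def)
    show "1 / sqrt c \<ge> 0" using \<open>c > 0\<close> by simp
    show "continuous_on {L<..} (\<lambda>s. s powr (-3/2))"
      using b by (intro continuous_intros) (auto simp: L_def)
    show "(\<integral>\<^sup>+ s \<in> {L<..}. ennreal (s powr (-3/2)) \<partial>lborel) < \<infinity>"
      using b by (intro nn_integral_powr_tail_finite) (auto simp: L_def)
  qed auto
qed

lemma estimate_i:
  assumes f_lim: "lim_top g < \<infinity> \<Longrightarrow> filterlim f at_top at_top"
    and lim: "lim_top g > 0"
    and cond: "\<not> (q \<le> 1 \<and> (\<integral>\<^sup>+ t \<in> {0<..}. ennreal (1 / (sqrt (t * f t)
            + (t * pos_part (g t)) powr (1 / (2 - q)))) \<partial>lborel) = \<infinity>)"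
  shows "ereal (u x0) \<le> max (Inf (ereal ` {t. g t \<ge> 0})) (R_inv (R_i CARD('n) q f g) d)"
proof -
  \<comment> \<open>The origin of t_0 in (i): the barriers start only at heights a with g a \<ge>
    0.\<close>
  have g_nonneg: "g a \<ge> 0" if a: "Inf (ereal ` {t. g t \<ge> 0}) < ereal a" for a
  proof -
    obtain t where "g t \<ge> 0" "t < a" using a by (auto simp: Inf_less_iff)
    then show ?thesis using monoD[OF g_mono, of t a] by simp
  qed
  show ?thesis
  proof (cases "q = 2")
    case True
    define e where "e = (\<lambda>t. 2 / n * pos_part (g t))"
    have "filterlim e at_top at_top" if "filterlim (\<lambda>t. pos_part (g t)) at_top at_top"
      unfolding e_def using n_ge_1
      by (intro filterlim_tendsto_pos_mult_at_top[OF tendsto_const _ that]) simp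
    then have "filterlim f at_top at_top \<or> filterlim e at_top at_top"
      using pos_part_growth[OF f_lim] by blast
    moreover have "continuous_on UNIV e" "mono e"
      unfolding e_def using pos_part_cont monoD[OF pos_part_mono] n_ge_1
      by (auto intro!: continuous_intros monoI divide_right_mono)
    ultimately show ?thesis
      using quadratic_drift_tail[OF lim] bound_quadratic_drift[OF True g_nonneg] n_ge_1
      by (intro expint_R_inv_bound[where e=e and f=f and C="sqrt (n / 2)"] f_cont f_mono f_pos d_pos
          R_i_eq_expint[OF True, folded e_def]) (auto simp: e_def)
  next
    case False
    then have q: "q < 2" using q_le by simp
    have tail: "finite_tail (\<lambda>s. 1 / (sqrt (integral {a..a + s} f)
            + (integral {a..a + s} (\<lambda>t. pos_part (g t))) powr (1 / (2 - q))))" for a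
      using drift_tail_sublinear drift_tail_superlinear[OF _ q lim] cond
      by (cases "q \<le> 1") (auto simp: top.not_eq_extremum)
    show ?thesis
    proof (rule drift_R_inv_bound[OF f_cont f_mono f_pos pos_part_cont pos_part_mono pos_part_nonneg _
          pos_part_growth[OF f_lim] tail _ _ d_pos])
      show "R_i CARD('n) q f g a = ennreal (2 * (n / (2 - q)) powr (1 / (2 - q))) *
        (\<integral>\<^sup>+ t \<in> {a<..}. ennreal (1 / (sqrt (integral {a..t} f)
            + (integral {a..t} (\<lambda>s. pos_part (g s))) powr (1 / (2 - q)))) \<partial>lborel)" for a
        using q by (simp add: R_i_def n_eq)
      show "u x0 \<le> a" if "Inf (ereal ` {t. g t \<ge> 0}) < ereal a" "R_i CARD('n) q f g a < ennreal d" for a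
        using bound_drift[OF q g_nonneg[OF that(1)] that(2)] .
    qed (use q n_ge_1 in auto)
  qed
qed

lemma estimate_ii:
  assumes f_lim: "filterlim f at_top at_top" and lim: "lim_top g = 0"
    and fin: "(\<integral>\<^sup>+ t \<in> {0<..}. ennreal (1 / sqrt (W_ii q f g 0 t)) \<partial>lborel) < \<infinity>"
  shows "ereal (u x0) \<le> R_inv (R_ii CARD('n) q f g) d"
proof -
  define e where "e = (\<lambda>t. - 2 * ((neg_part (g t) / f t) powr (2 / q) * f t))"
  have e: "continuous_on UNIV e" "mono e"
    unfolding e_def using damping_cont damping_mono by auto
  have W_eq: "W_ii q f g a t = expint e f a t" for a t
    unfolding W_ii_eq_expint e_def ..
  have g: "g t \<le> 0" for t
  proof -
    have "ereal (g t) \<le> lim_top g" unfolding lim_top_eq_SUP[OF g_mono] by (rule SUP_upper) simp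
    then show ?thesis using lim by simp
  qed
  define h where "h = (\<lambda>t. 1 / sqrt (expint e f 0 t))"
  have pos: "expint e f a t > 0" if "a < t" for a t by (rule expint_pos[OF e(1) f_cont that f_pos])
  have cont: "continuous_on {0<..} h"
    unfolding h_def using pos[of 0]
    by (intro continuous_intros continuous_on_subset[OF continuous_on_expint[OF e(1) f_cont]]) (auto simp: less_le)
  have tail: "finite_tail (\<lambda>s. 1 / sqrt (expint e f a (a + s)))" for a
  proof -
    \<comment> \<open>The hypothesis has base 0. Lowering the base to a' increases the weighted
      integral at a fixed endpoint, and translating from a' up to a increases it at a fixed length
      s.\<close>
    define a' where "a' = min a 0"
    have le: "1 / sqrt (expint e f a (a + s)) \<le> 1 * h (a' + 1 * s)" if s: "s > \<bar>a\<bar>" for s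
    proof -
      have *: "0 < a' + s" "a' \<le> 0" "a' \<le> a" "s \<ge> 0" using s by (auto simp: a'_def)
      have "expint e f 0 (a' + s) \<le> expint e f a' (a' + s)"
        using * by (intro expint_antimono_base[OF e(1) f_cont] f_nonneg) auto
      also have "\<dots> \<le> expint e f a (a + s)"
        using * by (intro expint_shift_mono(1)[OF e(1) f_cont e(2) f_nonneg] f_mono')
      finally show ?thesis using pos[OF *(1)] by (simp add: h_def frac_le)
    qed
    show ?thesis
    proof (rule finite_tailI[OF _ _ le])
      show "continuous_on {\<bar>a\<bar><..} (\<lambda>s. h (a' + 1 * s))"
        by (intro continuous_on_compose2[OF cont] continuous_intros) (auto simp: a'_def)
      show "(\<integral>\<^sup>+ s \<in> {\<bar>a\<bar><..}. ennreal (h (a' + 1 * s)) \<partial>lborel) < \<infinity>"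
        using fin by (intro nn_integral_tail_affine_finite[OF cont]) (auto simp: h_def W_eq a'_def)
    qed auto
  qed
  \<comment> \<open>The barrier is available at every height a, so the threshold \<tau> is -
    \<infinity>.\<close>
  have "ereal (u x0) \<le> max (- \<infinity>) (R_inv (R_ii CARD('n) q f g) d)"
  proof (rule expint_R_inv_bound[OF e f_cont f_mono f_pos _ tail _ _ d_pos])
    show "R_ii CARD('n) q f g a = ennreal (n powr (1 / q) / sqrt q) *
        (\<integral>\<^sup>+ t \<in> {a<..}. ennreal (1 / sqrt (expint e f a t)) \<partial>lborel)" for a
      by (simp add: R_ii_def W_eq n_eq)
    show "u x0 \<le> a" if "R_ii CARD('n) q f g a < ennreal d" for a
      by (rule bound_damped[OF g that])
  qed (use f_lim q_pos n_ge_1 in auto)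
  then show ?thesis by simp
qed

lemma estimate_iii:
  assumes f_lim: "filterlim f at_top at_top" and lim: "lim_top g < 0"
    and fin: "(\<integral>\<^sup>+ t \<in> {0<..}. ennreal (1 / sqrt (t * f t) + 1 / f t powr (1 / q)) \<partial>lborel) < \<infinity>"
  shows "ereal (u x0) \<le> R_inv (R_iii CARD('n) q f g) d"
proof -
  define k where "k = (\<lambda>t. neg_part (g t))"
  have k: "continuous_on UNIV k" "antimono k" "\<And>t. k t \<ge> 0"
    unfolding k_def using neg_part_cont neg_part_antimono neg_part_nonneg by auto
  have g: "g t < 0" for t
  proof -
    have "ereal (g t) \<le> lim_top g" unfolding lim_top_eq_SUP[OF g_mono] by (rule SUP_upper) simp
    then have "ereal (g t) < 0" using lim by (rule le_less_trans)
    then show ?thesis by simp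
  qed
  define h where "h = (\<lambda>t. 1 / sqrt (t * f t) + 1 / f t powr (1 / q))"
  have f_ne: "f t \<noteq> 0" for t using f_pos[of t] by simp
  have cont: "continuous_on {0<..} h"
    unfolding h_def using f_ne f_nonneg
    by (intro continuous_intros continuous_on_powr' continuous_on_subset[OF f_cont]) auto
  have tail: "finite_tail (\<lambda>s. 1 / sqrt (integral {a..a + s} f) + (integral {a..a + s} k / integral {a..a + s} f) powr (1 / q))" for a
  proof -
    \<comment> \<open>With t = s / 4 the integral of k is at most k a * s = 4 * k a * t, and
      division by t * f t leaves 4 * k a / f t.\<close>
    define B where "B = 1 + (4 * k a) powr (1 / q)"
    have le: "1 / sqrt (integral {a..a + s} f) + (integral {a..a + s} k / integral {a..a + s} f) powr (1 / q)
        \<le> B * h (0 + 1 / 4 * s)" if s: "s > 4 * \<bar>a\<bar>" for s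
    proof -
      define t where "t = 1 / 4 * s"
      have "t > 0" using s by (simp add: t_def)
      have P: "t * f t \<le> integral {a..a + s} f"
        unfolding t_def by (rule quarter_le_integral[OF f_cont f_mono' f_nonneg s])
      have tf: "t * f t > 0" using \<open>t > 0\<close> f_pos by simp
      have 1: "1 / sqrt (integral {a..a + s} f) \<le> 1 / sqrt (t * f t)"
        using P tf by (intro frac_le) auto
      have "integral {a..a + s} k / integral {a..a + s} f \<le> (k a * s) / (t * f t)"
        using integral_le_base[OF k(1,2), of a "a + s"] P tf k(3)[of a] \<open>t > 0\<close>
        by (intro frac_le) (auto simp: t_def)
      also have "\<dots> = 4 * k a / f t" using \<open>t > 0\<close> by (simp add: t_def)
      finally have "(integral {a..a + s} k / integral {a..a + s} f) powr (1 / q) \<le> (4 * k a / f t) powr (1 / q)"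
        using integral_Icc_nonneg[OF k(1,3)] integral_Icc_nonneg[OF f_cont f_nonneg] q_pos
        by (intro powr_mono2) auto
      also have "\<dots> = (4 * k a) powr (1 / q) * (1 / f t powr (1 / q))"
        using k(3)[of a] f_nonneg[of t] by (simp add: powr_divide)
      finally have 2: "(integral {a..a + s} k / integral {a..a + s} f) powr (1 / q) \<le> (4 * k a) powr (1 / q) * (1 / f t powr (1 / q))" .
      have "0 \<le> (4 * k a) powr (1 / q) * (1 / sqrt (t * f t))" "0 \<le> 1 / f t powr (1 / q)"
        using tf by auto
      with 1 2 have "1 / sqrt (integral {a..a + s} f) + (integral {a..a + s} k / integral {a..a + s} f) powr (1 / q) \<le> B * h t"
        unfolding B_def h_def distrib_left distrib_right by linarith
      then show ?thesis by (simp add: t_def)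
    qed
    show ?thesis
    proof (rule finite_tailI[where L="4 * \<bar>a\<bar>", OF _ _ le])
      show "B \<ge> 0" by (simp add: B_def add_nonneg_nonneg)
      show "continuous_on {4 * \<bar>a\<bar><..} (\<lambda>s. h (0 + 1 / 4 * s))"
        by (intro continuous_on_compose2[OF cont] continuous_intros) auto
      show "(\<integral>\<^sup>+ s \<in> {4 * \<bar>a\<bar><..}. ennreal (h (0 + 1 / 4 * s)) \<partial>lborel) < \<infinity>"
        using fin by (intro nn_integral_tail_affine_finite[OF cont]) (auto simp: h_def)
    qed auto
  qed
  have "ereal (u x0) \<le> max (- \<infinity>) (R_inv (R_iii CARD('n) q f g) d)"
  proof (rule absorption_R_inv_bound[OF f_cont f_mono f_pos k _ f_lim tail _ _ d_pos])
    show "R_iii CARD('n) q f g a = ennreal (2 * n powr (1 / q) / q) *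
        (\<integral>\<^sup>+ t \<in> {a<..}. ennreal (1 / sqrt (integral {a..t} f) + (integral {a..t} k / integral {a..t} f) powr (1 / q)) \<partial>lborel)" for a
      by (simp add: R_iii_def k_def n_eq)
    show "u x0 \<le> a" if "R_iii CARD('n) q f g a < ennreal d" for a
      by (rule bound_absorption[OF g that])
  qed (use q_pos n_ge_1 in auto)
  then show ?thesis by simp
qed

end

text \<open>A ball is connected: if it met both \<Omega> and the complement, it would contain a
  frontier point nearer to x than the distance permits.\<close>

lemma ball_infdist_frontier_subset:
  fixes x :: "'a::euclidean_space"
  assumes "x \<in> \<Omega>"
  shows "ball x (infdist x (frontier \<Omega>)) \<subseteq> \<Omega>"
proof (rule ccontr)
  let ?B = "ball x (infdist x (frontier \<Omega>))"
  assume "\<not> ?B \<subseteq> \<Omega>"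
  then have diff: "?B - \<Omega> \<noteq> {}" by blast
  then have "x \<in> ?B" by (metis Diff_eq_empty_iff ball_eq_empty centre_in_ball empty_subsetI not_le)
  then have "?B \<inter> \<Omega> \<noteq> {}" using assms by blast
  then have "?B \<inter> frontier \<Omega> \<noteq> {}"
    using diff by (intro connected_Int_frontier) auto
  then obtain z where "z \<in> frontier \<Omega>" "dist x z < infdist x (frontier \<Omega>)" by auto
  then show False using infdist_le[of z "frontier \<Omega>" x] by simp
qed

theorem theorem3p6:
  fixes f g :: "real \<Rightarrow> real"
    and F :: "real^'n \<Rightarrow> real^'n^'n \<Rightarrow> real"
    and \<Omega> :: "(real^'n) set"
    and q :: real
    and u :: "real^'n \<Rightarrow> real"
  assumes f_cont: "continuous_on UNIV f" and g_cont: "continuous_on UNIV g"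
    and f_mono: "strict_mono f" and g_mono: "mono g"
    and f_pos: "\<And>t. f t > 0"
    and f_lim: "lim_top g < \<infinity> \<Longrightarrow> filterlim f at_top at_top"
    and \<Omega>_open: "open \<Omega>" and \<Omega>_conn: "connected \<Omega>" and \<Omega>_ne: "\<Omega> \<noteq> {}"
    and bdry: "frontier \<Omega> \<noteq> {}"
    and q: "0 < q" "q \<le> 2"
    and F: "admissible_F F"
    and u_usc: "usc_on \<Omega> u"
    and u_sub: "visc_subsol F f g q \<Omega> u"
  shows
   "(lim_top g > 0 \<and>
     \<not> (q \<le> 1 \<and> (\<integral>\<^sup>+ t \<in> {0<..}. ennreal (1 / (sqrt (t * f t)
            + (t * pos_part (g t)) powr (1 / (2 - q)))) \<partial>lborel) = \<infinity>)
     \<longrightarrow> (\<forall>x\<in>\<Omega>. ereal (u x) \<le> max (Inf (ereal ` {t. g t \<ge> 0}))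
                      (R_inv (R_i CARD('n) q f g) (infdist x (frontier \<Omega>)))))
  \<and> (lim_top g = 0 \<and>
     (\<integral>\<^sup>+ t \<in> {0<..}. ennreal (1 / sqrt (W_ii q f g 0 t)) \<partial>lborel) < \<infinity>
     \<longrightarrow> (\<forall>x\<in>\<Omega>. ereal (u x) \<le> R_inv (R_ii CARD('n) q f g) (infdist x (frontier \<Omega>))))
  \<and> (lim_top g < 0 \<and>
     (\<integral>\<^sup>+ t \<in> {0<..}. ennreal (1 / sqrt (t * f t) + 1 / f t powr (1 / q)) \<partial>lborel) < \<infinity>
     \<longrightarrow> (\<forall>x\<in>\<Omega>. ereal (u x) \<le> R_inv (R_iii CARD('n) q f g) (infdist x (frontier \<Omega>))))"
proof -
  have sub: "subsolution f g F \<Omega> q u x (infdist x (frontier \<Omega>)) (real CARD('n))" if "x \<in> \<Omega>" for x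
  proof
    have "x \<notin> frontier \<Omega>" using that \<Omega>_open by (simp add: frontier_def interior_open)
    then show "infdist x (frontier \<Omega>) > 0"
      using bdry by (intro infdist_pos_not_in_closed) auto
  qed (use assms ball_infdist_frontier_subset[OF that] in auto)
  show ?thesis
  proof (intro conjI impI ballI; elim conjE)
    fix x assume "x \<in> \<Omega>" "lim_top g > 0" "\<not> (q \<le> 1 \<and> (\<integral>\<^sup>+ t \<in> {0<..}. ennreal (1 / (sqrt (t * f t)
            + (t * pos_part (g t)) powr (1 / (2 - q)))) \<partial>lborel) = \<infinity>)"
    then show "ereal (u x) \<le> max (Inf (ereal ` {t. g t \<ge> 0})) (R_inv (R_i CARD('n) q f g) (infdist x (frontier \<Omega>)))"
      by (intro subsolution.estimate_i[OF sub] f_lim)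
  next
    fix x assume "x \<in> \<Omega>" and lim: "lim_top g = 0"
      and "(\<integral>\<^sup>+ t \<in> {0<..}. ennreal (1 / sqrt (W_ii q f g 0 t)) \<partial>lborel) < \<infinity>"
    moreover have "filterlim f at_top at_top" by (rule f_lim) (simp add: lim)
    ultimately show "ereal (u x) \<le> R_inv (R_ii CARD('n) q f g) (infdist x (frontier \<Omega>))"
      by (intro subsolution.estimate_ii[OF sub])
  next
    fix x assume "x \<in> \<Omega>" and lim: "lim_top g < 0"
      and "(\<integral>\<^sup>+ t \<in> {0<..}. ennreal (1 / sqrt (t * f t) + 1 / f t powr (1 / q)) \<partial>lborel) < \<infinity>"
    moreover have "filterlim f at_top at_top" using lim by (intro f_lim) (auto intro: less_trans)
    ultimately show "ereal (u x) \<le> R_inv (R_iii CARD('n) q f g) (infdist x (frontier \<Omega>))"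
      by (intro subsolution.estimate_iii[OF sub])
  qed
qed

end
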